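(* All Lie algebras are real. (1) In dimension $2$ there is a single nilpotent Lie algebra up to isomorphism (the abelian one). It admits a bi-Lagrangian structure. (2) In dimension $4$ there are exactly three nilpotent Lie algebras up to isomorphism, namely $A_4$, $L_3\oplus A_1$ and $L_4$, each of which admits a symplectic form. Two of them, $A_4$ and $L_3\oplus A_1$, admit a bi-Lagrangian structure, and one of them, $L_4$, does not. (3) In dimension $6$ there are exactly $26$ nilpotent Lie algebras up to isomorphism that admit a symplectic form, namely the $26$ Lie algebras listed in the context. Exactly $16$ of them admit a bi-Lagrangian structure, namely $A_6$, $L_3\oplus A_3$, $L_{5,2}\oplus A_1$, $L_3\oplus L_3$, $L_{6,1}$, $L_{6,2}$, $L_{5,3}\oplus A_1$, $L_{6,4}$, $L_{6,5}$, $L_{6,6}$, $L_{6,9}$, $L_{6,10}$, $L_{6,11}$, $L_{6,12}$, $L_{5,4}\oplus A_1$, $L_{6,16}$, and the remaining $10$, namely $L_4\oplus A_2$, $L_{6,13}$, $L_{5,6}\oplus A_1$, $L_{6,14}$, $L_{6,15}$, $L_{6,17}^+$, $L_{6,17}^-$, $L_{6,18}$, $L_{6,19}$, $L_{6,21}$, do not admit a bi-Lagrangian structure (for any symplectic form).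
   Context: Let $\mathfrak{g}$ be a finite-dimensional real Lie algebra. A symplectic form on $\mathfrak{g}$ is a closed, non-degenerate $2$-form $\omega\in\Lambda^2\mathfrak{g}^*$ (closed with respect to the Chevalley–Eilenberg differential, i.e. $\omega([X,Y],Z)+\omega([Y,Z],X)+\omega([Z,X],Y)=0$ for all $X,Y,Z$). A bi-Lagrangian structure on $\mathfrak{g}$ consists of a symplectic form $\omega$ and two Lie subalgebras $\mathcal{F},\mathcal{G}\subset\mathfrak{g}$, both Lagrangian for $\omega$ (of dimension $\frac12\dim\mathfrak{g}$ and with $\omega$ vanishing on them), such that $\mathfrak{g}=\mathcal{F}\oplus\mathcal{G}$ as vector spaces. Notation: $e_1,\dots,e_n$ is a basis of $\mathfrak{g}$, $\alpha_1,\dots,\alpha_n$ the dual basis, $\alpha_{ij}=\alpha_i\wedge\alpha_j$, and the Lie bracket is encoded by $d\alpha_i(e_j,e_k)=-\alpha_i([e_j,e_k])$. In all lists $d\alpha_1=d\alpha_2=0$. Dimension $4$, listed as $(d\alpha_3,d\alpha_4)$: $A_4$: $(0,0)$; $L_3\oplus A_1$: $(0,\alpha_{12})$; $L_4$: $(\alpha_{12},\alpha_{13})$. Dimension $6$, listed as $(d\alpha_3,d\alpha_4,d\alpha_5,d\alpha_6)$: $A_6$: $(0,0,0,0)$; $L_3\oplus A_3$: $(0,0,0,\alpha_{12})$; $L_{5,2}\oplus A_1$: $(0,0,\alpha_{12},\alpha_{13})$; $L_3\oplus L_3$: $(0,0,\alpha_{12},\alpha_{34})$; $L_{6,1}$: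 $(0,0,\alpha_{12},\alpha_{13}+\alpha_{24})$; $L_{6,2}$: $(0,0,\alpha_{13}-\alpha_{24},\alpha_{14}+\alpha_{23})$; $L_4\oplus A_2$: $(0,0,\alpha_{12},\alpha_{15})$; $L_{5,3}\oplus A_1$: $(0,0,\alpha_{12},\alpha_{15}+\alpha_{23})$; $L_{6,4}$: $(0,\alpha_{12},\alpha_{13},\alpha_{23})$; $L_{6,5}$: $(0,\alpha_{12},\alpha_{13},\alpha_{14})$; $L_{6,6}$: $(0,\alpha_{12},\alpha_{13},\alpha_{24})$; $L_{6,9}$: $(0,\alpha_{12},\alpha_{13},\alpha_{14}+\alpha_{23})$; $L_{6,10}$: $(0,\alpha_{12},\alpha_{14},\alpha_{23}+\alpha_{24})$; $L_{6,11}$: $(0,\alpha_{12},\alpha_{14},\alpha_{13}+\alpha_{24})$; $L_{6,12}$: $(0,\alpha_{12},\alpha_{14}+\alpha_{23},\alpha_{13}-\alpha_{24})$; $L_{5,4}\oplus A_1$: $(0,\alpha_{12},\alpha_{14},\alpha_{15})$; $L_{6,13}$: $(0,\alpha_{12},\alpha_{14},\alpha_{15}+\alpha_{23})$; $L_{5,6}\oplus A_1$: $(0,\alpha_{12},\alpha_{14},\alpha_{15}+\alpha_{24})$; $L_{6,14}$: $(0,\alpha_{12},\alpha_{14},\alpha_{15}+\alpha_{23}+\alpha_{24})$; $L_{6,15}$: $(0,\alpha_{12},\alpha_{14}+\alpha_{23},\alpha_{15}-\alpha_{34})$; $L_{6,16}$: $(\alpha_{12},\alpha_{13},\alpha_{23},\alpha_{14})$;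 $L_{6,17}^+$: $(\alpha_{12},\alpha_{13},\alpha_{23},\alpha_{14}+\alpha_{25})$; $L_{6,17}^-$: $(\alpha_{12},\alpha_{13},\alpha_{23},\alpha_{14}-\alpha_{25})$; $L_{6,18}$: $(\alpha_{12},\alpha_{13},\alpha_{14},\alpha_{15})$; $L_{6,19}$: $(\alpha_{12},\alpha_{13},\alpha_{14},\alpha_{15}+\alpha_{23})$; $L_{6,21}$: $(\alpha_{12},\alpha_{13},\alpha_{14}+\alpha_{23},\alpha_{15}+\alpha_{24})$. *)

theory Defs
  imports "HOL-Analysis.Analysis" "HOL-Library.Function_Algebras"
begin

text \<open>
  A Lie algebra is a bracket on a whole type of class \<open>real_vector\<close>. Its dimension is
  \<open>dim UNIV\<close>; since \<open>dim\<close> is \<open>0\<close> for infinite-dimensional spaces, an assumption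
  \<open>dim UNIV = n\<close> with \<open>n > 0\<close> includes finite-dimensionality.
\<close>

locale lie_algebra =
  fixes br :: "'a::real_vector \<Rightarrow> 'a \<Rightarrow> 'a"
  assumes bilinear_bracket: "bilinear br"
    and bracket_self: "br x x = 0"
    and jacobi: "br (br x y) z + br (br y z) x + br (br z x) y = 0"

fun lower_central_series :: "('a::real_vector \<Rightarrow> 'a \<Rightarrow> 'a) \<Rightarrow> nat \<Rightarrow> 'a set" where
  "lower_central_series br 0 = UNIV"
| "lower_central_series br (Suc k) = span {br x y |x y. y \<in> lower_central_series br k}"

definition nilpotent_lie_algebra :: "('a::real_vector \<Rightarrow> 'a \<Rightarrow> 'a) \<Rightarrow> bool" where
  "nilpotent_lie_algebra br \<longleftrightarrow>
     lie_algebra br \<and> (\<exists>k. lower_central_series br k = {0})"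

definition lie_isomorphic ::
  "('a::real_vector \<Rightarrow> 'a \<Rightarrow> 'a) \<Rightarrow> ('b::real_vector \<Rightarrow> 'b \<Rightarrow> 'b) \<Rightarrow> bool" where
  "lie_isomorphic br br' \<longleftrightarrow>
     (\<exists>\<phi>. linear \<phi> \<and> bij \<phi> \<and> (\<forall>x y. \<phi> (br x y) = br' (\<phi> x) (\<phi> y)))"

definition symplectic_form ::
  "('a::real_vector \<Rightarrow> 'a \<Rightarrow> 'a) \<Rightarrow> ('a \<Rightarrow> 'a \<Rightarrow> real) \<Rightarrow> bool" where
  "symplectic_form br \<omega> \<longleftrightarrow>
     bilinear \<omega> \<and> (\<forall>x. \<omega> x x = 0) \<and>
     (\<forall>x y z. \<omega> (br x y) z + \<omega> (br y z) x + \<omega> (br z x) y = 0) \<and>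
     (\<forall>x. (\<forall>y. \<omega> x y = 0) \<longrightarrow> x = 0)"

definition lie_subalgebra :: "('a::real_vector \<Rightarrow> 'a \<Rightarrow> 'a) \<Rightarrow> 'a set \<Rightarrow> bool" where
  "lie_subalgebra br F \<longleftrightarrow> subspace F \<and> (\<forall>x\<in>F. \<forall>y\<in>F. br x y \<in> F)"

definition lagrangian :: "('a::real_vector \<Rightarrow> 'a \<Rightarrow> real) \<Rightarrow> 'a set \<Rightarrow> bool" where
  "lagrangian \<omega> F \<longleftrightarrow>
     subspace F \<and> 2 * dim F = dim (UNIV :: 'a set) \<and> (\<forall>x\<in>F. \<forall>y\<in>F. \<omega> x y = 0)"

definition bi_lagrangian_structure ::
  "('a::real_vector \<Rightarrow> 'a \<Rightarrow> 'a) \<Rightarrow> ('a \<Rightarrow> 'a \<Rightarrow> real) \<Rightarrow> 'a set \<Rightarrow> 'a set \<Rightarrow> bool" where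
  "bi_lagrangian_structure br \<omega> F G \<longleftrightarrow>
     symplectic_form br \<omega> \<and>
     lie_subalgebra br F \<and> lagrangian \<omega> F \<and>
     lie_subalgebra br G \<and> lagrangian \<omega> G \<and>
     F \<inter> G = {0} \<and> (\<forall>x. \<exists>y\<in>F. \<exists>z\<in>G. x = y + z)"

definition admits_symplectic :: "('a::real_vector \<Rightarrow> 'a \<Rightarrow> 'a) \<Rightarrow> bool" where
  "admits_symplectic br \<longleftrightarrow> (\<exists>\<omega>. symplectic_form br \<omega>)"

definition admits_bi_lagrangian :: "('a::real_vector \<Rightarrow> 'a \<Rightarrow> 'a) \<Rightarrow> bool" where
  "admits_bi_lagrangian br \<longleftrightarrow> (\<exists>\<omega> F G. bi_lagrangian_structure br \<omega> F G)"


text \<open>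
  The listed Lie algebras live on \<open>real ^ n\<close> with the standard basis \<open>axis i 1\<close> for
  \<open>i = 1, \<dots>, n\<close>. The index type \<open>n\<close> is a numeral type, whose numerals are read modulo \<open>n\<close>;
  thus \<open>1, \<dots>, n\<close> are its distinct elements, and the last one equals \<open>0\<close>.
  The form \<open>\<alpha> i j\<close> is the wedge product of the \<open>i\<close>-th and \<open>j\<close>-th dual basis elements.
  Sums and differences of 2-forms, and the form \<open>0\<close>, are pointwise (\<open>Function_Algebras\<close>).
\<close>

type_synonym 'n form2 = "real ^ 'n \<Rightarrow> real ^ 'n \<Rightarrow> real"

definition \<alpha> :: "'n::finite \<Rightarrow> 'n \<Rightarrow> 'n form2" where
  "\<alpha> i j x y = x $ i * y $ j - x $ j * y $ i"

text \<open>
  The bracket whose structure equations are \<open>d (\<alpha>\<^sub>i) = d i\<close>. The sign comes from the convention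
  \<open>d (\<alpha>\<^sub>i) (x, y) = - \<alpha>\<^sub>i ([x, y])\<close>.
\<close>

definition bracket_of :: "('n::finite \<Rightarrow> 'n form2) \<Rightarrow> real ^ 'n \<Rightarrow> real ^ 'n \<Rightarrow> real ^ 'n" where
  "bracket_of d x y = (\<chi> i. - d i x y)"

type_synonym 'n bracket = "real ^ 'n \<Rightarrow> real ^ 'n \<Rightarrow> real ^ 'n"

definition lie4 :: "4 form2 \<Rightarrow> 4 form2 \<Rightarrow> 4 bracket" where
  "lie4 d3 d4 = bracket_of ((\<lambda>_. 0)(3 := d3, 4 := d4))"

definition lie6 :: "6 form2 \<Rightarrow> 6 form2 \<Rightarrow> 6 form2 \<Rightarrow> 6 form2 \<Rightarrow> 6 bracket" where
  "lie6 d3 d4 d5 d6 = bracket_of ((\<lambda>_. 0)(3 := d3, 4 := d4, 5 := d5, 6 := d6))"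

text \<open>In the names below, \<open>S\<close> separates direct summands.\<close>

definition A2 :: "2 bracket" where "A2 = bracket_of (\<lambda>_. 0)"

definition "A4 = lie4 0 0"
definition "L3_S_A1 = lie4 0 (\<alpha> 1 2)"
definition "L4 = lie4 (\<alpha> 1 2) (\<alpha> 1 3)"

definition "A6 = lie6 0 0 0 0"
definition "L3_S_A3 = lie6 0 0 0 (\<alpha> 1 2)"
definition "L5_2_S_A1 = lie6 0 0 (\<alpha> 1 2) (\<alpha> 1 3)"
definition "L3_S_L3 = lie6 0 0 (\<alpha> 1 2) (\<alpha> 3 4)"
definition "L6_1 = lie6 0 0 (\<alpha> 1 2) (\<alpha> 1 3 + \<alpha> 2 4)"
definition "L6_2 = lie6 0 0 (\<alpha> 1 3 - \<alpha> 2 4) (\<alpha> 1 4 + \<alpha> 2 3)"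
definition "L4_S_A2 = lie6 0 0 (\<alpha> 1 2) (\<alpha> 1 5)"
definition "L5_3_S_A1 = lie6 0 0 (\<alpha> 1 2) (\<alpha> 1 5 + \<alpha> 2 3)"
definition "L6_4 = lie6 0 (\<alpha> 1 2) (\<alpha> 1 3) (\<alpha> 2 3)"
definition "L6_5 = lie6 0 (\<alpha> 1 2) (\<alpha> 1 3) (\<alpha> 1 4)"
definition "L6_6 = lie6 0 (\<alpha> 1 2) (\<alpha> 1 3) (\<alpha> 2 4)"
definition "L6_9 = lie6 0 (\<alpha> 1 2) (\<alpha> 1 3) (\<alpha> 1 4 + \<alpha> 2 3)"
definition "L6_10 = lie6 0 (\<alpha> 1 2) (\<alpha> 1 4) (\<alpha> 2 3 + \<alpha> 2 4)"
definition "L6_11 = lie6 0 (\<alpha> 1 2) (\<alpha> 1 4) (\<alpha> 1 3 + \<alpha> 2 4)"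
definition "L6_12 = lie6 0 (\<alpha> 1 2) (\<alpha> 1 4 + \<alpha> 2 3) (\<alpha> 1 3 - \<alpha> 2 4)"
definition "L5_4_S_A1 = lie6 0 (\<alpha> 1 2) (\<alpha> 1 4) (\<alpha> 1 5)"
definition "L6_13 = lie6 0 (\<alpha> 1 2) (\<alpha> 1 4) (\<alpha> 1 5 + \<alpha> 2 3)"
definition "L5_6_S_A1 = lie6 0 (\<alpha> 1 2) (\<alpha> 1 4) (\<alpha> 1 5 + \<alpha> 2 4)"
definition "L6_14 = lie6 0 (\<alpha> 1 2) (\<alpha> 1 4) (\<alpha> 1 5 + \<alpha> 2 3 + \<alpha> 2 4)"
definition "L6_15 = lie6 0 (\<alpha> 1 2) (\<alpha> 1 4 + \<alpha> 2 3) (\<alpha> 1 5 - \<alpha> 3 4)"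
definition "L6_16 = lie6 (\<alpha> 1 2) (\<alpha> 1 3) (\<alpha> 2 3) (\<alpha> 1 4)"
definition "L6_17_plus = lie6 (\<alpha> 1 2) (\<alpha> 1 3) (\<alpha> 2 3) (\<alpha> 1 4 + \<alpha> 2 5)"
definition "L6_17_minus = lie6 (\<alpha> 1 2) (\<alpha> 1 3) (\<alpha> 2 3) (\<alpha> 1 4 - \<alpha> 2 5)"
definition "L6_18 = lie6 (\<alpha> 1 2) (\<alpha> 1 3) (\<alpha> 1 4) (\<alpha> 1 5)"
definition "L6_19 = lie6 (\<alpha> 1 2) (\<alpha> 1 3) (\<alpha> 1 4) (\<alpha> 1 5 + \<alpha> 2 3)"
definition "L6_21 = lie6 (\<alpha> 1 2) (\<alpha> 1 3) (\<alpha> 1 4 + \<alpha> 2 3) (\<alpha> 1 5 + \<alpha> 2 4)"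

definition nilpotent_4 :: "4 bracket set" where
  "nilpotent_4 = {A4, L3_S_A1, L4}"

definition symplectic_nilpotent_6 :: "6 bracket set" where
  "symplectic_nilpotent_6 =
    {A6, L3_S_A3, L5_2_S_A1, L3_S_L3, L6_1, L6_2, L4_S_A2,
     L5_3_S_A1, L6_4, L6_5, L6_6, L6_9, L6_10, L6_11,
     L6_12, L5_4_S_A1, L6_13, L5_6_S_A1, L6_14, L6_15, L6_16,
     L6_17_plus, L6_17_minus, L6_18, L6_19, L6_21}"

end

theory Submission
  imports Defs
begin

text \<open>
  The proof rests on coframes. In a nilpotent Lie algebra one can choose linear functionals \<open>f\<^sub>1,
  \<dots>, f\<^sub>n\<close>, a basis of the dual space, such that the differential of \<open>f\<^sub>k\<close> only involves \<open>f\<^sub>1, \<dots>,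
  f\<^sub>k\<^sub>-\<^sub>1\<close> (\<open>nilpotent_has_flag\<close>): otherwise some subspace \<open>W \<noteq> 0\<close> would satisfy \<open>W \<subseteq> [\<gg>, W]\<close> and
  survive in the whole lower central series. The algebra is then known from a short list of
  2-forms, and classifying it means simplifying these forms by a change of coframe.

  \<^bold>\<open>Classification.\<close> The condition \<open>d\<^sup>2 = 0\<close> and changes of the coframe leave three possibilities
  for the first four structure equations (\<open>first_four_differentials\<close>), which settles dimension
  four, and nine possibilities for the first five. A nilpotent algebra of dimension six is
  therefore one of nine algebras of dimension five together with a closed 2-form as last structure
  equation; for each of the nine, a lemma \<open>completion_\<dots>\<close> brings this 2-form into a normal form.
  Most case distinctions there concern a quadratic form or a pencil of 2-forms, whose type over
  the reals (rank, signature, number of real roots) is the invariant that matters. Without further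
  assumptions there are 34 algebras. A symplectic form excludes eight of them: its closedness on
  triples of basis vectors is a linear system for its coefficients, whose solutions either have
  the last basis vector in the radical (\<open>form6_last_coefficients\<close>) or vanish on a subspace of
  dimension four (\<open>form6_no_isotropic_tail\<close>), with one case where another basis vector is in the
  radical.

  \<^bold>\<open>Distinctness.\<close> The dimensions of four characteristic subspaces separate all listed algebras up
  to five small groups; within each group a property formulated in terms of the bracket decides
  (\<open>isomorphic_listed_eq\<close>).

  \<^bold>\<open>Existence of bi-Lagrangian structures.\<close> An explicit symplectic form and two complementary
  coordinate subspaces, in suitable linear coordinates, suffice (\<open>bi_lagrangianI\<close>).

  \<^bold>\<open>Obstruction.\<close> Let \<open>K\<close> be a Lagrangian subalgebra of dimension three. It cannot contain
  independent vectors \<open>x, y, [x, y], [x, [x, y]]\<close> (\<open>no_bracket_chain\<close>). As the two subalgebras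
  span the algebra, one of them contains a vector \<open>x\<close> with nonzero first coordinate, and then the
  chain condition pushes its vectors with first coordinate zero deep into the lower central
  series. For five of the ten algebras this already contradicts that the symplectic form vanishes
  on \<open>K\<close>, since it pairs the end of the series with \<open>x\<close>. For the other five the relative position
  of the two subalgebras has to be taken into account.
\<close>

section \<open>Linear algebra and isomorphisms\<close>

text \<open>Induction on the functionals: each of them costs at most one vector, so that \<open>S\<close> is
  spanned by at most \<open>card I\<close> vectors modulo the common zeros.\<close>

lemma exists_common_zero:
  fixes f :: "'i \<Rightarrow> 'a::real_vector \<Rightarrow> real"
  assumes S: "subspace S" and "finite I" and "\<And>i. i \<in> I \<Longrightarrow> linear (f i)" and card: "card I < dim S"
  shows "\<exists>x\<in>S. x \<noteq> 0 \<and> (\<forall>i\<in>I. f i x = 0)"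
proof -
  have "\<exists>E. finite E \<and> card E \<le> card I \<and>
      (\<forall>x\<in>S. \<exists>s\<in>span E. x - s \<in> S \<and> (\<forall>i\<in>I. f i (x - s) = 0))"
    using assms(2,3)
  proof (induction I)
    case empty
    then show ?case
      by (intro exI[of _ "{}"]) simp
  next
    case (insert j I)
    then obtain E where E: "finite E" "card E \<le> card I"
      and dec: "\<forall>x\<in>S. \<exists>s\<in>span E. x - s \<in> S \<and> (\<forall>i\<in>I. f i (x - s) = 0)"
      by auto
    have lin: "linear (f j)" "\<And>i. i \<in> I \<Longrightarrow> linear (f i)"
      using insert.prems by auto
    show ?case
    proof (cases "\<forall>x\<in>S. (\<forall>i\<in>I. f i x = 0) \<longrightarrow> f j x = 0")
      case True
      have "card E \<le> card (insert j I)"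
        using E insert.hyps by simp
      then show ?thesis
        using E dec True by (intro exI[of _ E]) fastforce
    next
      case False
      then obtain w where w: "w \<in> S" "\<And>i. i \<in> I \<Longrightarrow> f i w = 0" "f j w \<noteq> 0"
        by auto
      have "\<exists>s\<in>span (insert w E). x - s \<in> S \<and> (\<forall>i\<in>insert j I. f i (x - s) = 0)" if x: "x \<in> S" for x
      proof -
        obtain s where s: "s \<in> span E" "x - s \<in> S" "\<And>i. i \<in> I \<Longrightarrow> f i (x - s) = 0"
          using dec x by blast
        define c where "c = f j (x - s) / f j w"
        have "s + c *\<^sub>R w \<in> span (insert w E)"
          using s(1) by (meson span_add span_base span_scale insertI1 span_mono subset_insertI subsetD)
        moreover have "x - (s + c *\<^sub>R w) = (x - s) - c *\<^sub>R w"
          by simp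
        moreover have "(x - s) - c *\<^sub>R w \<in> S"
          using S s(2) w(1) by (simp add: subspace_diff subspace_scale)
        moreover have "f i ((x - s) - c *\<^sub>R w) = 0" if "i \<in> insert j I" for i
          using that lin s(3) w by (auto simp: linear_diff linear_scale c_def)
        ultimately show ?thesis
          by metis
      qed
      moreover have "card (insert w E) \<le> card (insert j I)"
        using E insert.hyps by (simp add: card_insert_if)
      ultimately show ?thesis
        using E by (intro exI[of _ "insert w E"]) auto
    qed
  qed
  then obtain E where E: "finite E" "card E \<le> card I"
    and dec: "\<And>x. x \<in> S \<Longrightarrow> \<exists>s\<in>span E. x - s \<in> S \<and> (\<forall>i\<in>I. f i (x - s) = 0)"
    by auto
  show ?thesis
  proof (rule ccontr)
    assume "\<not> ?thesis"
    then have "S \<subseteq> span E"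
      using dec by fastforce
    then show False
      using dim_le_card[of S E] E card by simp
  qed
qed

lemma dim_linear_bij_image:
  fixes \<phi> :: "'a::real_vector \<Rightarrow> 'b::real_vector"
  assumes "linear \<phi>" "inj \<phi>"
  shows "dim (\<phi> ` S) = dim S"
proof -
  obtain B where B: "B \<subseteq> S" "independent B" "S \<subseteq> span B" "card B = dim S"
    using basis_exists by blast
  have "\<phi> ` S \<subseteq> span (\<phi> ` B)"
    using B(3) assms(1) by (metis image_mono linear_span_image)
  moreover have "independent (\<phi> ` B)"
    using B(2) assms by (intro linear_independent_injective_image) (auto intro: inj_on_subset)
  moreover have "card (\<phi> ` B) = dim S"
    using B(4) assms(2) by (metis card_image inj_on_subset subset_UNIV)
  ultimately show ?thesis
    using B(1) by (intro dim_unique[of "\<phi> ` B"]) auto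
qed

text \<open>A positive dimension is the size of a finite basis, whereas \<open>dim\<close> is \<open>0\<close> by default on a
  space of infinite dimension.\<close>

lemma independent_spans_if_card_eq_dim:
  fixes E :: "'a::real_vector set"
  assumes "independent E" "card E = dim (UNIV :: 'a set)" "dim (UNIV :: 'a set) > 0"
  shows "span E = UNIV"
proof (rule ccontr)
  assume "span E \<noteq> UNIV"
  then obtain x where x: "x \<notin> span E" by blast
  obtain B :: "'a set" where B: "UNIV \<subseteq> span B" "card B = dim (UNIV :: 'a set)"
    using basis_exists by blast
  have "independent (insert x E)" "x \<notin> E"
    using x assms(1) by (auto simp: independent_insert span_base)
  moreover have "finite B" "finite E"
    using B(2) assms by (auto intro: card_ge_0_finite)
  ultimately show False
    using independent_span_bound[of B "insert x E"] B assms(2) by auto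
qed

lemma linear_injective_imp_bij:
  fixes \<phi> :: "'a::real_vector \<Rightarrow> real ^ 'n"
  assumes "linear \<phi>" "\<And>x. \<phi> x = 0 \<Longrightarrow> x = 0" "dim (UNIV :: 'a set) = CARD('n)"
  shows "bij \<phi>"
proof -
  have inj: "inj \<phi>"
    using assms(1,2) by (simp add: linear_injective_0)
  have "dim (range \<phi>) = CARD('n)"
    using dim_linear_bij_image[OF assms(1) inj] assms(3) by simp
  then have "span (range \<phi>) = UNIV"
    using dim_eq_full[of "range \<phi>"] by simp
  moreover have "span (range \<phi>) = range \<phi>"
    using assms(1) by (metis linear_span_image span_UNIV)
  ultimately show ?thesis
    using inj by (simp add: bij_def)
qed

lemma linear_inv_of_bij:
  assumes "linear \<phi>" "bij \<phi>"
  shows "linear (inv \<phi>)"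
proof (rule linearI)
  have eq: "inv \<phi> u = v" if "u = \<phi> v" for u v
    using that assms(2) by (simp add: bij_is_inj)
  have surj: "\<phi> (inv \<phi> u) = u" for u
    using assms(2) by (simp add: bij_is_surj surj_f_inv_f)
  show "inv \<phi> (u + v) = inv \<phi> u + inv \<phi> v" "inv \<phi> (c *\<^sub>R u) = c *\<^sub>R inv \<phi> u" for u v c
    using assms(1) by (intro eq; simp add: linear_add linear_scale surj)+
qed

lemma lie_isomorphic_trans:
  assumes "lie_isomorphic b b'" "lie_isomorphic b' b''"
  shows "lie_isomorphic b b''"
proof -
  obtain \<phi> \<psi> where "linear \<phi>" "bij \<phi>" "\<And>x y. \<phi> (b x y) = b' (\<phi> x) (\<phi> y)"
      and "linear \<psi>" "bij \<psi>" "\<And>x y. \<psi> (b' x y) = b'' (\<psi> x) (\<psi> y)"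
    using assms unfolding lie_isomorphic_def by metis
  then show ?thesis
    unfolding lie_isomorphic_def
    by (intro exI[of _ "\<psi> \<circ> \<phi>"]) (simp add: linear_compose bij_comp)
qed

lemma lie_isomorphic_sym:
  assumes "lie_isomorphic b b'"
  shows "lie_isomorphic b' b"
proof -
  obtain \<phi> where \<phi>: "linear \<phi>" "bij \<phi>" "\<And>x y. \<phi> (b x y) = b' (\<phi> x) (\<phi> y)"
    using assms unfolding lie_isomorphic_def by metis
  have "linear (inv \<phi>)"
    using \<phi> by (simp add: linear_inv_of_bij)
  moreover have "inv \<phi> (b' x y) = b (inv \<phi> x) (inv \<phi> y)" for x y
    using \<phi> by (metis bij_inv_eq_iff)
  ultimately show ?thesis
    using \<phi> unfolding lie_isomorphic_def by (meson bij_imp_bij_inv)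
qed

lemma lie_algebra_transfer:
  assumes "lie_algebra b" "lie_isomorphic b b'"
  shows "lie_algebra b'"
proof -
  obtain \<psi> where \<psi>: "linear \<psi>" "bij \<psi>" "\<And>x y. \<psi> (b' x y) = b (\<psi> x) (\<psi> y)"
    using lie_isomorphic_sym[OF assms(2)] unfolding lie_isomorphic_def by metis
  interpret lie_algebra b by fact
  have b': "b' x y = inv \<psi> (b (\<psi> x) (\<psi> y))" for x y
    using \<psi> by (metis bij_inv_eq_iff)
  have lin: "linear (inv \<psi>)"
    using \<psi> by (simp add: linear_inv_of_bij)
  show ?thesis
  proof
    have "linear (\<lambda>y. b (\<psi> x) (\<psi> y))" "linear (\<lambda>y. b (\<psi> y) (\<psi> x))" for x
      using bilinear_bracket \<psi>(1) linear_compose[of \<psi>]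
      by (auto simp: bilinear_def o_def)
    then show "bilinear b'"
      using lin linear_compose[of _ "inv \<psi>"] by (auto simp: bilinear_def b' o_def)
    fix x y z
    have inj: "u = 0" if "\<psi> u = 0" for u
      using that \<psi> by (metis bij_is_inj injD linear_0)
    show "b' x x = 0"
      by (rule inj) (simp add: \<psi> bracket_self)
    show "b' (b' x y) z + b' (b' y z) x + b' (b' z x) y = 0"
      by (rule inj) (simp add: \<psi> linear_add[OF \<psi>(1)] jacobi)
  qed
qed

lemma admits_symplectic_transfer:
  assumes "admits_symplectic b" "lie_isomorphic b b'"
  shows "admits_symplectic b'"
proof -
  obtain \<psi> where \<psi>: "linear \<psi>" "bij \<psi>" "\<And>x y. \<psi> (b' x y) = b (\<psi> x) (\<psi> y)"
    using lie_isomorphic_sym[OF assms(2)] unfolding lie_isomorphic_def by metis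
  obtain \<omega> where \<omega>: "symplectic_form b \<omega>"
    using assms(1) unfolding admits_symplectic_def by blast
  have "linear (\<lambda>y. \<omega> (\<psi> x) (\<psi> y))" "linear (\<lambda>y. \<omega> (\<psi> y) (\<psi> x))" for x
    using \<omega> \<psi>(1) linear_compose[of \<psi>] by (auto simp: symplectic_form_def bilinear_def o_def)
  moreover have "x = 0" if "\<forall>y. \<omega> (\<psi> x) (\<psi> y) = 0" for x
  proof -
    have "\<psi> x = 0"
      using that \<omega> \<psi>(2) unfolding symplectic_form_def by (metis bij_pointE)
    then show ?thesis
      using \<psi> by (metis bij_is_inj injD linear_0)
  qed
  ultimately have "symplectic_form b' (\<lambda>x y. \<omega> (\<psi> x) (\<psi> y))"
    using \<omega> \<psi>(3) by (auto simp: symplectic_form_def bilinear_def)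
  then show ?thesis
    unfolding admits_symplectic_def by blast
qed

section \<open>Flags of linear functionals\<close>

definition wedge :: "('a \<Rightarrow> real) \<Rightarrow> ('a \<Rightarrow> real) \<Rightarrow> 'a \<Rightarrow> 'a \<Rightarrow> real" where
  "wedge f g x y = f x * g y - f y * g x"

text \<open>A coframe adapted to the bracket. If \<open>W\<close> is the common kernel of the functionals before \<open>f
  k\<close>, then \<open>f k\<close> vanishes on \<open>[\<gg>, W]\<close>; in other words, the differential of \<open>f k\<close> only involves the
  earlier functionals. For \<open>n\<close> equal to the dimension the functionals form a basis of the dual
  space, because they have no common zero.\<close>

definition flag :: "('a::real_vector \<Rightarrow> 'a \<Rightarrow> 'a) \<Rightarrow> nat \<Rightarrow> (nat \<Rightarrow> 'a \<Rightarrow> real) \<Rightarrow> bool" where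
  "flag br n f \<longleftrightarrow>
     (\<forall>i\<in>{1..n}. linear (f i)) \<and>
     (\<forall>x. (\<forall>i\<in>{1..n}. f i x = 0) \<longrightarrow> x = 0) \<and>
     (\<forall>k\<in>{1..n}. \<forall>x y. (\<forall>i\<in>{1..<k}. f i y = 0) \<longrightarrow> f k (br x y) = 0)"

lemma functional_separating_span:
  fixes w :: "'a::real_vector"
  assumes "w \<notin> span S"
  shows "\<exists>f :: 'a \<Rightarrow> real. linear f \<and> f w = 1 \<and> (\<forall>x\<in>span S. f x = 0)"
proof -
  obtain B where B: "B \<subseteq> span S" "independent B" "span S \<subseteq> span B"
    by (rule maximal_independent_subset)
  then have w: "w \<notin> span B"
    using assms by (meson span_minimal subspace_span subsetD)
  then have "independent (insert w B)"
    using B(2) by (simp add: independent_insert)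
  then obtain f where f: "linear f" "\<forall>x\<in>insert w B. f x = (if x = w then 1 else 0 :: real)"
    using linear_independent_extend[of "insert w B" "\<lambda>x. if x = w then 1 else 0 :: real"] by blast
  have "f x = 0" if "x \<in> B" for x
    using that f(2) w span_base[of x B] by auto
  then have "f x = 0" if "x \<in> span B" for x
    using that f(1) linear_eq_0_on_span by blast
  then have "\<forall>x\<in>span S. f x = 0"
    using B(3) by blast
  then show ?thesis
    using f by auto
qed

text \<open>Along the lower central series an inclusion \<open>W \<subseteq> [\<gg>, W]\<close> would propagate and put \<open>W\<close> into
  every term.\<close>

lemma nilpotent_ideal_step:
  fixes br :: "'a::real_vector \<Rightarrow> 'a \<Rightarrow> 'a"
  assumes "nilpotent_lie_algebra br" "W \<noteq> {}" "W \<noteq> {0}"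
  shows "\<not> W \<subseteq> span {br x y |x y. y \<in> W}"
proof
  assume W: "W \<subseteq> span {br x y |x y. y \<in> W}"
  have "W \<subseteq> lower_central_series br k" for k
  proof (induction k)
    case (Suc k)
    then have "{br x y |x y. y \<in> W} \<subseteq> {br x y |x y. y \<in> lower_central_series br k}"
      by blast
    then have "span {br x y |x y. y \<in> W} \<subseteq> lower_central_series br (Suc k)"
      by (simp add: span_mono)
    then show ?case
      using W by blast
  qed simp
  moreover obtain k where "lower_central_series br k = {0}"
    using assms(1) by (auto simp: nilpotent_lie_algebra_def)
  ultimately have "W \<subseteq> {0}"
    by metis
  then show False
    using assms(2,3) by auto
qed

text \<open>The functionals are chosen one after the other. The common kernel \<open>W\<close> of fewer than \<open>n\<close> of
  them is nonzero, so by nilpotency some functional vanishes on \<open>[\<gg>, W]\<close> but not on \<open>W\<close>. The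
  independent set \<open>E\<close> that grows along with them meets \<open>W\<close> only in \<open>0\<close>; once it has \<open>n\<close> elements
  it spans the space, and the common kernel is trivial.\<close>

lemma nilpotent_has_flag:
  fixes br :: "'a::real_vector \<Rightarrow> 'a \<Rightarrow> 'a"
  assumes nil: "nilpotent_lie_algebra br" and dim: "dim (UNIV :: 'a set) = n" "n > 0"
  shows "\<exists>f. flag br n f"
proof -
  define W where "W f m = {x::'a. \<forall>i\<in>{1..m}. f i x = (0::real)}" for f and m :: nat
  define good where "good m f E \<longleftrightarrow> (\<forall>i\<in>{1..m}. linear (f i)) \<and>
      (\<forall>k\<in>{1..m}. \<forall>x y. (\<forall>i\<in>{1..<k}. f i y = 0) \<longrightarrow> f k (br x y) = 0) \<and>
      independent E \<and> card E = m \<and> finite E \<and> span E \<inter> W f m = {0}" for m f and E :: "'a set"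
  have "\<exists>f E. good m f E" if "m \<le> n" for m
    using that
  proof (induction m)
    case 0
    have "good 0 (\<lambda>_ _. 0) {}"
      by (simp add: good_def W_def independent_empty)
    then show ?case by blast
  next
    case (Suc m)
    then obtain f E where g: "good m f E" by auto
    have lin: "\<And>i. i \<in> {1..m} \<Longrightarrow> linear (f i)"
      and fl: "\<And>k x y. k \<in> {1..m} \<Longrightarrow> \<forall>i\<in>{1..<k}. f i y = 0 \<Longrightarrow> f k (br x y) = 0"
      and E: "independent E" "card E = m" "finite E" and E0: "span E \<inter> W f m = {0}"
      using g by (simp_all add: good_def)
    have "0 \<in> W f m"
      using lin by (simp add: W_def linear_0)
    moreover have "W f m \<noteq> {0}"
      using exists_common_zero[of "UNIV :: 'a set" "{1..m}" f] lin dim Suc.prems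
      by (auto simp: W_def)
    ultimately obtain w where w: "w \<in> W f m" "w \<notin> span {br x y |x y. y \<in> W f m}"
      using nilpotent_ideal_step[OF nil, of "W f m"] by blast
    have "\<exists>h :: 'a \<Rightarrow> real. linear h \<and> h w = 1 \<and> (\<forall>x\<in>span {br x y |x y. y \<in> W f m}. h x = 0)"
      by (rule functional_separating_span[OF w(2)])
    then obtain h :: "'a \<Rightarrow> real"
      where h': "linear h \<and> h w = 1 \<and> (\<forall>x\<in>span {br x y |x y. y \<in> W f m}. h x = 0)" ..
    then have h: "linear h" "h w = 1" by simp_all
    note hz = h'[THEN conjunct2, THEN conjunct2, rule_format]
    define f' where "f' = f(Suc m := h)"
    have f': "f' i = f i" if "i \<le> m" for i
      using that by (simp add: f'_def)
    have f'm: "f' (Suc m) = h"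
      by (simp add: f'_def)
    have W': "W f' (Suc m) = {x \<in> W f m. h x = 0}"
      using f' f'm by (auto simp: W_def atLeastAtMostSuc_conv)
    have "w \<noteq> 0"
      using h by (metis linear_0 zero_neq_one)
    then have wE: "w \<notin> span E"
      using w(1) E0 by blast
    have "h (br x y) = 0" if "\<forall>i\<in>{1..<Suc m}. f' i y = 0" for x y
    proof -
      have "y \<in> W f m"
        using that f' by (auto simp: W_def)
      then show ?thesis
        by (intro hz span_base) blast
    qed
    then have flag': "\<forall>k\<in>{1..Suc m}. \<forall>x y. (\<forall>i\<in>{1..<k}. f' i y = 0) \<longrightarrow> f' k (br x y) = 0"
      using fl f' f'm by (simp add: atLeastAtMostSuc_conv)
    have sub: "subspace (W f m)"
      using lin by (auto simp: subspace_def W_def linear_0 linear_add linear_scale)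
    have "v = 0" if v: "v \<in> span (insert w E)" "v \<in> W f' (Suc m)" for v
    proof -
      obtain c where c: "v - c *\<^sub>R w \<in> span E"
        using v(1) span_breakdown_eq by blast
      have "v - c *\<^sub>R w \<in> W f m"
        using v(2) W' w(1) sub by (simp add: subspace_diff subspace_scale)
      then have "v - c *\<^sub>R w = 0"
        using c E0 by blast
      then have "v = c *\<^sub>R w"
        by simp
      then show ?thesis
        using v(2) W' h(1,2) by (simp add: linear_scale)
    qed
    moreover have "0 \<in> W f' (Suc m)"
      using W' h(1) sub by (simp add: linear_0 subspace_0)
    ultimately have "span (insert w E) \<inter> W f' (Suc m) = {0}"
      using span_zero by blast
    moreover have "w \<notin> E"
      using wE span_base by blast
    ultimately have "good (Suc m) f' (insert w E)"
      using lin E wE flag' h(1) f' f'm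
      by (simp add: good_def independent_insert atLeastAtMostSuc_conv)
    then show ?case by blast
  qed
  then obtain f E where g: "good n f E" by blast
  then have "span E = UNIV"
    using independent_spans_if_card_eq_dim[of E] dim by (simp add: good_def)
  then have "W f n \<subseteq> {0}"
    using g by (simp add: good_def)
  then have "flag br n f"
    using g by (simp add: good_def flag_def W_def Collect_subset subset_iff)
  then show ?thesis by blast
qed

text \<open>Any \<open>n - 1\<close> of the functionals have a common zero \<open>v \<noteq> 0\<close>, on which the remaining one
  cannot vanish.\<close>

lemma flag_dual_basis:
  fixes br :: "'a::real_vector \<Rightarrow> 'a \<Rightarrow> 'a"
  assumes "flag br n f" and dim: "dim (UNIV :: 'a set) = n"
  obtains e where "\<And>i j. i \<in> {1..n} \<Longrightarrow> j \<in> {1..n} \<Longrightarrow> f i (e j) = (if i = j then 1 else 0)"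
proof -
  have lin: "\<And>i. i \<in> {1..n} \<Longrightarrow> linear (f i)"
    and inj: "\<And>x. (\<And>i. i \<in> {1..n} \<Longrightarrow> f i x = 0) \<Longrightarrow> x = 0"
    using assms(1) by (auto simp: flag_def)
  have "\<exists>v. \<forall>i\<in>{1..n}. f i v = (if i = j then 1 else 0)" if j: "j \<in> {1..n}" for j
  proof -
    have "card ({1..n} - {j}) < n"
      using j by simp
    then obtain v where v: "v \<noteq> 0" "\<And>i. i \<in> {1..n} - {j} \<Longrightarrow> f i v = 0"
      using exists_common_zero[of "UNIV :: 'a set" "{1..n} - {j}" f] lin dim by auto
    have "f j v \<noteq> 0"
      using v inj[of v] by (metis Diff_iff singletonD)
    then have "f i ((1 / f j v) *\<^sub>R v) = (if i = j then 1 else 0)" if "i \<in> {1..n}" for i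
      using v(2)[of i] that lin[OF that] by (auto simp: linear_scale)
    then show ?thesis by blast
  qed
  then obtain e where e: "\<And>i j. j \<in> {1..n} \<Longrightarrow> i \<in> {1..n} \<Longrightarrow> f i (e j) = (if i = j then 1 else 0)"
    by metis
  then show thesis
    using e that by blast
qed

text \<open>A form that vanishes on the common kernel of \<open>f\<^sub>1, \<dots>, f\<^sub>k\<close> only sees the first \<open>k\<close>
  coordinates.\<close>

lemma alternating_form_expansion:
  fixes br :: "'a::real_vector \<Rightarrow> 'a \<Rightarrow> 'a" and B :: "'a \<Rightarrow> 'a \<Rightarrow> real"
  assumes fl: "flag br n f" and k: "k \<le> n"
    and e: "\<And>i j. i \<in> {1..n} \<Longrightarrow> j \<in> {1..n} \<Longrightarrow> f i (e j) = (if i = j then 1 else 0)"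
    and B: "bilinear B" "\<And>x. B x x = 0"
    and van: "\<And>x y. (\<forall>i\<in>{1..k}. f i y = 0) \<Longrightarrow> B x y = 0"
  shows "B x y = - B y x"
    and "B x y = (\<Sum>j\<in>{1..k}. f j y * B x (e j))"
    and "B x y = (\<Sum>i\<in>{1..k}. \<Sum>j\<in>{1..k}. f i x * f j y * B (e i) (e j))"
proof -
  have lin: "\<And>i. i \<in> {1..n} \<Longrightarrow> linear (f i)"
    using fl by (auto simp: flag_def)
  have anti: "B x y = - B y x" for x y
  proof -
    have "B (x + y) (x + y) = B x x + B y x + (B x y + B y y)"
      by (simp add: bilinear_ladd[OF B(1)] bilinear_radd[OF B(1)])
    then show ?thesis
      using B(2)[of "x + y"] B(2)[of x] B(2)[of y] by linarith
  qed
  have trunc: "B x y = (\<Sum>j\<in>{1..k}. f j y * B x (e j))" for x y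
  proof -
    have "f i (y - (\<Sum>j\<in>{1..k}. f j y *\<^sub>R e j)) = 0" if i: "i \<in> {1..k}" for i
    proof -
      have i': "i \<in> {1..n}"
        using i k by auto
      have "f i (\<Sum>j\<in>{1..k}. f j y *\<^sub>R e j) = (\<Sum>j\<in>{1..k}. f j y * f i (e j))"
        using lin[OF i'] by (simp add: linear_sum linear_scale)
      also have "\<dots> = (\<Sum>j\<in>{1..k}. if j = i then f j y else 0)"
        using i' k by (intro sum.cong) (auto simp: e)
      finally show ?thesis
        using i lin[OF i'] by (simp add: linear_diff)
    qed
    then have "B x (y - (\<Sum>j\<in>{1..k}. f j y *\<^sub>R e j)) = 0"
      by (intro van) simp
    then have "B x y = B x (\<Sum>j\<in>{1..k}. f j y *\<^sub>R e j)"
      by (simp add: bilinear_rsub[OF B(1)])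
    also have "\<dots> = (\<Sum>j\<in>{1..k}. f j y * B x (e j))"
      using B(1) by (simp add: bilinear_def linear_sum linear_scale cong: sum.cong)
    finally show ?thesis .
  qed
  have "B x y = (\<Sum>i\<in>{1..k}. \<Sum>j\<in>{1..k}. f i x * f j y * B (e i) (e j))"
  proof -
    have "B x y = (\<Sum>j\<in>{1..k}. f j y * (\<Sum>i\<in>{1..k}. f i x * B (e i) (e j)))"
    proof (subst trunc, intro sum.cong refl)
      fix j
      have "B x (e j) = - (\<Sum>i\<in>{1..k}. f i x * B (e j) (e i))"
        using anti[of x "e j"] trunc[of "e j" x] by simp
      also have "\<dots> = (\<Sum>i\<in>{1..k}. f i x * B (e i) (e j))"
        unfolding sum_negf[symmetric]
      proof (intro sum.cong refl)
        fix i
        show "- (f i x * B (e j) (e i)) = f i x * B (e i) (e j)"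
          using anti[of "e j" "e i"] by simp
      qed
      finally show "f j y * B x (e j) = f j y * (\<Sum>i\<in>{1..k}. f i x * B (e i) (e j))"
        by simp
    qed
    also have "\<dots> = (\<Sum>j\<in>{1..k}. \<Sum>i\<in>{1..k}. f i x * f j y * B (e i) (e j))"
      by (simp add: sum_distrib_left mult_ac)
    also have "\<dots> = (\<Sum>i\<in>{1..k}. \<Sum>j\<in>{1..k}. f i x * f j y * B (e i) (e j))"
      by (rule sum.swap)
    finally show ?thesis .
  qed
  then show "B x y = - B y x" "B x y = (\<Sum>j\<in>{1..k}. f j y * B x (e j))"
    "B x y = (\<Sum>i\<in>{1..k}. \<Sum>j\<in>{1..k}. f i x * f j y * B (e i) (e j))"
    using anti trunc by blast+
qed

section \<open>Normal forms for the first structure equations\<close>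

text \<open>The counterpart of \<open>\<alpha>\<close> for the sequence \<open>\<lambda>i. f i x\<close> of the values of a coframe: structure
  equations are found for functionals on an arbitrary space before coordinates are introduced.\<close>

definition \<beta> :: "nat \<Rightarrow> nat \<Rightarrow> (nat \<Rightarrow> real) \<Rightarrow> (nat \<Rightarrow> real) \<Rightarrow> real" where
  "\<beta> i j u v = u i * v j - u j * v i"

definition structure4 ::
  "('a \<Rightarrow> 'a \<Rightarrow> 'a) \<Rightarrow> (nat \<Rightarrow> 'a \<Rightarrow> real) \<Rightarrow> ((nat \<Rightarrow> real) \<Rightarrow> (nat \<Rightarrow> real) \<Rightarrow> real) \<Rightarrow>
    ((nat \<Rightarrow> real) \<Rightarrow> (nat \<Rightarrow> real) \<Rightarrow> real) \<Rightarrow> bool"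
  where "structure4 br f d3 d4 \<longleftrightarrow>
    (\<forall>x y. f 1 (br x y) = 0 \<and> f 2 (br x y) = 0 \<and>
      f 3 (br x y) = - d3 (\<lambda>i. f i x) (\<lambda>i. f i y) \<and>
      f 4 (br x y) = - d4 (\<lambda>i. f i x) (\<lambda>i. f i y))"

definition structure5 ::
  "('a \<Rightarrow> 'a \<Rightarrow> 'a) \<Rightarrow> (nat \<Rightarrow> 'a \<Rightarrow> real) \<Rightarrow> ((nat \<Rightarrow> real) \<Rightarrow> (nat \<Rightarrow> real) \<Rightarrow> real) \<Rightarrow>
    ((nat \<Rightarrow> real) \<Rightarrow> (nat \<Rightarrow> real) \<Rightarrow> real) \<Rightarrow> ((nat \<Rightarrow> real) \<Rightarrow> (nat \<Rightarrow> real) \<Rightarrow> real) \<Rightarrow> bool"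
  where "structure5 br f d3 d4 d5 \<longleftrightarrow> structure4 br f d3 d4 \<and>
    (\<forall>x y. f 5 (br x y) = - d5 (\<lambda>i. f i x) (\<lambda>i. f i y))"

lemma intervals_numeral:
  "{1..2::nat} = {1,2}" "{1..3::nat} = {1,2,3}" "{1..4::nat} = {1,2,3,4}"
  "{1..5::nat} = {1,2,3,4,5}" "{1..6::nat} = {1,2,3,4,5,6}"
  "{1..<1::nat} = {}" "{1..<2::nat} = {1}" "{1..<3::nat} = {1,2}" "{1..<4::nat} = {1,2,3}"
  "{1..<5::nat} = {1,2,3,4}" "{1..<6::nat} = {1,2,3,4,5}"
  by (rule set_eqI, simp only: atLeastAtMost_iff atLeastLessThan_iff insert_iff empty_iff, arith)+

lemma sum_upto_numeral:
  fixes g :: "nat \<Rightarrow> real"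
  shows "sum g {1..2} = g 1 + g 2" "sum g {1..3} = g 1 + g 2 + g 3" "sum g {1..4} = g 1 + g 2 + g 3 + g 4"
    "sum g {1..5} = g 1 + g 2 + g 3 + g 4 + g 5"
  unfolding intervals_numeral by simp_all

text \<open>Changing the first \<open>K\<close> functionals of a flag, without enlarging their common kernel, does
  not affect the later ones: the condition on \<open>f k\<close> for \<open>k > K\<close> depends on the earlier functionals
  through their common kernel only.\<close>

lemma flag_replace:
  assumes fl: "flag br n f" and K: "K \<le> n" and same: "\<And>i. K < i \<Longrightarrow> f' i = f i"
    and lin: "\<forall>i\<in>{1..K}. linear (f' i)"
    and ker: "\<And>x. \<forall>i\<in>{1..K}. f' i x = 0 \<Longrightarrow> \<forall>i\<in>{1..K}. f i x = 0"
    and br: "\<forall>k\<in>{1..K}. \<forall>x y. (\<forall>i\<in>{1..<k}. f' i y = 0) \<longrightarrow> f' k (br x y) = 0"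
  shows "flag br n f'"
proof -
  have "linear (f' i)" if "i \<in> {1..n}" for i
    using that fl lin same by (cases "i \<le> K") (auto simp: flag_def)
  moreover have ker': "f i x = 0" if x: "\<forall>i\<in>{1..m}. f' i x = 0" and "K \<le> m" "i \<in> {1..m}" for i m x
  proof (cases "i \<le> K")
    case True
    then show ?thesis
      using ker[of x] x that by auto
  next
    case False
    then show ?thesis
      using that same[of i] by (auto dest: bspec[of _ _ i])
  qed
  have "x = 0" if "\<forall>i\<in>{1..n}. f' i x = 0" for x
    using fl ker'[OF that K] by (auto simp: flag_def)
  moreover have "f' k (br x y) = 0" if k: "k \<in> {1..n}" and y: "\<forall>i\<in>{1..<k}. f' i y = 0" for k x y
  proof (cases "k \<le> K")
    case True
    then show ?thesis
      using br k y by auto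
  next
    case False
    have "\<forall>i\<in>{1..k - 1}. f' i y = 0"
      using y by auto
    then have "f i y = 0" if "i \<in> {1..<k}" for i
      using ker'[of "k - 1" y i] False that by auto
    then show ?thesis
      using fl k False same[of k] by (auto simp: flag_def)
  qed
  ultimately show ?thesis
    by (auto simp: flag_def)
qed

locale flagged_lie_algebra = lie_algebra br
  for br :: "'a::real_vector \<Rightarrow> 'a \<Rightarrow> 'a" +
  fixes n :: nat
  assumes dim: "dim (UNIV :: 'a set) = n"
begin

lemma bracket_skew: "br x y = - br y x"
proof -
  have "br (x + y) (x + y) = br x x + br y x + (br x y + br y y)"
    by (simp add: bilinear_ladd[OF bilinear_bracket] bilinear_radd[OF bilinear_bracket])
  then show ?thesis
    by (simp add: bracket_self add_eq_0_iff2)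
qed

lemma flag_linear:
  assumes "flag br n f" "k \<in> {1..n}"
  shows "linear (f k)" "f k (x + y) = f k x + f k y" "f k (c *\<^sub>R x) = c * f k x" "f k 0 = 0"
    "f k (- x) = - f k x"
  using assms by (auto simp: flag_def linear_add linear_scale linear_0 linear_neg)

lemma differential_form:
  assumes "linear h"
  shows "bilinear (\<lambda>x y. - h (br x y))" "- h (br x x) = 0"
proof -
  have "linear (\<lambda>y. - h (br x y))" "linear (\<lambda>y. - h (br y x))" for x
    using bilinear_bracket assms
    by (auto simp: bilinear_def intro!: linear_compose_neg linear_compose[of _ h, unfolded o_def])
  then show "bilinear (\<lambda>x y. - h (br x y))"
    by (simp add: bilinear_def)
  show "- h (br x x) = 0"
    using assms by (simp add: bracket_self linear_0)
qed

lemma differential_expansion: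
  assumes fl: "flag br n f" and k: "k < n"
    and e: "\<And>i j. i \<in> {1..n} \<Longrightarrow> j \<in> {1..n} \<Longrightarrow> f i (e j) = (if i = j then 1 else 0)"
  shows "f (Suc k) (br x y) = - (\<Sum>i\<in>{1..k}. \<Sum>j\<in>{1..k}. f i x * f j y * - f (Suc k) (br (e i) (e j)))"
proof -
  have k': "Suc k \<in> {1..n}"
    using k by simp
  have "- f (Suc k) (br x y) = (\<Sum>i\<in>{1..k}. \<Sum>j\<in>{1..k}. f i x * f j y * - f (Suc k) (br (e i) (e j)))"
  proof (rule alternating_form_expansion(3)[OF fl _ e])
    show "bilinear (\<lambda>x y. - f (Suc k) (br x y))" "\<And>x. - f (Suc k) (br x x) = 0"
      using differential_form[of "f (Suc k)"] flag_linear(1)[OF fl k'] by blast+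
    show "- f (Suc k) (br x y) = 0" if "\<forall>i\<in>{1..k}. f i y = 0" for x y
    proof -
      have "\<forall>i\<in>{1..<Suc k}. f i y = 0"
        using that by auto
      then show ?thesis
        using fl k' unfolding flag_def by (metis neg_equal_0_iff_equal)
    qed
  qed (use k in auto)
  then show ?thesis
    by (simp only: minus_minus minus_equation_iff)
qed

text \<open>The flag condition leaves only products of earlier functionals in the differential of \<open>f
  k\<close>. For \<open>k \<le> 2\<close> no nonzero products are left.\<close>

lemma differential_expansions:
  assumes fl: "flag br n f" and "n \<ge> 1"
  shows "f 1 (br x y) = 0"
    and "n \<ge> 2 \<Longrightarrow> f 2 (br x y) = 0"
    and "n \<ge> 3 \<Longrightarrow> \<exists>a. \<forall>x y. f 3 (br x y) = - (a * wedge (f 1) (f 2) x y)" (is "_ \<Longrightarrow> ?d3")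
    and "n \<ge> 4 \<Longrightarrow> \<exists>c12 c13 c23. \<forall>x y. f 4 (br x y) =
       - (c12 * wedge (f 1) (f 2) x y + c13 * wedge (f 1) (f 3) x y + c23 * wedge (f 2) (f 3) x
           y)" (is "_ \<Longrightarrow> ?d4")
    and "n \<ge> 5 \<Longrightarrow> \<exists>c12 c13 c14 c23 c24 c34. \<forall>x y. f 5 (br x y) =
       - (c12 * wedge (f 1) (f 2) x y + c13 * wedge (f 1) (f 3) x y + c14 * wedge (f 1) (f 4) x y
         + c23 * wedge (f 2) (f 3) x y + c24 * wedge (f 2) (f 4) x y + c34 * wedge (f 3) (f 4) x
             y)" (is "_ \<Longrightarrow> ?d5")
    and "n \<ge> 6 \<Longrightarrow> \<exists>c12 c13 c14 c15 c23 c24 c25 c34 c35 c45. \<forall>x y. f 6 (br x y) =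
       - (c12 * wedge (f 1) (f 2) x y + c13 * wedge (f 1) (f 3) x y + c14 * wedge (f 1) (f 4) x y
         + c15 * wedge (f 1) (f 5) x y + c23 * wedge (f 2) (f 3) x y + c24 * wedge (f 2) (f 4) x y
         + c25 * wedge (f 2) (f 5) x y + c34 * wedge (f 3) (f 4) x y + c35 * wedge (f 3) (f 5) x y
         + c45 * wedge (f 4) (f 5) x y)" (is "_ \<Longrightarrow> ?d6")
proof -
  obtain e where e: "\<And>i j. i \<in> {1..n} \<Longrightarrow> j \<in> {1..n} \<Longrightarrow> f i (e j) = (if i = j then 1 else 0)"
    using flag_dual_basis[OF fl dim] by metis
  define c where "c k i j = - f k (br (e i) (e j))" for k i j
  have c: "c k i j = - c k j i" "c k i i = 0" if "k \<in> {1..n}" for k i j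
    using flag_linear[OF fl that] bracket_skew[of "e i" "e j"] by (simp_all add: c_def bracket_self)
  note ex = differential_expansion[OF fl _ e, folded c_def]
  show "f 1 (br x y) = 0"
    using ex[of 0] \<open>n \<ge> 1\<close> by simp
  show "f 2 (br x y) = 0" if "n \<ge> 2"
    using ex[of 1 x y] that c(2)[of 2] by (simp add: numeral_2_eq_2)
  show ?d3 if "n \<ge> 3"
  proof -
    have m: "3 \<in> {1..n}" "2 < n"
      using that by simp_all
    note skew = c(1)[OF m(1), of 2 1] c(2)[OF m(1)]
    have "f 3 (br x y) = - (\<Sum>i\<in>{1..2}. \<Sum>j\<in>{1..2}. f i x * f j y * c 3 i j)" for x y
      using ex[OF m(2)] by simp
    then have "\<forall>x y. f 3 (br x y) =
       - (c 3 1 2 * wedge (f 1) (f 2) x y)"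
      unfolding sum_upto_numeral skew by (simp add: wedge_def algebra_simps)
    then show ?thesis
      by blast
  qed
  show ?d4 if "n \<ge> 4"
  proof -
    have m: "4 \<in> {1..n}" "3 < n"
      using that by simp_all
    note skew = c(1)[OF m(1), of 2 1] c(1)[OF m(1), of 3 1] c(1)[OF m(1), of 3 2] c(2)[OF m(1)]
    have "f 4 (br x y) = - (\<Sum>i\<in>{1..3}. \<Sum>j\<in>{1..3}. f i x * f j y * c 4 i j)" for x y
      using ex[OF m(2)] by simp
    then have "\<forall>x y. f 4 (br x y) =
       - (c 4 1 2 * wedge (f 1) (f 2) x y + c 4 1 3 * wedge (f 1) (f 3) x y + c 4 2 3 * wedge (f 2) (f
           3) x y)"
      unfolding sum_upto_numeral skew by (simp add: wedge_def algebra_simps)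
    then show ?thesis
      by blast
  qed
  show ?d5 if "n \<ge> 5"
  proof -
    have m: "5 \<in> {1..n}" "4 < n"
      using that by simp_all
    note skew = c(1)[OF m(1), of 2 1] c(1)[OF m(1), of 3 1] c(1)[OF m(1), of 4 1] c(1)[OF m(1), of 3 2]
        c(1)[OF m(1), of 4 2] c(1)[OF m(1), of 4 3] c(2)[OF m(1)]
    have "f 5 (br x y) = - (\<Sum>i\<in>{1..4}. \<Sum>j\<in>{1..4}. f i x * f j y * c 5 i j)" for x y
      using ex[OF m(2)] by simp
    then have "\<forall>x y. f 5 (br x y) =
       - (c 5 1 2 * wedge (f 1) (f 2) x y + c 5 1 3 * wedge (f 1) (f 3) x y + c 5 1 4 * wedge (f 1) (f
           4) x y + c 5 2 3 * wedge (f 2) (f 3) x y + c 5 2 4 * wedge (f 2) (f 4) x y + c 5 3 4 * wedge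
           (f 3) (f 4) x y)"
      unfolding sum_upto_numeral skew by (simp add: wedge_def algebra_simps)
    then show ?thesis
      by blast
  qed
  show ?d6 if "n \<ge> 6"
  proof -
    have m: "6 \<in> {1..n}" "5 < n"
      using that by simp_all
    note skew = c(1)[OF m(1), of 2 1] c(1)[OF m(1), of 3 1] c(1)[OF m(1), of 4 1] c(1)[OF m(1), of 5 1]
        c(1)[OF m(1), of 3 2] c(1)[OF m(1), of 4 2] c(1)[OF m(1), of 5 2] c(1)[OF m(1), of 4 3] c(1)[OF
        m(1), of 5 3] c(1)[OF m(1), of 5 4] c(2)[OF m(1)]
    have "f 6 (br x y) = - (\<Sum>i\<in>{1..5}. \<Sum>j\<in>{1..5}. f i x * f j y * c 6 i j)" for x y
      using ex[OF m(2)] by simp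
    then have "\<forall>x y. f 6 (br x y) =
       - (c 6 1 2 * wedge (f 1) (f 2) x y + c 6 1 3 * wedge (f 1) (f 3) x y + c 6 1 4 * wedge (f 1) (f
           4) x y + c 6 1 5 * wedge (f 1) (f 5) x y + c 6 2 3 * wedge (f 2) (f 3) x y + c 6 2 4 * wedge
           (f 2) (f 4) x y + c 6 2 5 * wedge (f 2) (f 5) x y + c 6 3 4 * wedge (f 3) (f 4) x y + c 6 3
           5 * wedge (f 3) (f 5) x y + c 6 4 5 * wedge (f 4) (f 5) x y)"
      unfolding sum_upto_numeral skew by (simp add: wedge_def algebra_simps)
    then show ?thesis
      by blast
  qed
qed

end

\<comment> \<open>The first functional of a flag is written \<open>f 1\<close>, which the simplifier should leave as it is.\<close>
declare One_nat_def [simp del]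

context flagged_lie_algebra
begin

text \<open>The first step towards a normal form of an alternating form \<open>B\<close>. If \<open>c = B (e i) (e j)\<close> is
  nonzero, then \<open>B _ (e j) / c\<close> and \<open>B (e i) _\<close> can replace \<open>f i\<close> and \<open>f j\<close>, and the product of
  these two functionals accounts for every term of \<open>B\<close> that involves them. The permutation \<open>\<sigma>\<close>
  moves \<open>i\<close> and \<open>j\<close> to the first two places.\<close>

lemma split_off_plane:
  assumes fl: "flag br n f" and K: "2 \<le> K" "K \<le> n"
    and closed: "\<And>i x y. i \<in> {1..K} \<Longrightarrow> f i (br x y) = 0"
    and B: "bilinear B" "\<And>x. B x x = 0"
    and van: "\<And>x y. (\<forall>i\<in>{1..K}. f i y = 0) \<Longrightarrow> B x y = (0::real)"
    and nz: "B x0 y0 \<noteq> 0"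
  obtains g where "flag br n g" "\<And>i x y. i \<in> {1..K} \<Longrightarrow> g i (br x y) = 0" "\<And>i. i > K \<Longrightarrow> g i = f i"
    "\<And>y. \<forall>i\<in>{1..K}. g i y = 0 \<Longrightarrow> \<forall>i\<in>{1..K}. f i y = 0"
    "\<And>x y. \<forall>i\<in>{3..K}. g i y = 0 \<Longrightarrow> B x y = wedge (g 1) (g 2) x y"
proof -
  obtain e where e: "\<And>i j. i \<in> {1..n} \<Longrightarrow> j \<in> {1..n} \<Longrightarrow> f i (e j) = (if i = j then 1 else 0)"
    using flag_dual_basis[OF fl dim] by metis
  note ex = alternating_form_expansion[OF fl K(2) e B van]
  have "\<exists>i\<in>{1..K}. \<exists>j\<in>{1..K}. B (e i) (e j) \<noteq> 0"
  proof (rule ccontr)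
    assume "\<not> ?thesis"
    then have "B x0 y0 = 0"
      using ex(3)[of x0 y0] by simp
    then show False
      using nz by simp
  qed
  then obtain i j where ij: "i \<in> {1..K}" "j \<in> {1..K}" "B (e i) (e j) \<noteq> 0"
    by blast
  define c where "c = B (e i) (e j)"
  have "i \<noteq> j"
    using ij(3) B(2) by auto
  define j' where "j' = Transposition.transpose 1 i j"
  define \<sigma> where "\<sigma> = Transposition.transpose 1 i \<circ> Transposition.transpose 2 j'"
  have j': "j' \<noteq> 1" "j' \<in> {1..K}"
    using \<open>i \<noteq> j\<close> ij K by (auto simp: j'_def Transposition.transpose_def)
  have \<sigma>12: "\<sigma> 1 = i" "\<sigma> 2 = j"
    using j'(1) \<open>i \<noteq> j\<close> by (auto simp: \<sigma>_def Transposition.transpose_def j'_def)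
  have bij: "bij \<sigma>"
    by (simp add: \<sigma>_def bij_comp)
  have \<sigma>K: "\<sigma> k \<in> {1..K}" if "k \<in> {1..K}" for k
    using that ij j' K by (auto simp: \<sigma>_def Transposition.transpose_def)
  have others: "\<exists>k\<in>{3..K}. \<sigma> k = m" if m: "m \<in> {1..K}" "m \<noteq> i" "m \<noteq> j" for m
  proof -
    have "inj_on \<sigma> {1..K}" "\<sigma> ` {1..K} \<subseteq> {1..K}"
      using bij \<sigma>K by (auto simp: bij_def inj_on_def)
    then have "\<sigma> ` {1..K} = {1..K}"
      by (simp add: endo_inj_surj)
    then obtain k where k: "k \<in> {1..K}" "\<sigma> k = m"
      using m(1) by (metis imageE)
    moreover have "k \<noteq> 1" "k \<noteq> 2"
      using k(2) \<sigma>12 m by auto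
    ultimately show ?thesis
      by (intro bexI[of _ k]) auto
  qed
  define g where "g k = (if k = 1 then \<lambda>x. B x (e j) / c else if k = 2 then B (e i)
    else if k \<le> K then f (\<sigma> k) else f k)" for k
  have g12: "g 1 = (\<lambda>x. B x (e j) / c)" "g 2 = B (e i)"
    by (simp_all add: g_def)
  have g3: "g k = f (\<sigma> k)" if "k \<in> {3..K}" for k
    using that by (simp add: g_def)
  have lin: "linear (B x)" "linear (\<lambda>y. B y x)" for x
    using B(1) by (auto simp: bilinear_def)
  have g1z: "g 1 y = 0" "g 2 y = 0" if "\<forall>k\<in>{1..K}. f k y = 0" for y
    using that van[of y "e j"] van[of y "e i"] van[of y] ex(1)[of y "e j"] by (simp_all add: g12)
  have red: "B x y = f i y * B x (e i) + f j y * B x (e j)" if y: "\<forall>k\<in>{3..K}. g k y = 0" for x y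
  proof -
    have "f m y = 0" if m: "m \<in> {1..K}" "m \<noteq> i" "m \<noteq> j" for m
    proof -
      obtain k where k: "k \<in> {3..K}" "\<sigma> k = m"
        using others[OF m] by blast
      then have "g k y = 0"
        using y by blast
      then show ?thesis
        using k g3[OF k(1)] by simp
    qed
    then have "(\<Sum>m\<in>{1..K}. f m y * B x (e m)) = (\<Sum>m\<in>{i, j}. f m y * B x (e m))"
      using ij by (intro sum.mono_neutral_right) auto
    then show ?thesis
      using ex(2)[of x y] \<open>i \<noteq> j\<close> by simp
  qed
  have g12y: "g 1 y = f i y" "g 2 y = c * f j y" if y: "\<forall>k\<in>{3..K}. g k y = 0" for y
    using red[OF y, of "e j"] red[OF y, of "e i"] ex(1)[of y "e j"] ex(1)[of "e j" "e i"] B(2) ij(3)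
    by (simp_all add: g12 c_def)
  have wedge: "B x y = wedge (g 1) (g 2) x y" if y: "\<forall>k\<in>{3..K}. g k y = 0" for x y
    using red[OF y, of x] g12y[OF y] ij(3) ex(1)[of x "e i"]
    by (simp add: wedge_def g12(1)[THEN fun_cong, of x] g12(2)[THEN fun_cong, of x] c_def)
  have ker: "\<forall>k\<in>{1..K}. f k y = 0" if y: "\<forall>k\<in>{1..K}. g k y = 0" for y
  proof
    fix k assume k: "k \<in> {1..K}"
    have y3: "\<forall>k\<in>{3..K}. g k y = 0"
      using y by auto
    have "f i y = 0" "f j y = 0"
      using g12y[OF y3] y K ij(3) by (auto simp: c_def)
    moreover have "f k y = 0" if k': "k \<noteq> i" "k \<noteq> j"
    proof -
      obtain m where m: "m \<in> {3..K}" "\<sigma> m = k"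
        using others[OF k k'] by blast
      then have "g m y = 0"
        using y3 by blast
      then show ?thesis
        using m g3[OF m(1)] by simp
    qed
    ultimately show "f k y = 0"
      by blast
  qed
  have same: "g k = f k" if "k > K" for k
    using that K by (simp add: g_def)
  have gclosed: "g k (br x y) = 0" if k: "k \<in> {1..K}" for k x y
  proof -
    have f0: "\<forall>k\<in>{1..K}. f k (br x y) = 0"
      using closed by blast
    consider "k = 1" | "k = 2" | "k \<in> {3..K}"
      using k by (cases "k = 1"; cases "k = 2") auto
    then show ?thesis
    proof cases
      case 3
      then show ?thesis
        using closed[OF \<sigma>K[OF k]] by (simp add: g3)
    qed (use g1z[OF f0] in simp_all)
  qed
  have "linear (g k)" if k: "k \<in> {1..K}" for k
  proof -
    consider "k = 1" | "k = 2" | "k \<in> {3..K}"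
      using k by (cases "k = 1"; cases "k = 2") auto
    then show ?thesis
    proof cases
      case 1
      have "linear (\<lambda>x. (1 / c) *\<^sub>R B x (e j))"
        using lin by (intro linear_compose_scale_right)
      then show ?thesis
        using 1 by (simp add: g12)
    next
      case 3
      then show ?thesis
        using g3[OF 3] flag_linear(1)[OF fl, of "\<sigma> k"] \<sigma>K[OF k] K by simp
    qed (use lin in \<open>simp add: g12\<close>)
  qed
  then have "flag br n g"
    using flag_replace[OF fl K(2), of g] same ker gclosed by blast
  then show thesis
    using gclosed same ker wedge by (intro that[of g])
qed

text \<open>What remains after splitting off a plane is a form in \<open>K - 2 \<le> 3\<close> functionals.\<close>

lemma split_off_plane_expansion:
  assumes fl: "flag br n f" and K: "K \<in> {3, 4, 5}" "K \<le> n"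
    and closed: "\<And>i x y. i \<in> {1..K} \<Longrightarrow> f i (br x y) = 0"
    and B: "bilinear B" "\<And>x. B x x = 0"
    and van: "\<And>x y. (\<forall>i\<in>{1..K}. f i y = 0) \<Longrightarrow> B x y = (0::real)"
    and nz: "B x0 y0 \<noteq> 0"
  obtains g a b c where "flag br n g" "\<And>i x y. i \<in> {1..K} \<Longrightarrow> g i (br x y) = 0" "\<And>i. i > K \<Longrightarrow> g i = f i"
    "\<And>x y. B x y = wedge (g 1) (g 2) x y + (if K = 3 then 0 else a * wedge (g 3) (g 4) x y)
       + (if K = 5 then b * wedge (g 3) (g 5) x y + c * wedge (g 4) (g 5) x y else 0)"
proof -
  have "2 \<le> K"
    using K by auto
  obtain g where g: "flag br n g" "\<And>i x y. i \<in> {1..K} \<Longrightarrow> g i (br x y) = 0" "\<And>i. i > K \<Longrightarrow> g i = f i"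
      "\<And>y. \<forall>i\<in>{1..K}. g i y = 0 \<Longrightarrow> \<forall>i\<in>{1..K}. f i y = 0"
      "\<And>x y. \<forall>i\<in>{3..K}. g i y = 0 \<Longrightarrow> B x y = wedge (g 1) (g 2) x y"
    using split_off_plane[OF fl \<open>2 \<le> K\<close> K(2) closed B van nz] by blast
  obtain e where e: "\<And>i j. i \<in> {1..n} \<Longrightarrow> j \<in> {1..n} \<Longrightarrow> g i (e j) = (if i = j then 1 else 0)"
    using flag_dual_basis[OF g(1) dim] by metis
  have van': "\<And>x y. (\<forall>i\<in>{1..K}. g i y = 0) \<Longrightarrow> B x y = 0"
    using g(4) van by blast
  note ex = alternating_form_expansion[OF g(1) K(2) e B van']
  have ge: "g k (e j) = (if k = j then 1 else 0)" if "k \<in> {1..K}" "j \<in> {1..K}" for k j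
    using e that K by auto
  have B2: "B (e k) (e j) = wedge (g 1) (g 2) (e k) (e j)" if "k \<in> {1..K}" "j \<in> {1, 2}" for k j
    using that ge \<open>2 \<le> K\<close> by (intro g(5)) auto
  have B12: "B (e 1) (e 2) = 1" "\<And>k. k \<in> {3..K} \<Longrightarrow> B (e k) (e 1) = 0"
    "\<And>k. k \<in> {3..K} \<Longrightarrow> B (e k) (e 2) = 0"
    using B2[of 1 2] B2[of _ 1] B2[of _ 2] ge \<open>2 \<le> K\<close> by (simp_all add: wedge_def)
  have B12': "B (e 1) (e k) = 0" "B (e 2) (e k) = 0" if "k \<in> {3..K}" for k
    using B12(2,3)[OF that] ex(1)[of "e 1" "e k"] ex(1)[of "e 2" "e k"] by linarith+
  have B21: "B (e 2) (e 1) = - 1"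
    using B12(1) ex(1)[of "e 1" "e 2"] by linarith
  have "B x y = wedge (g 1) (g 2) x y + (if K = 3 then 0 else B (e 3) (e 4) * wedge (g 3) (g 4) x y)
       + (if K = 5 then B (e 3) (e 5) * wedge (g 3) (g 5) x y + B (e 4) (e 5) * wedge (g 4) (g 5) x y else 0)"
    for x y
  proof -
    consider "K = 3" | "K = 4" | "K = 5"
      using K by auto
    then show ?thesis
    proof cases
      case 1
      show ?thesis
        using ex(3)[of x y] B12 B12' B21 B(2) unfolding 1 sum_upto_numeral
        by (simp add: wedge_def algebra_simps)
    next
      case 2
      show ?thesis
        using ex(3)[of x y] B12 B12' B21 B(2) ex(1)[of "e 4" "e 3"] unfolding 2 sum_upto_numeral
        by (simp add: wedge_def algebra_simps)
    next
      case 3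
      show ?thesis
        using ex(3)[of x y] B12 B12' B21 B(2) ex(1)[of "e 4" "e 3"] ex(1)[of "e 5" "e 3"] ex(1)[of
            "e 5" "e 4"]
        unfolding 3 sum_upto_numeral
        by (simp add: wedge_def algebra_simps)
    qed
  qed
  then show thesis
    using g(1,2,3) by (intro that[of g])
qed

end

lemma linear_functional_intros:
  fixes f g :: "'a::real_vector \<Rightarrow> real"
  shows "linear f \<Longrightarrow> linear (\<lambda>x. c * f x)" "linear f \<Longrightarrow> linear (\<lambda>x. f x / c)"
    "linear f \<Longrightarrow> linear g \<Longrightarrow> linear (\<lambda>x. f x + g x)"
    "linear f \<Longrightarrow> linear g \<Longrightarrow> linear (\<lambda>x. f x - g x)"
    "linear f \<Longrightarrow> linear (\<lambda>x. - f x)"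
proof -
  show scale: "linear f \<Longrightarrow> linear (\<lambda>x. c * f x)" for f :: "'a \<Rightarrow> real" and c
    using linear_compose_scale_right[of f c] by simp
  show "linear f \<Longrightarrow> linear (\<lambda>x. f x / c)"
    using scale[of f "inverse c"] by (simp add: divide_inverse mult.commute)
qed (rule linear_compose_add linear_compose_sub linear_compose_neg; assumption)+

text \<open>The matrix with rows \<open>(p, q)\<close> and \<open>(- q, p)\<close> has determinant \<open>p\<^sup>2 + q\<^sup>2\<close>.\<close>

lemma rotation_eq_0:
  fixes p q a b :: real
  assumes "p * a + q * b = 0" "p * b - q * a = 0" "p\<^sup>2 + q\<^sup>2 \<noteq> 0"
  shows "a = 0" "b = 0"
proof -
  have "(p\<^sup>2 + q\<^sup>2) * a = p * (p * a + q * b) - q * (p * b - q * a)"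
    "(p\<^sup>2 + q\<^sup>2) * b = q * (p * a + q * b) + p * (p * b - q * a)"
    by (simp_all add: algebra_simps power2_eq_square)
  then show "a = 0" "b = 0"
    using assms by (metis mult_zero_right diff_self add_0 mult_eq_0_iff)+
qed

context flagged_lie_algebra
begin

lemma flag_update4:
  assumes fl: "flag br n f" and n: "4 \<le> n"
    and lin: "linear g1" "linear g2" "linear g3" "linear g4"
    and ker: "\<And>x. g1 x = 0 \<Longrightarrow> g2 x = 0 \<Longrightarrow> g3 x = 0 \<Longrightarrow> g4 x = 0 \<Longrightarrow>
      f 1 x = 0 \<and> f 2 x = 0 \<and> f 3 x = 0 \<and> f 4 x = 0"
    and closed: "\<And>x y. g1 (br x y) = 0" "\<And>x y. g2 (br x y) = 0"
    and d3: "\<And>x y. g1 y = 0 \<Longrightarrow> g2 y = 0 \<Longrightarrow> g3 (br x y) = 0"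
    and d4: "\<And>x y. g1 y = 0 \<Longrightarrow> g2 y = 0 \<Longrightarrow> g3 y = 0 \<Longrightarrow> g4 (br x y) = 0"
  shows "flag br n (f(1 := g1, 2 := g2, 3 := g3, 4 := g4))"
  by (rule flag_replace[OF fl n], unfold intervals_numeral) (use assms in \<open>auto simp: intervals_numeral\<close>)

lemma flag_update5:
  assumes fl: "flag br n f" and n: "5 \<le> n"
    and lin: "linear g1" "linear g2" "linear g3" "linear g4" "linear g5"
    and ker: "\<And>x. g1 x = 0 \<Longrightarrow> g2 x = 0 \<Longrightarrow> g3 x = 0 \<Longrightarrow> g4 x = 0 \<Longrightarrow> g5 x = 0 \<Longrightarrow>
      f 1 x = 0 \<and> f 2 x = 0 \<and> f 3 x = 0 \<and> f 4 x = 0 \<and> f 5 x = 0"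
    and closed: "\<And>x y. g1 (br x y) = 0" "\<And>x y. g2 (br x y) = 0"
    and d3: "\<And>x y. g1 y = 0 \<Longrightarrow> g2 y = 0 \<Longrightarrow> g3 (br x y) = 0"
    and d4: "\<And>x y. g1 y = 0 \<Longrightarrow> g2 y = 0 \<Longrightarrow> g3 y = 0 \<Longrightarrow> g4 (br x y) = 0"
    and d5: "\<And>x y. g1 y = 0 \<Longrightarrow> g2 y = 0 \<Longrightarrow> g3 y = 0 \<Longrightarrow> g4 y = 0 \<Longrightarrow> g5 (br x y) = 0"
  shows "flag br n (f(1 := g1, 2 := g2, 3 := g3, 4 := g4, 5 := g5))"
  by (rule flag_replace[OF fl n], unfold intervals_numeral) (use assms in \<open>auto simp: intervals_numeral\<close>)

lemma jacobi_functional: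
  assumes "linear h"
  shows "h (br (br x y) z) + h (br (br y z) x) + h (br (br z x) y) = 0"
proof -
  have "h (br (br x y) z + br (br y z) x + br (br z x) y) = 0"
    using assms by (simp add: jacobi linear_0)
  then show ?thesis
    using assms by (simp add: linear_add)
qed

lemma first_three_differentials:
  assumes fl: "flag br n f" and n: "4 \<le> n"
  shows "\<exists>f. flag br n f \<and> (\<forall>x y. f 1 (br x y) = 0 \<and> f 2 (br x y) = 0) \<and>
    ((\<forall>x y. f 3 (br x y) = 0) \<or> (\<forall>x y. f 3 (br x y) = - wedge (f 1) (f 2) x y))"
proof -
  note lin = flag_linear(1)[OF fl]
  have cl: "f 1 (br x y) = 0" "f 2 (br x y) = 0" for x y
    using differential_expansions(1,2)[OF fl] n by auto
  obtain a where a: "\<And>x y. f 3 (br x y) = - (a * wedge (f 1) (f 2) x y)"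
    using differential_expansions(3)[OF fl] n by auto
  show ?thesis
  proof (cases "a = 0")
    case True
    then show ?thesis
      using fl cl a by auto
  next
    case False
    have l: "linear (f 1)" "linear (f 2)" "linear (f 3)" "linear (f 4)"
      using lin n by simp_all
    have f4: "f 4 (br x y) = 0" if "f 1 y = 0" "f 2 y = 0" "f 3 y = 0" for x y
    proof -
      have "4 \<in> {1..n}" "\<forall>i\<in>{1..<4}. f i y = 0"
        using that n by (simp_all add: intervals_numeral)
      then show ?thesis
        using fl unfolding flag_def by blast
    qed
    have "flag br n (f(1 := f 1, 2 := f 2, 3 := (\<lambda>x. f 3 x / a), 4 := f 4))"
      by (rule flag_update4[OF fl n])
        (use l cl a f4 False in \<open>auto simp: wedge_def intro: linear_functional_intros\<close>)
    then show ?thesis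
      using cl a False by (intro exI[of _ "f(1 := f 1, 2 := f 2, 3 := (\<lambda>x. f 3 x / a), 4 := f 4)"])
        (auto simp: wedge_def)
  qed
qed

text \<open>If the first three functionals are closed, then the differential of the fourth is a 2-form
  in three variables, hence zero or decomposable. Otherwise it is \<open>a \<alpha>\<^sub>1\<^sub>2 + (b \<alpha>\<^sub>1 + c \<alpha>\<^sub>2) \<and>
  \<alpha>\<^sub>3\<close> with \<open>\<alpha>\<^sub>1\<^sub>2\<close> exact: for \<open>b = c = 0\<close> the functional \<open>f\<^sub>4 - a f\<^sub>3\<close> is closed and changes
  places with \<open>f\<^sub>3\<close>, and for \<open>(b, c) \<noteq> 0\<close> the combination \<open>b \<alpha>\<^sub>1 + c \<alpha>\<^sub>2\<close> becomes the new \<open>\<alpha>\<^sub>1\<close>.\<close>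

lemma first_four_differentials:
  assumes fl: "flag br n f" and n: "4 \<le> n"
  shows "\<exists>f. flag br n f \<and>
    (structure4 br f 0 0 \<or> structure4 br f 0 (\<beta> 1 2) \<or> structure4 br f (\<beta> 1 2) (\<beta> 1 3))"
proof -
  obtain f where fl: "flag br n f" and cl: "\<And>x y. f 1 (br x y) = 0" "\<And>x y. f 2 (br x y) = 0"
    and d3: "(\<forall>x y. f 3 (br x y) = 0) \<or> (\<forall>x y. f 3 (br x y) = - wedge (f 1) (f 2) x y)"
    using first_three_differentials[OF fl n] by auto
  have l: "linear (f 1)" "linear (f 2)" "linear (f 3)" "linear (f 4)"
    using flag_linear(1)[OF fl] n by simp_all
  show ?thesis
  proof (cases "\<forall>x y. f 3 (br x y) = 0")
    case closed3: True
    have f4: "f 4 (br x y) = 0" if "f 1 y = 0" "f 2 y = 0" "f 3 y = 0" for x y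
    proof -
      have "4 \<in> {1..n}" "\<forall>i\<in>{1..<4}. f i y = 0"
        using that n by (simp_all add: intervals_numeral)
      then show ?thesis
        using fl unfolding flag_def by blast
    qed
    show ?thesis
    proof (cases "\<forall>x y. f 4 (br x y) = 0")
      case True
      then show ?thesis
        using fl cl closed3 by (intro exI[of _ f]) (simp add: structure4_def)
    next
      case False
      then obtain x0 y0 where nz: "- f 4 (br x0 y0) \<noteq> 0"
        by auto
      have 3: "3 \<in> {3, 4, 5 :: nat}" "3 \<le> n"
        using n by auto
      have clK: "f i (br x y) = 0" if "i \<in> {1..3}" for i x y
        using that cl closed3 by (auto simp: intervals_numeral)
      have van: "- f 4 (br x y) = 0" if "\<forall>i\<in>{1..3}. f i y = 0" for x y
        using that f4 by (simp add: intervals_numeral)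
      obtain g a b c where g: "flag br n g" "\<And>i x y. i \<in> {1..3} \<Longrightarrow> g i (br x y) = 0"
          "\<And>i. i > 3 \<Longrightarrow> g i = f i"
        and eq: "\<And>x y. - f 4 (br x y) = wedge (g 1) (g 2) x y
          + (if (3::nat) = 3 then 0 else a * wedge (g 3) (g 4) x y)
          + (if (3::nat) = 5 then b * wedge (g 3) (g 5) x y + c * wedge (g 4) (g 5) x y else 0)"
        using split_off_plane_expansion[OF fl 3 clK differential_form[OF l(4)] van nz] by blast
      have "g 4 (br x y) = - \<beta> 1 2 (\<lambda>i. g i x) (\<lambda>i. g i y)" for x y
        using eq[of x y] g(3)[of 4] by (simp add: \<beta>_def wedge_def mult.commute)
      then have "structure4 br g 0 (\<beta> 1 2)"
        using g(2)[of 1] g(2)[of 2] g(2)[of 3] by (simp add: structure4_def)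
      then show ?thesis
        using g(1) by blast
    qed
  next
    case False
    then have d3: "\<And>x y. f 3 (br x y) = - wedge (f 1) (f 2) x y"
      using d3 by blast
    obtain a b c where d4: "\<And>x y. f 4 (br x y) =
       - (a * wedge (f 1) (f 2) x y + b * wedge (f 1) (f 3) x y + c * wedge (f 2) (f 3) x y)"
      using differential_expansions(4)[OF fl] n by auto
    define N where "N = b\<^sup>2 + c\<^sup>2"
    show ?thesis
    proof (cases "N = 0")
      case True
      then have "b = 0" "c = 0"
        by (simp_all add: N_def sum_power2_eq_zero_iff)
      then have cl4: "f 4 (br x y) - a * f 3 (br x y) = 0" for x y
        using d3 d4 by simp
      define g where "g = f(1 := f 1, 2 := f 2, 3 := (\<lambda>x. f 4 x - a * f 3 x), 4 := f 3)"
      have "flag br n g"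
        unfolding g_def
        by (rule flag_update4[OF fl n])
          (use l cl d3 cl4 in \<open>auto simp: wedge_def intro!: linear_functional_intros\<close>)
      moreover have "structure4 br g 0 (\<beta> 1 2)"
        using cl cl4 d3 by (simp add: g_def structure4_def \<beta>_def wedge_def)
      ultimately show ?thesis by blast
    next
      case N: False
      define g where "g = f(1 := (\<lambda>x. b * f 1 x + c * f 2 x), 2 := (\<lambda>x. (b * f 2 x - c * f 1 x) / N),
        3 := f 3, 4 := (\<lambda>x. f 4 x - a * f 3 x))"
      have w: "wedge (f 1) (f 2) x y = \<beta> 1 2 (\<lambda>i. g i x) (\<lambda>i. g i y)" for x y
      proof -
        have "(b * f 1 x + c * f 2 x) * (b * f 2 y - c * f 1 y)
          - (b * f 1 y + c * f 2 y) * (b * f 2 x - c * f 1 x) = N * wedge (f 1) (f 2) x y"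
          by (simp add: N_def wedge_def algebra_simps power2_eq_square)
        then show ?thesis
          using N by (simp add: g_def \<beta>_def diff_divide_distrib[symmetric] eq_divide_eq algebra_simps)
      qed
      have st: "structure4 br g (\<beta> 1 2) (\<beta> 1 3)"
      proof -
        have "f 4 (br x y) - a * f 3 (br x y) = - \<beta> 1 3 (\<lambda>i. g i x) (\<lambda>i. g i y)" for x y
          unfolding d3 d4 by (simp add: g_def \<beta>_def wedge_def algebra_simps)
        then show ?thesis
          using cl d3 by (simp add: structure4_def w[symmetric]) (simp add: g_def)
      qed
      have ker: "f 1 x = 0" "f 2 x = 0" if "b * f 1 x + c * f 2 x = 0" "(b * f 2 x - c * f 1 x) / N = 0" for x
        using rotation_eq_0[of b "f 1 x" c "f 2 x"] that N by (auto simp: N_def)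
      have "flag br n g"
        unfolding g_def
      proof (rule flag_update4[OF fl n])
        show "linear (\<lambda>x. b * f 1 x + c * f 2 x)" "linear (\<lambda>x. (b * f 2 x - c * f 1 x) / N)"
          "linear (f 3)" "linear (\<lambda>x. f 4 x - a * f 3 x)"
          using l by (auto intro!: linear_functional_intros)
        show "b * f 1 (br x y) + c * f 2 (br x y) = 0" "(b * f 2 (br x y) - c * f 1 (br x y)) / N = 0" for x y
          using cl by simp_all
        show "f 3 (br x y) = 0" if "b * f 1 y + c * f 2 y = 0" "(b * f 2 y - c * f 1 y) / N = 0" for x y
          using ker[OF that] d3 by (simp add: wedge_def)
        show "f 4 (br x y) - a * f 3 (br x y) = 0"
          if "b * f 1 y + c * f 2 y = 0" "(b * f 2 y - c * f 1 y) / N = 0" "f 3 y = 0" for x y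
          using ker[OF that(1,2)] that(3) d3 d4 by (simp add: wedge_def)
        show "f 1 x = 0 \<and> f 2 x = 0 \<and> f 3 x = 0 \<and> f 4 x = 0"
          if "b * f 1 x + c * f 2 x = 0" "(b * f 2 x - c * f 1 x) / N = 0" "f 3 x = 0"
              "f 4 x - a * f 3 x = 0" for x
          using ker[OF that(1,2)] that(3,4) by simp
      qed
      then show ?thesis
        using st by blast
    qed
  qed
qed

end

context flagged_lie_algebra
begin

lemma flag_vanishes:
  assumes "flag br n f"
  shows "4 \<le> n \<Longrightarrow> f 1 y = 0 \<Longrightarrow> f 2 y = 0 \<Longrightarrow> f 3 y = 0 \<Longrightarrow> f 4 (br x y) = 0"
    and "5 \<le> n \<Longrightarrow> f 1 y = 0 \<Longrightarrow> f 2 y = 0 \<Longrightarrow> f 3 y = 0 \<Longrightarrow> f 4 y = 0 \<Longrightarrow> f 5 (br x y) = 0"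
proof -
  have *: "f k (br x y) = 0" if "k \<in> {1..n}" "\<forall>i\<in>{1..<k}. f i y = 0" for k
    using assms that unfolding flag_def by blast
  show "4 \<le> n \<Longrightarrow> f 1 y = 0 \<Longrightarrow> f 2 y = 0 \<Longrightarrow> f 3 y = 0 \<Longrightarrow> f 4 (br x y) = 0"
    "5 \<le> n \<Longrightarrow> f 1 y = 0 \<Longrightarrow> f 2 y = 0 \<Longrightarrow> f 3 y = 0 \<Longrightarrow> f 4 y = 0 \<Longrightarrow> f 5 (br x y) = 0"
    using *[of 4] *[of 5] by (simp_all add: intervals_numeral)
qed

text \<open>A 2-form in four closed functionals has rank zero, two or four.\<close>

lemma fifth_differential_A4:
  assumes fl: "flag br n f" and n: "5 \<le> n" and st: "structure4 br f 0 0"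
  shows "\<exists>f. flag br n f \<and> (structure5 br f 0 0 0 \<or> structure5 br f 0 0 (\<beta> 1 2) \<or>
    structure5 br f 0 0 (\<beta> 1 2 + \<beta> 3 4))"
proof -
  have cl: "f 1 (br x y) = 0" "f 2 (br x y) = 0" "f 3 (br x y) = 0" "f 4 (br x y) = 0" for x y
    using st by (simp_all add: structure4_def)
  have l: "linear (f 1)" "linear (f 2)" "linear (f 3)" "linear (f 4)" "linear (f 5)"
    using flag_linear(1)[OF fl] n by simp_all
  show ?thesis
  proof (cases "\<forall>x y. f 5 (br x y) = 0")
    case True
    then have "structure5 br f 0 0 0"
      using cl by (simp add: structure5_def structure4_def)
    then show ?thesis
      using fl by blast
  next
    case False
    then obtain x0 y0 where nz: "- f 5 (br x0 y0) \<noteq> 0"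
      by auto
    have 4: "4 \<in> {3, 4, 5 :: nat}" "4 \<le> n"
      using n by auto
    have clK: "f i (br x y) = 0" if "i \<in> {1..4}" for i x y
      using that cl by (auto simp: intervals_numeral)
    have van: "- f 5 (br x y) = 0" if "\<forall>i\<in>{1..4}. f i y = 0" for x y
      using that flag_vanishes(2)[OF fl n] by (simp add: intervals_numeral)
    obtain g a b c where g: "flag br n g" "\<And>i x y. i \<in> {1..4} \<Longrightarrow> g i (br x y) = 0"
        "\<And>i. i > 4 \<Longrightarrow> g i = f i"
      and eq: "\<And>x y. - f 5 (br x y) = wedge (g 1) (g 2) x y
        + (if (4::nat) = 3 then 0 else a * wedge (g 3) (g 4) x y)
        + (if (4::nat) = 5 then b * wedge (g 3) (g 5) x y + c * wedge (g 4) (g 5) x y else 0)"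
      using split_off_plane_expansion[OF fl 4 clK differential_form[OF l(5)] van nz] by blast
    have gcl: "g 1 (br x y) = 0" "g 2 (br x y) = 0" "g 3 (br x y) = 0" "g 4 (br x y) = 0" for x y
      using g(2) by (simp_all add: intervals_numeral)
    have g5: "g 5 (br x y) = - (wedge (g 1) (g 2) x y + a * wedge (g 3) (g 4) x y)" for x y
      using eq[of x y] g(3)[of 5] by simp
    have gl: "linear (g 1)" "linear (g 2)" "linear (g 3)" "linear (g 4)" "linear (g 5)"
      using flag_linear(1)[OF g(1)] n by simp_all
    show ?thesis
    proof (cases "a = 0")
      case True
      then have "structure5 br g 0 0 (\<beta> 1 2)"
        using gcl by (simp add: structure5_def structure4_def g5 wedge_def \<beta>_def mult.commute)
      then show ?thesis
        using g(1) by blast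
    next
      case a: False
      define h where "h = g(1 := g 1, 2 := g 2, 3 := (\<lambda>x. a * g 3 x), 4 := g 4, 5 := g 5)"
      have "flag br n h"
        unfolding h_def
        by (rule flag_update5[OF g(1) n])
          (use gl gcl g5 a in \<open>auto simp: wedge_def intro!: linear_functional_intros\<close>)
      moreover have "structure5 br h 0 0 (\<beta> 1 2 + \<beta> 3 4)"
        using gcl by (simp add: structure5_def structure4_def g5 h_def wedge_def \<beta>_def algebra_simps)
      ultimately show ?thesis by blast
    qed
  qed
qed

text \<open>Over the reals a pair \<open>(p, q) \<noteq> 0\<close> extends to a basis by \<open>(- q, p)\<close>, so any given
  combination can be made the first functional without a case distinction.\<close>

lemma rotate_plane:
  assumes fl: "flag br n f" and n: "5 \<le> n" and cl: "\<And>x y. f 1 (br x y) = 0" "\<And>x y. f 2 (br x y) = 0"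
    and nz: "p\<^sup>2 + q\<^sup>2 \<noteq> 0"
  obtains g where "flag br n g" "g 1 = (\<lambda>x. p * f 1 x + q * f 2 x)" "\<And>i. i > 2 \<Longrightarrow> g i = f i"
    "\<And>x y. g 1 (br x y) = 0" "\<And>x y. g 2 (br x y) = 0"
    "\<And>x y. wedge (g 1) (g 2) x y = wedge (f 1) (f 2) x y"
    "\<And>u v. \<exists>r t. \<forall>x. u * f 1 x + v * f 2 x = r * g 1 x + t * g 2 x"
proof -
  define N where "N = p\<^sup>2 + q\<^sup>2"
  define g where "g = f(1 := (\<lambda>x. p * f 1 x + q * f 2 x), 2 := (\<lambda>x. (p * f 2 x - q * f 1 x) / N))"
  have N: "N \<noteq> 0"
    using nz by (simp add: N_def)
  have g12: "g 1 = (\<lambda>x. p * f 1 x + q * f 2 x)" "g 2 = (\<lambda>x. (p * f 2 x - q * f 1 x) / N)"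
    by (simp_all add: g_def)
  have l: "linear (f 1)" "linear (f 2)"
    using flag_linear(1)[OF fl] n by simp_all
  have gcl: "g 1 (br x y) = 0" "g 2 (br x y) = 0" for x y
    by (simp_all add: g12 cl)
  have ker: "f 1 x = 0 \<and> f 2 x = 0" if "g 1 x = 0" "g 2 x = 0" for x
  proof -
    have "p * f 1 x + q * f 2 x = 0" "p * f 2 x - q * f 1 x = 0"
      using that N by (simp_all add: g12)
    then show ?thesis
      using rotation_eq_0[of p "f 1 x" q "f 2 x"] nz by blast
  qed
  have flg: "flag br n g"
  proof (rule flag_replace[OF fl, of 2])
    show "\<forall>i\<in>{1..2}. linear (g i)"
      using l by (auto simp: intervals_numeral g12 intro!: linear_functional_intros)
    show "\<forall>i\<in>{1..2}. f i x = 0" if "\<forall>i\<in>{1..2}. g i x = 0" for x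
      using that ker by (simp add: intervals_numeral)
    show "\<forall>k\<in>{1..2}. \<forall>x y. (\<forall>i\<in>{1..<k}. g i y = 0) \<longrightarrow> g k (br x y) = 0"
      using gcl by (simp add: intervals_numeral)
  qed (use n in \<open>simp_all add: g_def\<close>)
  have w: "wedge (g 1) (g 2) x y = wedge (f 1) (f 2) x y" for x y
  proof -
    have "(p * f 1 x + q * f 2 x) * (p * f 2 y - q * f 1 y)
      - (p * f 1 y + q * f 2 y) * (p * f 2 x - q * f 1 x) = N * wedge (f 1) (f 2) x y"
      by (simp add: N_def wedge_def algebra_simps power2_eq_square)
    moreover have "wedge (g 1) (g 2) x y = ((p * f 1 x + q * f 2 x) * (p * f 2 y - q * f 1 y)
      - (p * f 1 y + q * f 2 y) * (p * f 2 x - q * f 1 x)) / N"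
      using N by (simp add: g12 wedge_def field_simps)
    ultimately show ?thesis
      using N by simp
  qed
  have comb: "u * f 1 x + v * f 2 x = (u * p + v * q) / N * g 1 x + (v * p - u * q) * g 2 x" for u v x
  proof -
    have "(u * p + v * q) * (p * f 1 x + q * f 2 x) + (v * p - u * q) * (p * f 2 x - q * f 1 x)
      = N * (u * f 1 x + v * f 2 x)"
      by (simp add: N_def algebra_simps power2_eq_square)
    then show ?thesis
      using N by (simp add: g12 add_divide_distrib[symmetric] eq_divide_eq mult.commute)
  qed
  show thesis
  proof (rule that[of g])
    show "\<exists>r t. \<forall>x. u * f 1 x + v * f 2 x = r * g 1 x + t * g 2 x" for u v
      using comb by blast
  qed (use flg gcl w in \<open>simp_all add: g_def\<close>)
qed

text \<open>The condition \<open>d\<^sup>2 = 0\<close> removes \<open>\<alpha>\<^sub>3\<^sub>4\<close>, and \<open>\<alpha>\<^sub>1\<^sub>2\<close> is exact. What is left is \<open>(c\<^sub>1\<^sub>3 \<alpha>\<^sub>1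
  + c\<^sub>2\<^sub>3 \<alpha>\<^sub>2) \<and> \<alpha>\<^sub>3 + (c\<^sub>1\<^sub>4 \<alpha>\<^sub>1 + c\<^sub>2\<^sub>4 \<alpha>\<^sub>2) \<and> \<alpha>\<^sub>4\<close>, and the factor of \<open>\<alpha>\<^sub>4\<close>, or that of \<open>\<alpha>\<^sub>3\<close>
  if it vanishes, is made the new \<open>\<alpha>\<^sub>1\<close>.\<close>

lemma fifth_differential_L3_A1:
  assumes fl: "flag br n f" and n: "5 \<le> n" and st: "structure4 br f 0 (\<beta> 1 2)"
  shows "\<exists>f. flag br n f \<and> (structure5 br f 0 0 (\<beta> 1 2) \<or> structure5 br f 0 (\<beta> 1 2) (\<beta> 1 3) \<or>
    structure5 br f 0 (\<beta> 1 2) (\<beta> 1 4) \<or> structure5 br f 0 (\<beta> 1 2) (\<beta> 1 4 + \<beta> 2 3))"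
proof -
  have cl: "f 1 (br x y) = 0" "f 2 (br x y) = 0" "f 3 (br x y) = 0" for x y
    using st by (simp_all add: structure4_def)
  have d4: "f 4 (br x y) = - wedge (f 1) (f 2) x y" for x y
    using st by (simp add: structure4_def \<beta>_def wedge_def mult.commute)
  have l: "linear (f 1)" "linear (f 2)" "linear (f 3)" "linear (f 4)" "linear (f 5)"
    using flag_linear(1)[OF fl] n by simp_all
  obtain c12 c13 c14 c23 c24 c34 where d5: "\<And>x y. f 5 (br x y) =
      - (c12 * wedge (f 1) (f 2) x y + c13 * wedge (f 1) (f 3) x y + c14 * wedge (f 1) (f 4) x y
        + c23 * wedge (f 2) (f 3) x y + c24 * wedge (f 2) (f 4) x y + c34 * wedge (f 3) (f 4) x y)"
    using differential_expansions(5)[OF fl] n by auto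
  obtain e where "\<And>i j. i \<in> {1..n} \<Longrightarrow> j \<in> {1..n} \<Longrightarrow> f i (e j) = (if i = j then 1 else 0)"
    using flag_dual_basis[OF fl dim] by metis
  then have e: "f i (e j) = (if i = j then 1 else 0)" if "i \<in> {1, 2, 3, 4}" "j \<in> {1, 2, 3, 4}" for i j
    using that n by auto
  have "c34 = 0"
    using jacobi_functional[OF l(5), of "e 1" "e 2" "e 3"]
    unfolding d5 by (simp add: wedge_def cl d4 e)
  note d5 = d5[unfolded this mult_zero_left add_0_right]
  show ?thesis
  proof (cases "c14\<^sup>2 + c24\<^sup>2 = 0")
    case True
    then have "c14 = 0" "c24 = 0"
      by (simp_all add: sum_power2_eq_zero_iff)
    note d5 = d5[unfolded this mult_zero_left add_0_right]
    show ?thesis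
    proof (cases "c13\<^sup>2 + c23\<^sup>2 = 0")
      case True
      then have "c13 = 0" "c23 = 0"
        by (simp_all add: sum_power2_eq_zero_iff)
      note d5 = d5[unfolded this mult_zero_left add_0_right]
      define g where "g = f(1 := f 1, 2 := f 2, 3 := f 3, 4 := (\<lambda>x. f 5 x - c12 * f 4 x), 5 := f 4)"
      have "flag br n g"
        unfolding g_def
        by (rule flag_update5[OF fl n])
          (use l in \<open>auto simp: cl d4 d5 wedge_def intro!: linear_functional_intros\<close>)
      moreover have "structure5 br g 0 0 (\<beta> 1 2)"
        by (simp add: structure5_def structure4_def g_def cl d4 d5 wedge_def \<beta>_def algebra_simps)
      ultimately show ?thesis by blast
    next
      case False
      obtain h where h: "flag br n h" and h1: "h 1 = (\<lambda>x. c13 * f 1 x + c23 * f 2 x)"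
        and hf: "\<And>i. i > 2 \<Longrightarrow> h i = f i" and hcl: "\<And>x y. h 1 (br x y) = 0" "\<And>x y. h 2 (br x y) = 0"
        and w: "\<And>x y. wedge (h 1) (h 2) x y = wedge (f 1) (f 2) x y"
        by (rule rotate_plane[OF fl n cl(1,2) False]) (rule that)
      have hl: "linear (h 1)" "linear (h 2)" "linear (h 3)" "linear (h 4)" "linear (h 5)"
        using flag_linear(1)[OF h] n by simp_all
      have h3: "h 3 (br x y) = 0" and h4: "h 4 (br x y) = - wedge (h 1) (h 2) x y" for x y
        using cl(3) d4 by (simp_all add: hf w)
      have h5: "h 5 (br x y) - c12 * h 4 (br x y) = - wedge (h 1) (h 3) x y" for x y
        unfolding h4 w by (simp add: hf d5) (simp add: wedge_def h1 hf algebra_simps)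
      have h5': "h 5 (br x y) = - (c12 * wedge (h 1) (h 2) x y + wedge (h 1) (h 3) x y)" for x y
        using h5[of x y] by (simp add: h4)
      define g where "g = h(1 := h 1, 2 := h 2, 3 := h 3, 4 := h 4, 5 := (\<lambda>x. h 5 x - c12 * h 4 x))"
      have "flag br n g"
        unfolding g_def
        by (rule flag_update5[OF h n])
          (use hl in \<open>auto simp: hcl h3 h4 h5' wedge_def intro!: linear_functional_intros\<close>)
      moreover have "structure5 br g 0 (\<beta> 1 2) (\<beta> 1 3)"
        by (simp add: structure5_def structure4_def g_def hcl h3 h5)
          (simp add: h4 wedge_def \<beta>_def mult.commute)
      ultimately show ?thesis by blast
    qed
  next
    case False
    obtain h where h: "flag br n h" and h1: "h 1 = (\<lambda>x. c14 * f 1 x + c24 * f 2 x)"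
      and hf: "\<And>i. i > 2 \<Longrightarrow> h i = f i" and hcl: "\<And>x y. h 1 (br x y) = 0" "\<And>x y. h 2 (br x y) = 0"
      and w: "\<And>x y. wedge (h 1) (h 2) x y = wedge (f 1) (f 2) x y"
      and comb: "\<And>u v. \<exists>r t. \<forall>x. u * f 1 x + v * f 2 x = r * h 1 x + t * h 2 x"
      by (rule rotate_plane[OF fl n cl(1,2) False]) (rule that)
    obtain r t where rt: "\<And>x. c13 * f 1 x + c23 * f 2 x = r * h 1 x + t * h 2 x"
      using comb by blast
    have hl: "linear (h 1)" "linear (h 2)" "linear (h 3)" "linear (h 4)" "linear (h 5)"
      using flag_linear(1)[OF h] n by simp_all
    have h3: "h 3 (br x y) = 0" and h4: "h 4 (br x y) = - wedge (h 1) (h 2) x y" for x y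
      using cl(3) d4 by (simp_all add: hf w)
    have h5: "h 5 (br x y) - c12 * h 4 (br x y) =
      - (wedge (h 1) (\<lambda>x. h 4 x + r * h 3 x) x y + t * wedge (h 2) (h 3) x y)" for x y
    proof -
      have "h 5 (br x y) - c12 * h 4 (br x y) = - ((c13 * f 1 x + c23 * f 2 x) * f 3 y
          - (c13 * f 1 y + c23 * f 2 y) * f 3 x + h 1 x * f 4 y - h 1 y * f 4 x)"
        unfolding h4 w by (simp add: hf d5) (simp add: wedge_def h1 algebra_simps)
      also have "\<dots> = - (wedge (h 1) (\<lambda>x. h 4 x + r * h 3 x) x y + t * wedge (h 2) (h 3) x y)"
        unfolding rt by (simp add: hf wedge_def algebra_simps)
      finally show ?thesis .
    qed
    have h5': "h 5 (br x y) = - (c12 * wedge (h 1) (h 2) x y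
      + wedge (h 1) (\<lambda>x. h 4 x + r * h 3 x) x y + t * wedge (h 2) (h 3) x y)" for x y
      using h5[of x y] by (simp add: h4)
    show ?thesis
    proof (cases "t = 0")
      case True
      define g where "g = h(1 := h 1, 2 := h 2, 3 := h 3, 4 := (\<lambda>x. h 4 x + r * h 3 x),
        5 := (\<lambda>x. h 5 x - c12 * h 4 x))"
      have "flag br n g"
        unfolding g_def
        by (rule flag_update5[OF h n])
          (use hl True in \<open>auto simp: hcl h3 h4 h5' wedge_def intro!: linear_functional_intros\<close>)
      moreover have "structure5 br g 0 (\<beta> 1 2) (\<beta> 1 4)"
        by (simp add: structure5_def structure4_def g_def hcl h3 h5 True)
          (simp add: h4 wedge_def \<beta>_def algebra_simps)
      ultimately show ?thesis by blast
    next
      case t: False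
      define g where "g = h(1 := h 1, 2 := h 2, 3 := (\<lambda>x. t * h 3 x), 4 := (\<lambda>x. h 4 x + r * h 3 x),
        5 := (\<lambda>x. h 5 x - c12 * h 4 x))"
      have "flag br n g"
        unfolding g_def
        by (rule flag_update5[OF h n])
          (use hl t in \<open>auto simp: hcl h3 h4 h5' wedge_def intro!: linear_functional_intros\<close>)
      moreover have "structure5 br g 0 (\<beta> 1 2) (\<beta> 1 4 + \<beta> 2 3)"
        by (simp add: structure5_def structure4_def g_def hcl h3 h5)
          (simp add: h4 wedge_def \<beta>_def algebra_simps)
      ultimately show ?thesis by blast
    qed
  qed
qed

text \<open>Here \<open>d\<^sup>2 = 0\<close> removes \<open>\<alpha>\<^sub>3\<^sub>4\<close> and \<open>\<alpha>\<^sub>2\<^sub>4\<close>, and \<open>\<alpha>\<^sub>1\<^sub>2\<close>, \<open>\<alpha>\<^sub>1\<^sub>3\<close> are exact. The two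
  remaining coefficients are scaled to \<open>0\<close> or \<open>1\<close>.\<close>

lemma fifth_differential_L4:
  assumes fl: "flag br n f" and n: "5 \<le> n" and st: "structure4 br f (\<beta> 1 2) (\<beta> 1 3)"
  shows "\<exists>f. flag br n f \<and> (structure5 br f 0 (\<beta> 1 2) (\<beta> 1 4) \<or>
    structure5 br f (\<beta> 1 2) (\<beta> 1 3) (\<beta> 2 3) \<or>
    structure5 br f (\<beta> 1 2) (\<beta> 1 3) (\<beta> 1 4) \<or> structure5 br f (\<beta> 1 2) (\<beta> 1 3) (\<beta> 1 4 + \<beta> 2 3))"
proof -
  have cl: "f 1 (br x y) = 0" "f 2 (br x y) = 0" for x y
    using st by (simp_all add: structure4_def)
  have d3: "f 3 (br x y) = - wedge (f 1) (f 2) x y" and d4: "f 4 (br x y) = - wedge (f 1) (f 3) x y" for x y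
    using st by (simp_all add: structure4_def \<beta>_def wedge_def mult.commute)
  have l: "linear (f 1)" "linear (f 2)" "linear (f 3)" "linear (f 4)" "linear (f 5)"
    using flag_linear(1)[OF fl] n by simp_all
  obtain c12 c13 c14 c23 c24 c34 where d5: "\<And>x y. f 5 (br x y) =
      - (c12 * wedge (f 1) (f 2) x y + c13 * wedge (f 1) (f 3) x y + c14 * wedge (f 1) (f 4) x y
        + c23 * wedge (f 2) (f 3) x y + c24 * wedge (f 2) (f 4) x y + c34 * wedge (f 3) (f 4) x y)"
    using differential_expansions(5)[OF fl] n by auto
  obtain e where "\<And>i j. i \<in> {1..n} \<Longrightarrow> j \<in> {1..n} \<Longrightarrow> f i (e j) = (if i = j then 1 else 0)"
    using flag_dual_basis[OF fl dim] by metis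
  then have e: "f i (e j) = (if i = j then 1 else 0)" if "i \<in> {1, 2, 3, 4}" "j \<in> {1, 2, 3, 4}" for i j
    using that n by auto
  have c34: "c34 = 0"
    using jacobi_functional[OF l(5), of "e 1" "e 2" "e 4"]
    unfolding d5 by (simp add: wedge_def cl d3 d4 e)
  have c24: "c24 = 0"
    using jacobi_functional[OF l(5), of "e 1" "e 2" "e 3"]
    unfolding d5 by (simp add: wedge_def cl d3 d4 e)
  note d5 = d5[unfolded c34 c24 mult_zero_left add_0_right]
  have d5': "f 5 (br x y) - c12 * f 3 (br x y) - c13 * f 4 (br x y) =
      - (c14 * wedge (f 1) (f 4) x y + c23 * wedge (f 2) (f 3) x y)" for x y
    unfolding d3 d4 d5 by simp
  show ?thesis
  proof (cases "c14 = 0")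
    case c14: True
    show ?thesis
    proof (cases "c23 = 0")
      case True
      define g where "g = f(1 := f 1, 2 := f 2, 3 := (\<lambda>x. f 5 x - c12 * f 3 x - c13 * f 4 x),
        4 := f 3, 5 := f 4)"
      have "flag br n g"
        unfolding g_def
        by (rule flag_update5[OF fl n])
          (use l c14 True in \<open>auto simp: cl d3 d4 d5 wedge_def intro!: linear_functional_intros\<close>)
      moreover have "structure5 br g 0 (\<beta> 1 2) (\<beta> 1 4)"
        by (simp add: structure5_def structure4_def g_def cl d5' c14 True)
          (simp add: d3 d4 wedge_def \<beta>_def algebra_simps)
      ultimately show ?thesis by blast
    next
      case c23: False
      define g where "g = f(1 := f 1, 2 := f 2, 3 := f 3, 4 := f 4,
        5 := (\<lambda>x. (f 5 x - c12 * f 3 x - c13 * f 4 x) / c23))"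
      have "flag br n g"
        unfolding g_def
        by (rule flag_update5[OF fl n])
          (use l c14 c23 in \<open>auto simp: cl d3 d4 d5 wedge_def intro!: linear_functional_intros\<close>)
      moreover have "structure5 br g (\<beta> 1 2) (\<beta> 1 3) (\<beta> 2 3)"
        by (simp add: structure5_def structure4_def g_def cl d5' c14 c23)
          (simp add: d3 d4 wedge_def \<beta>_def algebra_simps)
      ultimately show ?thesis by blast
    qed
  next
    case c14: False
    define a where "a = c23 / c14"
    have d5'': "(f 5 (br x y) - c12 * f 3 (br x y) - c13 * f 4 (br x y)) / c14 =
        - (wedge (f 1) (f 4) x y + a * wedge (f 2) (f 3) x y)" for x y
      unfolding d5' a_def using c14 by (simp add: field_simps)
    show ?thesis
    proof (cases "a = 0")
      case True
      define g where "g = f(1 := f 1, 2 := f 2, 3 := f 3, 4 := f 4,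
        5 := (\<lambda>x. (f 5 x - c12 * f 3 x - c13 * f 4 x) / c14))"
      have "flag br n g"
        unfolding g_def
        by (rule flag_update5[OF fl n])
          (use l c14 in \<open>auto simp: cl d3 d4 d5 wedge_def intro!: linear_functional_intros\<close>)
      moreover have "structure5 br g (\<beta> 1 2) (\<beta> 1 3) (\<beta> 1 4)"
        by (simp add: structure5_def structure4_def g_def cl d5'' True)
          (simp add: d3 d4 wedge_def \<beta>_def algebra_simps)
      ultimately show ?thesis by blast
    next
      case a: False
      define h where "h x = (f 5 x - c12 * f 3 x - c13 * f 4 x) / c14" for x
      have h: "h (br x y) = - (wedge (f 1) (f 4) x y + a * wedge (f 2) (f 3) x y)" for x y
        unfolding h_def by (rule d5'')
      have lh: "linear h"
        unfolding h_def using l by (auto intro!: linear_functional_intros)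
      have hz: "f 5 x = 0" if "h x = 0" "f 3 x = 0" "f 4 x = 0" for x
        using that c14 by (simp add: h_def)
      define g where "g = f(1 := f 1, 2 := (\<lambda>x. a * f 2 x), 3 := (\<lambda>x. a * f 3 x), 4 := (\<lambda>x. a * f 4 x),
        5 := (\<lambda>x. a * h x))"
      have "flag br n g"
        unfolding g_def
        by (rule flag_update5[OF fl n])
          (use l lh hz a in \<open>auto simp: cl d3 d4 h wedge_def intro!: linear_functional_intros\<close>)
      moreover have "structure5 br g (\<beta> 1 2) (\<beta> 1 3) (\<beta> 1 4 + \<beta> 2 3)"
        by (simp add: structure5_def structure4_def g_def cl)
          (simp add: h d3 d4 wedge_def \<beta>_def algebra_simps)
      ultimately show ?thesis by blast
    qed
  qed
qed

end

section \<open>Coordinates in dimension six\<close>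

lemma forall_6: "(\<forall>i::6. P i) \<longleftrightarrow> P 1 \<and> P 2 \<and> P 3 \<and> P 4 \<and> P 5 \<and> P 6"
proof -
  have "i \<in> {1, 2, 3, 4, 5, 6}" for i :: 6
  proof (cases i)
    case (of_int z)
    then have "z = 0 \<or> z = 1 \<or> z = 2 \<or> z = 3 \<or> z = 4 \<or> z = 5"
      by auto
    then show ?thesis
      using of_int by auto
  qed
  then show ?thesis
    by (metis empty_iff insert_iff)
qed

lemma vec6_eq_iff: "x = y \<longleftrightarrow> x$1 = y$1 \<and> x$2 = y$2 \<and> x$3 = y$3 \<and> x$4 = y$4 \<and> x$5 = y$5 \<and> x$6 = y$6"
  for x y :: "real^6"
  by (simp add: vec_eq_iff forall_6)

definition vec6 :: "real \<Rightarrow> real \<Rightarrow> real \<Rightarrow> real \<Rightarrow> real \<Rightarrow> real \<Rightarrow> real^6" where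
  "vec6 a b c d e f = (\<chi> i. if i = 1 then a else if i = 2 then b else if i = 3 then c
     else if i = 4 then d else if i = 5 then e else f)"

lemma vec6_nth [simp]:
  "vec6 a b c d e f $ 1 = a" "vec6 a b c d e f $ 2 = b" "vec6 a b c d e f $ 3 = c"
  "vec6 a b c d e f $ 4 = d" "vec6 a b c d e f $ 5 = e" "vec6 a b c d e f $ 6 = f"
  by (simp_all add: vec6_def)

lemma lie6_nth [simp]:
  "lie6 d3 d4 d5 d6 x y $ 1 = 0" "lie6 d3 d4 d5 d6 x y $ 2 = 0"
  "lie6 d3 d4 d5 d6 x y $ 3 = - d3 x y" "lie6 d3 d4 d5 d6 x y $ 4 = - d4 x y"
  "lie6 d3 d4 d5 d6 x y $ 5 = - d5 x y" "lie6 d3 d4 d5 d6 x y $ 6 = - d6 x y"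
  by (simp_all add: lie6_def bracket_of_def)

lemma linear_vec_component: "linear (\<lambda>x::real^'n. x $ i)"
  by (simp add: linear_iff)

lemma linear_functional_mult_right: "linear f \<Longrightarrow> linear (\<lambda>x. f x * c)" for f :: "'a::real_vector \<Rightarrow> real"
  using linear_functional_intros(1)[of f c] by (simp add: mult.commute)

lemmas linear_coordinate_intros =
  linear_functional_intros linear_functional_mult_right linear_vec_component

text \<open>The values of a coframe are coordinates, in which its structure equations define the
  bracket.\<close>

lemma lie6I:
  fixes br :: "'a::real_vector \<Rightarrow> 'a \<Rightarrow> 'a"
  assumes dim: "dim (UNIV :: 'a set) = 6"
    and lin: "linear g1" "linear g2" "linear g3" "linear g4" "linear g5" "linear g6"
    and ker: "\<And>x. g1 x = 0 \<Longrightarrow> g2 x = 0 \<Longrightarrow> g3 x = 0 \<Longrightarrow> g4 x = 0 \<Longrightarrow> g5 x = 0 \<Longrightarrow> g6 x = 0 \<Longrightarrow> x = 0"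
    and V: "\<And>x. V x = vec6 (g1 x) (g2 x) (g3 x) (g4 x) (g5 x) (g6 x)"
    and eqs: "\<And>x y. g1 (br x y) = 0" "\<And>x y. g2 (br x y) = 0"
      "\<And>x y. g3 (br x y) = - d3 (V x) (V y)" "\<And>x y. g4 (br x y) = - d4 (V x) (V y)"
      "\<And>x y. g5 (br x y) = - d5 (V x) (V y)" "\<And>x y. g6 (br x y) = - d6 (V x) (V y)"
  shows "lie_isomorphic br (lie6 d3 d4 d5 d6)"
proof -
  have "linear V"
    using lin by (auto simp: linear_iff V vec6_eq_iff)
  moreover have "bij V"
  proof (rule linear_injective_imp_bij)
    show "x = 0" if "V x = 0" for x
      using that by (intro ker) (simp_all add: V vec6_eq_iff)
  qed (use dim \<open>linear V\<close> in simp_all)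
  moreover have "V (br x y) = lie6 d3 d4 d5 d6 (V x) (V y)" for x y
    by (simp add: vec6_eq_iff) (simp add: V eqs[unfolded V])
  ultimately show ?thesis
    unfolding lie_isomorphic_def by blast
qed

text \<open>A 2-form in the first five coordinates, as it occurs in the last structure equation.\<close>

definition two_form :: "real \<Rightarrow> real \<Rightarrow> real \<Rightarrow> real \<Rightarrow> real \<Rightarrow> real \<Rightarrow> real \<Rightarrow> real \<Rightarrow> real \<Rightarrow> real \<Rightarrow> 6 form2" where
  "two_form c12 c13 c14 c15 c23 c24 c25 c34 c35 c45 x y =
     c12 * \<alpha> 1 2 x y + c13 * \<alpha> 1 3 x y + c14 * \<alpha> 1 4 x y + c15 * \<alpha> 1 5 x y + c23 * \<alpha> 2 3 x y
     + c24 * \<alpha> 2 4 x y + c25 * \<alpha> 2 5 x y + c34 * \<alpha> 3 4 x y + c35 * \<alpha> 3 5 x y + c45 * \<alpha> 4 5 x y"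

lemmas form_simps = two_form_def \<alpha>_def

definition form6 :: "real \<Rightarrow> real \<Rightarrow> real \<Rightarrow> real \<Rightarrow> real \<Rightarrow> real \<Rightarrow> real \<Rightarrow> real \<Rightarrow> real \<Rightarrow> real \<Rightarrow>
    real \<Rightarrow> real \<Rightarrow> real \<Rightarrow> real \<Rightarrow> real \<Rightarrow> 6 form2" where
  "form6 c12 c13 c14 c15 c16 c23 c24 c25 c26 c34 c35 c36 c45 c46 c56 x y =
     two_form c12 c13 c14 c15 c23 c24 c25 c34 c35 c45 x y + c16 * \<alpha> 1 6 x y + c26 * \<alpha> 2 6 x y
     + c36 * \<alpha> 3 6 x y + c46 * \<alpha> 4 6 x y + c56 * \<alpha> 5 6 x y"

lemma vec6_expand:
  fixes x :: "real^6"
  shows "x = x$1 *\<^sub>R vec6 1 0 0 0 0 0 + x$2 *\<^sub>R vec6 0 1 0 0 0 0 + x$3 *\<^sub>R vec6 0 0 1 0 0 0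
    + x$4 *\<^sub>R vec6 0 0 0 1 0 0 + x$5 *\<^sub>R vec6 0 0 0 0 1 0 + x$6 *\<^sub>R vec6 0 0 0 0 0 1"
  by (simp add: vec6_eq_iff)

lemma alternating_form6:
  fixes \<omega> :: "6 form2"
  assumes bil: "bilinear \<omega>" and alt: "\<And>x. \<omega> x x = 0"
  shows "\<exists>c12 c13 c14 c15 c16 c23 c24 c25 c26 c34 c35 c36 c45 c46 c56.
    \<omega> = form6 c12 c13 c14 c15 c16 c23 c24 c25 c26 c34 c35 c36 c45 c46 c56"
proof -
  have anti: "\<omega> x y = - \<omega> y x" for x y
  proof -
    have "\<omega> (x + y) (x + y) = \<omega> x x + \<omega> y x + (\<omega> x y + \<omega> y y)"
      by (simp add: bilinear_ladd[OF bil] bilinear_radd[OF bil])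
    then show ?thesis
      using alt[of x] alt[of y] alt[of "x + y"] by linarith
  qed
  define e where "e i = (if i = 1 then vec6 1 0 0 0 0 0 else if i = 2 then vec6 0 1 0 0 0 0
    else if i = 3 then vec6 0 0 1 0 0 0 else if i = 4 then vec6 0 0 0 1 0 0
    else if i = (5::nat) then vec6 0 0 0 0 1 0 else vec6 0 0 0 0 0 1)" for i
  define w where "w i j = \<omega> (e i) (e j)" for i j
  have x: "x = x$1 *\<^sub>R e 1 + x$2 *\<^sub>R e 2 + x$3 *\<^sub>R e 3 + x$4 *\<^sub>R e 4 + x$5 *\<^sub>R e 5 + x$6 *\<^sub>R e 6" for x
    using vec6_expand[of x] by (simp add: e_def)
  have diag: "w i i = 0" for i
    by (simp add: w_def alt)
  have low: "w 2 1 = - w 1 2" "w 3 1 = - w 1 3" "w 4 1 = - w 1 4" "w 5 1 = - w 1 5" "w 6 1 = - w 1 6"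
    "w 3 2 = - w 2 3" "w 4 2 = - w 2 4" "w 5 2 = - w 2 5" "w 6 2 = - w 2 6" "w 4 3 = - w 3 4"
    "w 5 3 = - w 3 5" "w 6 3 = - w 3 6" "w 5 4 = - w 4 5" "w 6 4 = - w 4 6" "w 6 5 = - w 5 6"
    unfolding w_def by (rule anti)+
  have left: "\<omega> x y = x$1 * \<omega> (e 1) y + x$2 * \<omega> (e 2) y + x$3 * \<omega> (e 3) y + x$4 * \<omega> (e 4) y
      + x$5 * \<omega> (e 5) y + x$6 * \<omega> (e 6) y" for x y
    by (subst x) (simp add: bilinear_ladd[OF bil] bilinear_lmul[OF bil])
  have right: "\<omega> (e i) y = y$1 * w i 1 + y$2 * w i 2 + y$3 * w i 3 + y$4 * w i 4
      + y$5 * w i 5 + y$6 * w i 6" for i y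
    by (subst x[of y]) (simp add: bilinear_radd[OF bil] bilinear_rmul[OF bil] w_def)
  have "\<omega> x y = form6 (w 1 2) (w 1 3) (w 1 4) (w 1 5) (w 1 6) (w 2 3) (w 2 4) (w 2 5) (w 2 6)
    (w 3 4) (w 3 5) (w 3 6) (w 4 5) (w 4 6) (w 5 6) x y" for x y
    unfolding left[of x y] right diag low form6_def form_simps by (simp add: algebra_simps)
  then show ?thesis
    by blast
qed

lemma form6_bilinear: "bilinear (form6 c12 c13 c14 c15 c16 c23 c24 c25 c26 c34 c35 c36 c45 c46 c56)"
  unfolding bilinear_def form6_def form_simps by (intro conjI allI linear_coordinate_intros)

lemma form6_self: "form6 c12 c13 c14 c15 c16 c23 c24 c25 c26 c34 c35 c36 c45 c46 c56 x x = 0"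
  by (simp add: form6_def form_simps)

lemma symplectic_form_expansion:
  assumes "symplectic_form B \<omega>"
  obtains c12 c13 c14 c15 c16 c23 c24 c25 c26 c34 c35 c36 c45 c46 c56
  where "\<omega> = form6 c12 c13 c14 c15 c16 c23 c24 c25 c26 c34 c35 c36 c45 c46 c56"
  using alternating_form6[of \<omega>] assms unfolding symplectic_form_def by blast

context flagged_lie_algebra
begin

lemma flag_to_coordinates:
  assumes n: "n = 6" and fl: "flag br n f" and st: "structure5 br f d3 d4 d5"
    and V: "\<And>x. V x = vec6 (f 1 x) (f 2 x) (f 3 x) (f 4 x) (f 5 x) (f 6 x)"
    and D: "\<And>x y. d3 (\<lambda>i. f i x) (\<lambda>i. f i y) = D3 (V x) (V y)"
      "\<And>x y. d4 (\<lambda>i. f i x) (\<lambda>i. f i y) = D4 (V x) (V y)"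
      "\<And>x y. d5 (\<lambda>i. f i x) (\<lambda>i. f i y) = D5 (V x) (V y)"
      "\<And>x y. f 6 (br x y) = - D6 (V x) (V y)"
  shows "lie_isomorphic br (lie6 D3 D4 D5 D6)"
proof (rule lie6I[where V = V])
  show "x = 0" if "f 1 x = 0" "f 2 x = 0" "f 3 x = 0" "f 4 x = 0" "f 5 x = 0" "f 6 x = 0" for x
  proof -
    have "\<forall>i\<in>{1..n}. f i x = 0"
      using that n by (simp add: intervals_numeral)
    then show ?thesis
      using fl unfolding flag_def by blast
  qed
qed (use flag_linear(1)[OF fl] n st dim D V in \<open>simp_all add: structure5_def structure4_def\<close>)

text \<open>Only the last structure equation stays arbitrary: a nilpotent algebra of dimension six is
  given by one of the nine algebras of dimension five and ten coefficients.\<close>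

lemma coordinates_of_flag:
  assumes n: "n = 6" and fl: "flag br n f" and st: "structure5 br f d3 d4 d5"
    and D: "\<And>x y u v. d3 x y = D3 (vec6 (x 1) (x 2) (x 3) (x 4) (x 5) u) (vec6 (y 1) (y 2) (y 3) (y 4)
        (y 5) v)"
      "\<And>x y u v. d4 x y = D4 (vec6 (x 1) (x 2) (x 3) (x 4) (x 5) u) (vec6 (y 1) (y 2) (y 3) (y 4) (y 5) v)"
      "\<And>x y u v. d5 x y = D5 (vec6 (x 1) (x 2) (x 3) (x 4) (x 5) u) (vec6 (y 1) (y 2) (y 3) (y 4) (y 5) v)"
  shows "\<exists>c12 c13 c14 c15 c23 c24 c25 c34 c35 c45.
    lie_isomorphic br (lie6 D3 D4 D5 (two_form c12 c13 c14 c15 c23 c24 c25 c34 c35 c45))"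
proof -
  obtain c12 c13 c14 c15 c23 c24 c25 c34 c35 c45 where d6: "\<And>x y. f 6 (br x y) =
       - (c12 * wedge (f 1) (f 2) x y + c13 * wedge (f 1) (f 3) x y + c14 * wedge (f 1) (f 4) x y
         + c15 * wedge (f 1) (f 5) x y + c23 * wedge (f 2) (f 3) x y + c24 * wedge (f 2) (f 4) x y
         + c25 * wedge (f 2) (f 5) x y + c34 * wedge (f 3) (f 4) x y + c35 * wedge (f 3) (f 5) x y
         + c45 * wedge (f 4) (f 5) x y)"
    using differential_expansions(6)[OF fl] n by auto
  show ?thesis
    by (intro exI, rule flag_to_coordinates[OF n fl st refl])
      (rule D d6[unfolded wedge_def, folded \<alpha>_def] | simp add: d6 form_simps wedge_def mult.commute)+
qed

end

section \<open>Reducing the last structure equation\<close>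

text \<open>For each of the nine nilpotent algebras of dimension five, the lemmas \<open>completion_\<dots>\<close>
  simplify the last structure equation. They all follow the same pattern. The Jacobi identity on
  triples of basis vectors gives linear relations between the ten coefficients. Exact summands of
  the 2-form are absorbed by subtracting multiples of \<open>x$3\<close>, \<open>x$4\<close>, \<open>x$5\<close> from \<open>x$6\<close>. The
  remaining coefficients, divided by one of them that is nonzero, are the constants in the new
  coframe, whose six functionals are listed explicitly. The constants are named and substituted
  before the structure equations are verified, which keeps the denominators to single variables.\<close>

definition listed :: "6 bracket \<Rightarrow> bool" where
  "listed B \<longleftrightarrow> (\<exists>L\<in>symplectic_nilpotent_6. lie_isomorphic B L)"

lemma listedI: "lie_isomorphic B L \<Longrightarrow> L \<in> symplectic_nilpotent_6 \<Longrightarrow> listed B"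
  unfolding listed_def by blast

lemma listed_trans: "lie_isomorphic B B' \<Longrightarrow> listed B' \<Longrightarrow> listed B"
  unfolding listed_def using lie_isomorphic_trans by blast

lemma jacobi_component:
  assumes "lie_algebra B"
  shows "B (B x y) z $ i + B (B y z) x $ i + B (B z x) y $ i = (0::real)"
proof -
  interpret lie_algebra B by fact
  have "(B (B x y) z + B (B y z) x + B (B z x) y) $ i = 0"
    by (simp add: jacobi)
  then show ?thesis
    by simp
qed

lemma coordinate_isomorphism:
  fixes g1 g2 g3 g4 g5 g6 :: "real^6 \<Rightarrow> real"
  assumes "linear g1" "linear g2" "linear g3" "linear g4" "linear g5" "linear g6"
    and "\<And>x. g1 x = 0 \<Longrightarrow> g2 x = 0 \<Longrightarrow> g3 x = 0 \<Longrightarrow> g4 x = 0 \<Longrightarrow> g5 x = 0 \<Longrightarrow> g6 x = 0 \<Longrightarrow>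
      x$1 = 0 \<and> x$2 = 0 \<and> x$3 = 0 \<and> x$4 = 0 \<and> x$5 = 0 \<and> x$6 = 0"
    and "\<And>x y. g1 (B x y) = 0" "\<And>x y. g2 (B x y) = 0"
    and "\<And>x y. g3 (B x y) = - d3 (vec6 (g1 x) (g2 x) (g3 x) (g4 x) (g5 x) (g6 x))
      (vec6 (g1 y) (g2 y) (g3 y) (g4 y) (g5 y) (g6 y))"
    and "\<And>x y. g4 (B x y) = - d4 (vec6 (g1 x) (g2 x) (g3 x) (g4 x) (g5 x) (g6 x))
      (vec6 (g1 y) (g2 y) (g3 y) (g4 y) (g5 y) (g6 y))"
    and "\<And>x y. g5 (B x y) = - d5 (vec6 (g1 x) (g2 x) (g3 x) (g4 x) (g5 x) (g6 x))
      (vec6 (g1 y) (g2 y) (g3 y) (g4 y) (g5 y) (g6 y))"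
    and "\<And>x y. g6 (B x y) = - d6 (vec6 (g1 x) (g2 x) (g3 x) (g4 x) (g5 x) (g6 x))
      (vec6 (g1 y) (g2 y) (g3 y) (g4 y) (g5 y) (g6 y))"
  shows "lie_isomorphic B (lie6 d3 d4 d5 d6)"
  by (rule lie6I[where V = "\<lambda>x. vec6 (g1 x) (g2 x) (g3 x) (g4 x) (g5 x) (g6 x)"
      and ?g1.0 = g1 and ?g2.0 = g2 and ?g3.0 = g3 and ?g4.0 = g4 and ?g5.0 = g5 and ?g6.0 = g6])
    (use assms in \<open>simp_all add: vec6_eq_iff\<close>)

abbreviation (input) "u1 \<equiv> vec6 1 0 0 0 0 0"
abbreviation (input) "u2 \<equiv> vec6 0 1 0 0 0 0"
abbreviation (input) "u3 \<equiv> vec6 0 0 1 0 0 0"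
abbreviation (input) "u4 \<equiv> vec6 0 0 0 1 0 0"
abbreviation (input) "u5 \<equiv> vec6 0 0 0 0 1 0"
abbreviation (input) "u6 \<equiv> vec6 0 0 0 0 0 1"

lemmas form6_simps = form6_def form_simps

lemma admits_symplecticE:
  assumes "admits_symplectic (B :: 6 bracket)"
  obtains c12 c13 c14 c15 c16 c23 c24 c25 c26 c34 c35 c36 c45 c46 c56 \<omega> where
    "\<omega> = form6 c12 c13 c14 c15 c16 c23 c24 c25 c26 c34 c35 c36 c45 c46 c56"
    "\<And>x y z. \<omega> (B x y) z + \<omega> (B y z) x + \<omega> (B z x) y = 0"
    "\<And>x. \<forall>y. \<omega> x y = 0 \<Longrightarrow> x = 0"
proof -
  obtain \<omega> where \<omega>: "symplectic_form B \<omega>"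
    using assms unfolding admits_symplectic_def by blast
  obtain c12 c13 c14 c15 c16 c23 c24 c25 c26 c34 c35 c36 c45 c46 c56
    where "\<omega> = form6 c12 c13 c14 c15 c16 c23 c24 c25 c26 c34 c35 c36 c45 c46 c56"
    using symplectic_form_expansion[OF \<omega>] by blast
  then show thesis
    using \<omega> by (intro that[of \<omega>]) (auto simp: symplectic_form_def)
qed

text \<open>Otherwise the last basis vector lies in the radical.\<close>

lemma form6_last_coefficients:
  assumes "\<And>x. \<forall>y. form6 c12 c13 c14 c15 c16 c23 c24 c25 c26 c34 c35 c36 c45 c46 c56 x y = 0 \<Longrightarrow> x = 0"
  shows "\<not> (c16 = 0 \<and> c26 = 0 \<and> c36 = 0 \<and> c46 = 0 \<and> c56 = 0)"
  using assms[of u6] by (auto simp: form6_simps vec6_eq_iff)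

text \<open>A nondegenerate form cannot vanish on a subspace of dimension four of a space of dimension
  six: on the span of the last four basis vectors, the pairings with the first two are two
  functionals, and they have a common zero.\<close>

lemma form6_no_isotropic_tail:
  assumes nd: "\<And>x. \<forall>y. form6 c12 c13 c14 c15 c16 c23 c24 c25 c26 c34 c35 c36 c45 c46 c56 x y = 0 \<Longrightarrow> x = 0"
  shows "\<not> (c34 = 0 \<and> c35 = 0 \<and> c36 = 0 \<and> c45 = 0 \<and> c46 = 0 \<and> c56 = 0)"
proof
  assume z: "c34 = 0 \<and> c35 = 0 \<and> c36 = 0 \<and> c45 = 0 \<and> c46 = 0 \<and> c56 = 0"
  define f :: "nat \<Rightarrow> real^6 \<Rightarrow> real" where
    "f i = (if i = 1 then (\<lambda>x. x$1) else if i = 2 then (\<lambda>x. x$2)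
      else if i = 3 then (\<lambda>x. c13 * x$3 + c14 * x$4 + c15 * x$5 + c16 * x$6)
      else (\<lambda>x. c23 * x$3 + c24 * x$4 + c25 * x$5 + c26 * x$6))" for i
  have "\<exists>x\<in>UNIV. x \<noteq> 0 \<and> (\<forall>i\<in>{1..4}. f i x = 0)"
    by (rule exists_common_zero)
      (auto simp: f_def intro!: linear_coordinate_intros)
  then obtain x where x: "x \<noteq> 0" "\<And>i. i \<in> {1..4} \<Longrightarrow> f i x = 0"
    by auto
  have "x$1 = 0" "x$2 = 0" "c13 * x$3 + c14 * x$4 + c15 * x$5 + c16 * x$6 = 0"
      "c23 * x$3 + c24 * x$4 + c25 * x$5 + c26 * x$6 = 0"
    using x(2)[of 1] x(2)[of 2] x(2)[of 3] x(2)[of 4] by (simp_all add: f_def)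
  moreover have "form6 c12 c13 c14 c15 c16 c23 c24 c25 c26 c34 c35 c36 c45 c46 c56 x y =
      x$1 * (c12 * y$2 + c13 * y$3 + c14 * y$4 + c15 * y$5 + c16 * y$6)
      + x$2 * (c23 * y$3 + c24 * y$4 + c25 * y$5 + c26 * y$6 - c12 * y$1)
      - y$1 * (c13 * x$3 + c14 * x$4 + c15 * x$5 + c16 * x$6)
      - y$2 * (c23 * x$3 + c24 * x$4 + c25 * x$5 + c26 * x$6)" for y
    using z by (simp add: form6_simps algebra_simps)
  ultimately have "\<forall>y. form6 c12 c13 c14 c15 c16 c23 c24 c25 c26 c34 c35 c36 c45 c46 c56 x y = 0"
    by simp
  then show False
    using nd x(1) by blast
qed

text \<open>The roots of \<open>X\<^sup>2 - b X - a\<close> are \<open>l, m\<close>, or \<open>l\<close> twice, or \<open>l \<plusminus> i m\<close>. For a pencil of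
  2-forms with this characteristic polynomial, the real roots are its decomposable members.\<close>

lemma quadratic_trichotomy:
  fixes a b :: real
  shows "(\<exists>l m. l \<noteq> m \<and> b = l + m \<and> a = - (l * m)) \<or> (\<exists>l. b = 2 * l \<and> a = - (l * l)) \<or>
    (\<exists>l m. m \<noteq> 0 \<and> b = 2 * l \<and> a = - (l * l + m * m))"
proof -
  define r where "r = sqrt \<bar>b\<^sup>2 + 4 * a\<bar> / 2"
  have r: "r * r = \<bar>b\<^sup>2 + 4 * a\<bar> / 4"
    by (simp add: r_def)
  consider "b\<^sup>2 + 4 * a > 0" | "b\<^sup>2 + 4 * a = 0" | "b\<^sup>2 + 4 * a < 0"
    by linarith
  then show ?thesis
  proof cases
    case 1
    then have "b / 2 + r \<noteq> b / 2 - r" "b = (b / 2 + r) + (b / 2 - r)" "a = - ((b / 2 + r) * (b / 2 - r))"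
      using r by (auto simp: algebra_simps power2_eq_square)
    then show ?thesis
      by blast
  next
    case 2
    then have "b = 2 * (b / 2)" "a = - ((b / 2) * (b / 2))"
      by (simp_all add: power2_eq_square)
    then show ?thesis
      by blast
  next
    case 3
    then have "r \<noteq> 0" "b = 2 * (b / 2)" "a = - ((b / 2) * (b / 2) + r * r)"
      using r by (auto simp: power2_eq_square)
    then show ?thesis
      by blast
  qed
qed

text \<open>For \<open>c15 = 0\<close> and \<open>c24 \<noteq> 0\<close> the fifth and sixth structure equation span a pencil of
  2-forms whose decomposable members are the roots of \<open>X\<^sup>2 - q X - p\<close>; two, one or no real roots
  give \<open>L6_10\<close>, \<open>L6_11\<close> and \<open>L6_12\<close>.\<close>

lemma completion_L53:
  assumes lie: "lie_algebra (lie6 0 (\<alpha> 1 2) (\<alpha> 1 4 + \<alpha> 2 3) (two_form c12 c13 c14 c15 c23 c24 c25 c34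
      c35 c45))"
  shows "listed (lie6 0 (\<alpha> 1 2) (\<alpha> 1 4 + \<alpha> 2 3) (two_form c12 c13 c14 c15 c23 c24 c25 c34 c35 c45))"
    (is "listed ?B")
proof -
  note jac = jacobi_component[OF lie, where i = 6]
  have c34: "c34 = - c15"
    using jac[of u1 u2 u3] by (simp add: form_simps)
  have c25: "c25 = 0"
    using jac[of u1 u2 u4] by (simp add: form_simps)
  have c35: "c35 = 0"
    using jac[of u1 u3 u4] by (simp add: form_simps)
  have c45: "c45 = 0"
    using jac[of u1 u2 u5] by (simp add: form_simps)
  note B = c34 c25 c35 c45
  define b where "b = c23 - c14"
  have c23: "c23 = c14 + b"
    by (simp add: b_def)
  show ?thesis
  proof (cases "c15 = 0")
    case e: False
    define a v k where "a = c13 / c15" and "v = b / (2 * c15)" and "k = c24 / c15"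
    then have v: "c23 = c14 + 2 * c15 * v" "c13 = a * c15" "c24 = k * c15"
      using e by (simp_all add: b_def)
    have "lie_isomorphic ?B L6_15"
      unfolding B L6_15_def
      by (rule coordinate_isomorphism[of
          "\<lambda>x. x$1" "\<lambda>x. x$2" "\<lambda>x. x$3 + v * x$1 - k * x$2"
          "\<lambda>x. x$4 + v * x$2" "\<lambda>x. x$5 + a * (x$3 + v * x$1 - k * x$2)"
          "\<lambda>x. (x$6 - c12 * x$4 - c14 * x$5) / c15 - v * x$5 - (a * k + v * v) * x$4"])
        (use e in \<open>auto intro!: linear_coordinate_intros simp: form_simps v field_simps\<close>)
    then show ?thesis
      by (rule listedI) (simp add: symplectic_nilpotent_6_def)
  next
    case e: True
    note B = B e
    show ?thesis
    proof (cases "c24 = 0")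
      case c: True
      note B = B c
      show ?thesis
      proof (cases "b = 0")
        case b: False
        define a where "a = c13 / b"
        then have a: "c13 = a * b"
          using b by simp
        have "lie_isomorphic ?B L6_6"
          unfolding B L6_6_def
          by (rule coordinate_isomorphism[of
              "\<lambda>x. x$2 + a * x$1" "\<lambda>x. x$1" "\<lambda>x. x$3"
              "\<lambda>x. a * x$3 - x$4" "\<lambda>x. (x$6 - c12 * x$4 - c14 * x$5) / b"
              "\<lambda>x. (x$6 - c12 * x$4 - c14 * x$5) / b - x$5"])
            (use b in \<open>auto intro!: linear_coordinate_intros simp: form_simps a c23 field_simps\<close>)
        then show ?thesis
          by (rule listedI) (simp add: symplectic_nilpotent_6_def)
      next
        case b: True
        note B = B c23 b
        show ?thesis
        proof (cases "c13 = 0")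
          case a: True
          note B = B a
          have "lie_isomorphic ?B L5_3_S_A1"
            unfolding B L5_3_S_A1_def
            by (rule coordinate_isomorphism[of
                "\<lambda>x. x$1" "\<lambda>x. x$2" "\<lambda>x. x$3"
                "\<lambda>x. x$6 - c12 * x$4 - c14 * x$5" "\<lambda>x. x$4" "\<lambda>x. x$5"])
              (auto intro!: linear_coordinate_intros simp: form_simps algebra_simps)
          then show ?thesis
            by (rule listedI) (simp add: symplectic_nilpotent_6_def)
        next
          case a: False
          have "lie_isomorphic ?B L6_9"
            unfolding B L6_9_def
            by (rule coordinate_isomorphism[of
                "\<lambda>x. x$1" "\<lambda>x. x$2" "\<lambda>x. x$3" "\<lambda>x. x$4"
                "\<lambda>x. (x$6 - c12 * x$4 - c14 * x$5) / c13" "\<lambda>x. x$5"])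
              (use a in \<open>auto intro!: linear_coordinate_intros simp: form_simps field_simps\<close>)
          then show ?thesis
            by (rule listedI) (simp add: symplectic_nilpotent_6_def)
        qed
      qed
    next
      case c: False
      define p q where "p = c13 / c24" and "q = b / c24"
      then have pq: "c13 = p * c24" "c23 = c14 + q * c24"
        using c by (simp_all add: b_def)
      consider (real) l m where "l \<noteq> m" "q = l + m" "p = - (l * m)"
        | (double) l where "q = 2 * l" "p = - (l * l)"
        | (complex) l m where "m \<noteq> 0" "q = 2 * l" "p = - (l * l + m * m)"
        using quadratic_trichotomy[of q p] by blast
      then show ?thesis
      proof cases
        case real
        define \<delta> where "\<delta> = l - m"
        have \<delta>: "\<delta> \<noteq> 0" "l = m + \<delta>"
          using real(1) by (simp_all add: \<delta>_def)
        have "lie_isomorphic ?B L6_10"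
          unfolding B L6_10_def
          by (rule coordinate_isomorphism[of
              "\<lambda>x. x$2 - m * x$1" "\<lambda>x. x$2 - (m + \<delta>) * x$1"
              "\<lambda>x. - \<delta> * \<delta> * x$3"
              "\<lambda>x. \<delta> * (x$4 + (m + \<delta>) * x$3)"
              "\<lambda>x. \<delta> * ((x$6 - c12 * x$4 - c14 * x$5) / c24 - m * x$5)"
              "\<lambda>x. \<delta> * ((x$6 - c12 * x$4 - c14 * x$5) / c24 - (m + \<delta>) * x$5)"])
            (use c \<delta>(1) in \<open>auto intro!: linear_coordinate_intros simp: form_simps pq real(2,3) \<delta>(2)
                field_simps\<close>)
        then show ?thesis
          by (rule listedI) (simp add: symplectic_nilpotent_6_def)
      next
        case double
        have "lie_isomorphic ?B L6_11"
          unfolding B L6_11_def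
          by (rule coordinate_isomorphism[of
              "\<lambda>x. x$2 - l * x$1" "\<lambda>x. x$1" "\<lambda>x. - x$3"
              "\<lambda>x. - (x$4 + l * x$3)"
              "\<lambda>x. - ((x$6 - c12 * x$4 - c14 * x$5) / c24 - l * x$5)" "\<lambda>x. - x$5"])
            (use c in \<open>auto intro!: linear_coordinate_intros simp: form_simps pq double field_simps\<close>)
        then show ?thesis
          by (rule listedI) (simp add: symplectic_nilpotent_6_def)
      next
        case complex
        have "lie_isomorphic ?B L6_12"
          unfolding B L6_12_def
          by (rule coordinate_isomorphism[of
              "\<lambda>x. x$1" "\<lambda>x. (x$2 - l * x$1) / m" "\<lambda>x. x$3"
              "\<lambda>x. (x$4 + l * x$3) / m" "\<lambda>x. x$5 / m"
              "\<lambda>x. - ((x$6 - c12 * x$4 - c14 * x$5) / c24 - l * x$5) / (m * m)"])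
            (use c complex(1) in \<open>auto intro!: linear_coordinate_intros simp: form_simps pq
                complex(2,3) field_simps\<close>)
        then show ?thesis
          by (rule listedI) (simp add: symplectic_nilpotent_6_def)
      qed
    qed
  qed
qed

text \<open>The last case, with only \<open>\<alpha>\<^sub>2\<^sub>4\<close> and exact terms in the sixth structure equation, is the
  one without symplectic forms: a closed form vanishes on the span of the last four basis
  vectors.\<close>

lemma completion_L4_A1:
  assumes lie: "lie_algebra (lie6 0 (\<alpha> 1 2) (\<alpha> 1 4) (two_form c12 c13 c14 c15 c23 c24 c25 c34 c35 c45))"
    and symp: "admits_symplectic
      (lie6 0 (\<alpha> 1 2) (\<alpha> 1 4) (two_form c12 c13 c14 c15 c23 c24 c25 c34 c35 c45))"
  shows "listed (lie6 0 (\<alpha> 1 2) (\<alpha> 1 4) (two_form c12 c13 c14 c15 c23 c24 c25 c34 c35 c45))"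
    (is "listed ?B")
proof -
  note jac = jacobi_component[OF lie, where i = 6]
  have c34: "c34 = 0"
    using jac[of u1 u2 u3] by (simp add: form_simps)
  have c25: "c25 = 0"
    using jac[of u1 u2 u4] by (simp add: form_simps)
  have c35: "c35 = 0"
    using jac[of u1 u3 u4] by (simp add: form_simps)
  have c45: "c45 = 0"
    using jac[of u1 u2 u5] by (simp add: form_simps)
  note B = c34 c25 c35 c45
  show ?thesis
  proof (cases "c15 = 0")
    case e: False
    define a where "a = c13 / c15"
    then have a: "c13 = a * c15"
      using e by simp
    show ?thesis
    proof (cases "c24 = 0")
      case c: True
      note B = B c
      show ?thesis
      proof (cases "c23 = 0")
        case b: True
        note B = B b
        have "lie_isomorphic ?B L5_4_S_A1"
          unfolding B L5_4_S_A1_def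
          by (rule coordinate_isomorphism[of
              "\<lambda>x. x$1" "\<lambda>x. x$2" "\<lambda>x. x$3" "\<lambda>x. x$4"
              "\<lambda>x. x$5 + a * x$3" "\<lambda>x. (x$6 - c12 * x$4 - c14 * x$5) / c15"])
            (use e in \<open>auto intro!: linear_coordinate_intros simp: form_simps a field_simps\<close>)
        then show ?thesis
          by (rule listedI) (simp add: symplectic_nilpotent_6_def)
      next
        case b: False
        define k where "k = c23 / c15"
        then have k: "c23 = k * c15" "k \<noteq> 0"
          using e b by simp_all
        have "lie_isomorphic ?B L6_13"
          unfolding B L6_13_def
          by (rule coordinate_isomorphism[of
              "\<lambda>x. x$1" "\<lambda>x. x$2" "\<lambda>x. k * x$3" "\<lambda>x. x$4"
              "\<lambda>x. x$5 + a * x$3" "\<lambda>x. (x$6 - c12 * x$4 - c14 * x$5) / c15"])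
            (use e k(2) in \<open>auto intro!: linear_coordinate_intros simp: form_simps a k(1) field_simps\<close>)
        then show ?thesis
          by (rule listedI) (simp add: symplectic_nilpotent_6_def)
      qed
    next
      case c: False
      define l where "l = c24 / c15"
      then have l: "c24 = l * c15" "l \<noteq> 0"
        using e c by simp_all
      show ?thesis
      proof (cases "c23 = 0")
        case b: True
        note B = B b
        have "lie_isomorphic ?B L5_6_S_A1"
          unfolding B L5_6_S_A1_def
          by (rule coordinate_isomorphism[of
              "\<lambda>x. x$1" "\<lambda>x. l * x$2" "\<lambda>x. x$3" "\<lambda>x. l * x$4"
              "\<lambda>x. l * (x$5 + a * x$3)"
              "\<lambda>x. l * ((x$6 - c12 * x$4 - c14 * x$5) / c15)"])
            (use e l(2) in \<open>auto intro!: linear_coordinate_intros simp: form_simps a l(1) field_simps\<close>)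
        then show ?thesis
          by (rule listedI) (simp add: symplectic_nilpotent_6_def)
      next
        case b: False
        define k where "k = c23 / c15"
        then have k: "c23 = k * c15" "k \<noteq> 0"
          using e b by simp_all
        have "lie_isomorphic ?B L6_14"
          unfolding B L6_14_def
          by (rule coordinate_isomorphism[of
              "\<lambda>x. x$1" "\<lambda>x. l * x$2" "\<lambda>x. k * x$3" "\<lambda>x. l * x$4"
              "\<lambda>x. l * (x$5 + a * x$3)"
              "\<lambda>x. l * ((x$6 - c12 * x$4 - c14 * x$5) / c15)"])
            (use e l(2) k(2) in \<open>auto intro!: linear_coordinate_intros simp: form_simps a l(1) k(1)
                field_simps\<close>)
        then show ?thesis
          by (rule listedI) (simp add: symplectic_nilpotent_6_def)
      qed
    qed
  next
    case e: True
    note B = B e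
    show ?thesis
    proof (cases "c24 = 0")
      case c: True
      note B = B c
      show ?thesis
      proof (cases "c23 = 0")
        case b: True
        note B = B b
        show ?thesis
        proof (cases "c13 = 0")
          case a: True
          note B = B a
          have "lie_isomorphic ?B L4_S_A2"
            unfolding B L4_S_A2_def
            by (rule coordinate_isomorphism[of
                "\<lambda>x. x$1" "\<lambda>x. x$2" "\<lambda>x. x$3"
                "\<lambda>x. x$6 - c12 * x$4 - c14 * x$5" "\<lambda>x. x$4" "\<lambda>x. x$5"])
              (auto intro!: linear_coordinate_intros simp: form_simps algebra_simps)
          then show ?thesis
            by (rule listedI) (simp add: symplectic_nilpotent_6_def)
        next
          case a: False
          have "lie_isomorphic ?B L6_5"
            unfolding B L6_5_def
            by (rule coordinate_isomorphism[of
                "\<lambda>x. x$1" "\<lambda>x. x$2" "\<lambda>x. x$3" "\<lambda>x. x$4"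
                "\<lambda>x. (x$6 - c12 * x$4 - c14 * x$5) / c13" "\<lambda>x. x$5"])
              (use a in \<open>auto intro!: linear_coordinate_intros simp: form_simps field_simps\<close>)
          then show ?thesis
            by (rule listedI) (simp add: symplectic_nilpotent_6_def)
        qed
      next
        case b: False
        have "lie_isomorphic ?B L6_6"
          unfolding B L6_6_def
          by (rule coordinate_isomorphism[of
              "\<lambda>x. c23 * x$2 + c13 * x$1" "\<lambda>x. x$1" "\<lambda>x. x$3"
              "\<lambda>x. - c23 * x$4" "\<lambda>x. x$6 - c12 * x$4 - c14 * x$5"
              "\<lambda>x. - c23 * x$5"])
            (use b in \<open>auto intro!: linear_coordinate_intros simp: form_simps field_simps\<close>)
        then show ?thesis
          by (rule listedI) (simp add: symplectic_nilpotent_6_def)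
      qed
    next
      case c: False
      define p q where "p = c13 / c24" and "q = c23 / c24"
      then have pq: "c13 = p * c24" "c23 = q * c24"
        using c by simp_all
      show ?thesis
      proof (cases "q = 0")
        case q: False
        define k where "k = p / q"
        then have k: "p = k * q"
          using q by simp
        have "lie_isomorphic ?B L6_10"
          unfolding B L6_10_def
          by (rule coordinate_isomorphism[of
              "\<lambda>x. x$1" "\<lambda>x. x$2 + k * x$1" "\<lambda>x. q * x$3" "\<lambda>x. x$4"
              "\<lambda>x. x$5" "\<lambda>x. (x$6 - c12 * x$4 - c14 * x$5) / c24 + k * x$5"])
            (use c q in \<open>auto intro!: linear_coordinate_intros simp: form_simps pq k field_simps\<close>)
        then show ?thesis
          by (rule listedI) (simp add: symplectic_nilpotent_6_def)
      next
        case q: True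
        show ?thesis
        proof (cases "p = 0")
          case p: False
          have "lie_isomorphic ?B L6_11"
            unfolding B L6_11_def
            by (rule coordinate_isomorphism[of
                "\<lambda>x. x$1" "\<lambda>x. x$2" "\<lambda>x. p * x$3" "\<lambda>x. x$4"
                "\<lambda>x. x$5" "\<lambda>x. (x$6 - c12 * x$4 - c14 * x$5) / c24"])
              (use c p in \<open>auto intro!: linear_coordinate_intros simp: form_simps pq q field_simps\<close>)
          then show ?thesis
            by (rule listedI) (simp add: symplectic_nilpotent_6_def)
        next
          case p: True
          note B = B pq[unfolded p q]
          obtain w12 w13 w14 w15 w16 w23 w24 w25 w26 w34 w35 w36 w45 w46 w56 \<omega>
            where w: "\<omega> = form6 w12 w13 w14 w15 w16 w23 w24 w25 w26 w34 w35 w36 w45 w46 w56"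
            and closed: "\<And>x y z. \<omega> (?B x y) z + \<omega> (?B y z) x + \<omega> (?B z x) y = 0"
            and nondeg: "\<And>x. \<forall>y. \<omega> x y = 0 \<Longrightarrow> x = 0"
            by (rule admits_symplecticE[OF symp]) (rule that)
          note q126 = closed[of u1 u2 u6, unfolded w B]
          note q146 = closed[of u1 u4 u6, unfolded w B]
          note q234 = closed[of u2 u3 u4, unfolded w B]
          note q125 = closed[of u1 u2 u5, unfolded w B]
          note q123 = closed[of u1 u2 u3, unfolded w B]
          note q134 = closed[of u1 u3 u4, unfolded w B]
          have "w46 = 0" "w56 = 0"
            using q126 q146 by (simp_all add: form6_simps)
          moreover from this have "w36 = 0" "w45 = 0"
            using q234 q125 c by (simp_all add: form6_simps)
          moreover from calculation have "w34 = 0" "w35 = 0"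
            using q123 q134 by (simp_all add: form6_simps)
          ultimately show ?thesis
            using form6_no_isotropic_tail[OF nondeg[unfolded w]] by blast
        qed
      qed
    qed
  qed
qed

text \<open>A coefficient \<open>c25 \<noteq> 0\<close> is compatible with the Jacobi identity, but it puts the last basis
  vector into the radical of every closed form.\<close>

lemma completion_L54:
  assumes lie: "lie_algebra (lie6 (\<alpha> 1 2) (\<alpha> 1 3) (\<alpha> 1 4) (two_form c12 c13 c14 c15 c23 c24 c25 c34 c35 c45))"
    and symp: "admits_symplectic
      (lie6 (\<alpha> 1 2) (\<alpha> 1 3) (\<alpha> 1 4) (two_form c12 c13 c14 c15 c23 c24 c25 c34 c35 c45))"
  shows "listed (lie6 (\<alpha> 1 2) (\<alpha> 1 3) (\<alpha> 1 4) (two_form c12 c13 c14 c15 c23 c24 c25 c34 c35 c45))"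
    (is "listed ?B")
proof -
  note jac = jacobi_component[OF lie, where i = 6]
  have c24: "c24 = 0"
    using jac[of u1 u2 u3] by (simp add: form_simps)
  have c34: "c34 = - c25"
    using jac[of u1 u2 u4] by (simp add: form_simps)
  have c35: "c35 = 0"
    using jac[of u1 u2 u5] by (simp add: form_simps)
  have c45: "c45 = 0"
    using jac[of u1 u3 u5] by (simp add: form_simps)
  note B = c24 c34 c35 c45
  have c25: "c25 = 0"
  proof (rule ccontr)
    assume c25: "c25 \<noteq> 0"
    obtain w12 w13 w14 w15 w16 w23 w24 w25 w26 w34 w35 w36 w45 w46 w56 \<omega>
      where w: "\<omega> = form6 w12 w13 w14 w15 w16 w23 w24 w25 w26 w34 w35 w36 w45 w46 w56"
      and closed: "\<And>x y z. \<omega> (?B x y) z + \<omega> (?B y z) x + \<omega> (?B z x) y = 0"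
      and nondeg: "\<And>x. \<forall>y. \<omega> x y = 0 \<Longrightarrow> x = 0"
      by (rule admits_symplecticE[OF symp]) (rule that)
    note q126 = closed[of u1 u2 u6, unfolded w B]
    note q136 = closed[of u1 u3 u6, unfolded w B]
    note q146 = closed[of u1 u4 u6, unfolded w B]
    note q234 = closed[of u2 u3 u4, unfolded w B]
    note q125 = closed[of u1 u2 u5, unfolded w B]
    note q134 = closed[of u1 u3 u4, unfolded w B]
    have "w36 = 0" "w46 = 0" "w56 = 0"
      using q126 q136 q146 by (simp_all add: form6_simps)
    moreover from this have "w26 = 0"
      using q234 c25 by (simp add: form6_simps)
    moreover from calculation have "w16 = 0"
      using q125 q134 c25 by (auto simp: form6_simps)
    ultimately show False
      using form6_last_coefficients[OF nondeg[unfolded w]] by blast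
  qed
  note B = B[unfolded c25 minus_zero] c25
  show ?thesis
  proof (cases "c15 = 0")
    case a: True
    note B = B a
    show ?thesis
    proof (cases "c23 = 0")
      case c: True
      note B = B c
      have "lie_isomorphic ?B L5_4_S_A1"
        unfolding B L5_4_S_A1_def
        by (rule coordinate_isomorphism[of
            "\<lambda>x. x$1" "\<lambda>x. x$2"
            "\<lambda>x. x$6 - c12 * x$3 - c13 * x$4 - c14 * x$5" "\<lambda>x. x$3"
            "\<lambda>x. x$4" "\<lambda>x. x$5"])
          (auto intro!: linear_coordinate_intros simp: form_simps algebra_simps)
      then show ?thesis
        by (rule listedI) (simp add: symplectic_nilpotent_6_def)
    next
      case c: False
      have "lie_isomorphic ?B L6_16"
        unfolding B L6_16_def
        by (rule coordinate_isomorphism[of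
            "\<lambda>x. x$1" "\<lambda>x. x$2" "\<lambda>x. x$3" "\<lambda>x. x$4"
            "\<lambda>x. (x$6 - c12 * x$3 - c13 * x$4 - c14 * x$5) / c23" "\<lambda>x. x$5"])
          (use c in \<open>auto intro!: linear_coordinate_intros simp: form_simps field_simps\<close>)
      then show ?thesis
        by (rule listedI) (simp add: symplectic_nilpotent_6_def)
    qed
  next
    case a: False
    show ?thesis
    proof (cases "c23 = 0")
      case c: True
      note B = B c
      have "lie_isomorphic ?B L6_18"
        unfolding B L6_18_def
        by (rule coordinate_isomorphism[of
            "\<lambda>x. x$1" "\<lambda>x. x$2" "\<lambda>x. x$3" "\<lambda>x. x$4"
            "\<lambda>x. x$5" "\<lambda>x. (x$6 - c12 * x$3 - c13 * x$4 - c14 * x$5) / c15"])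
          (use a in \<open>auto intro!: linear_coordinate_intros simp: form_simps field_simps\<close>)
      then show ?thesis
        by (rule listedI) (simp add: symplectic_nilpotent_6_def)
    next
      case c: False
      define k where "k = c23 / c15"
      then have k: "c23 = k * c15" "k \<noteq> 0"
        using a c by simp_all
      have "lie_isomorphic ?B L6_19"
        unfolding B L6_19_def
        by (rule coordinate_isomorphism[of
            "\<lambda>x. x$1" "\<lambda>x. k * x$2" "\<lambda>x. k * x$3" "\<lambda>x. k * x$4"
            "\<lambda>x. k * x$5"
            "\<lambda>x. k * ((x$6 - c12 * x$3 - c13 * x$4 - c14 * x$5) / c15)"])
          (use a k(2) in \<open>auto intro!: linear_coordinate_intros simp: form_simps k(1) field_simps\<close>)
      then show ?thesis
        by (rule listedI) (simp add: symplectic_nilpotent_6_def)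
    qed
  qed
qed

text \<open>As before, a symplectic form forces \<open>c25 = 0\<close>.\<close>

lemma completion_L56:
  assumes lie: "lie_algebra (lie6 (\<alpha> 1 2) (\<alpha> 1 3) (\<alpha> 1 4 + \<alpha> 2 3) (two_form c12 c13 c14 c15 c23 c24 c25
      c34 c35 c45))"
    and symp: "admits_symplectic
      (lie6 (\<alpha> 1 2) (\<alpha> 1 3) (\<alpha> 1 4 + \<alpha> 2 3) (two_form c12 c13 c14 c15 c23 c24 c25 c34 c35 c45))"
  shows "listed (lie6 (\<alpha> 1 2) (\<alpha> 1 3) (\<alpha> 1 4 + \<alpha> 2 3) (two_form c12 c13 c14 c15 c23 c24 c25 c34 c35 c45))"
    (is "listed ?B")
proof -
  note jac = jacobi_component[OF lie, where i = 6]
  have c24: "c24 = c15"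
    using jac[of u1 u2 u3] by (simp add: form_simps)
  have c34: "c34 = - c25"
    using jac[of u1 u2 u4] by (simp add: form_simps)
  have c35: "c35 = 0"
    using jac[of u1 u2 u5] by (simp add: form_simps)
  have c45: "c45 = 0"
    using jac[of u1 u3 u5] by (simp add: form_simps)
  note B = c24 c34 c35 c45
  have c25: "c25 = 0"
  proof (rule ccontr)
    assume c25: "c25 \<noteq> 0"
    obtain w12 w13 w14 w15 w16 w23 w24 w25 w26 w34 w35 w36 w45 w46 w56 \<omega>
      where w: "\<omega> = form6 w12 w13 w14 w15 w16 w23 w24 w25 w26 w34 w35 w36 w45 w46 w56"
      and closed: "\<And>x y z. \<omega> (?B x y) z + \<omega> (?B y z) x + \<omega> (?B z x) y = 0"
      and nondeg: "\<And>x. \<forall>y. \<omega> x y = 0 \<Longrightarrow> x = 0"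
      by (rule admits_symplecticE[OF symp]) (rule that)
    note q126 = closed[of u1 u2 u6, unfolded w B]
    note q136 = closed[of u1 u3 u6, unfolded w B]
    note q146 = closed[of u1 u4 u6, unfolded w B]
    note q234 = closed[of u2 u3 u4, unfolded w B]
    note q135 = closed[of u1 u3 u5, unfolded w B]
    note q125 = closed[of u1 u2 u5, unfolded w B]
    note q134 = closed[of u1 u3 u4, unfolded w B]
    have "w36 = 0" "w46 = 0"
      using q126 q136 by (simp_all add: form6_simps)
    moreover from this have "w56 = 0"
      using q146 by (simp add: form6_simps)
    moreover from calculation have "w45 = 0"
      using q135 by (simp add: form6_simps)
    moreover from calculation have "w26 = 0"
      using q234 c25 by (simp add: form6_simps)
    moreover from calculation have "w16 = 0"
      using q125 q134 c25 by (auto simp: form6_simps)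
    ultimately show False
      using form6_last_coefficients[OF nondeg[unfolded w]] by blast
  qed
  note B = B[unfolded c25 minus_zero] c25
  define c where "c = c23 - c14"
  have c23: "c23 = c14 + c"
    by (simp add: c_def)
  show ?thesis
  proof (cases "c15 = 0")
    case a: True
    note B = B a
    show ?thesis
    proof (cases "c = 0")
      case c: True
      note B = B c23 c
      have "lie_isomorphic ?B L5_6_S_A1"
        unfolding B L5_6_S_A1_def
        by (rule coordinate_isomorphism[of
            "\<lambda>x. x$1" "\<lambda>x. x$2"
            "\<lambda>x. x$6 - c12 * x$3 - c13 * x$4 - c14 * x$5" "\<lambda>x. x$3"
            "\<lambda>x. x$4" "\<lambda>x. x$5"])
          (auto intro!: linear_coordinate_intros simp: form_simps algebra_simps)
      then show ?thesis
        by (rule listedI) (simp add: symplectic_nilpotent_6_def)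
    next
      case c: False
      have "lie_isomorphic ?B L6_16"
        unfolding B L6_16_def
        by (rule coordinate_isomorphism[of
            "\<lambda>x. x$1" "\<lambda>x. x$2" "\<lambda>x. x$3" "\<lambda>x. x$4"
            "\<lambda>x. (x$6 - c12 * x$3 - c13 * x$4 - c14 * x$5) / c"
            "\<lambda>x. x$5 - (x$6 - c12 * x$3 - c13 * x$4 - c14 * x$5) / c"])
          (use c in \<open>auto intro!: linear_coordinate_intros simp: form_simps c23 field_simps\<close>)
      then show ?thesis
        by (rule listedI) (simp add: symplectic_nilpotent_6_def)
    qed
  next
    case a: False
    define k where "k = - c / (2 * c15)"
    then have k: "c23 = c14 - 2 * k * c15"
      using a by (simp add: c23)
    have "lie_isomorphic ?B L6_21"
      unfolding B L6_21_def
      by (rule coordinate_isomorphism[of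
          "\<lambda>x. x$1" "\<lambda>x. x$2 + k * x$1" "\<lambda>x. x$3" "\<lambda>x. x$4"
          "\<lambda>x. x$5 + k * x$4"
          "\<lambda>x. (x$6 - c12 * x$3 - c13 * x$4 - c14 * x$5) / c15 + 2 * k * x$5"])
        (use a in \<open>auto intro!: linear_coordinate_intros simp: form_simps k field_simps\<close>)
    then show ?thesis
      by (rule listedI) (simp add: symplectic_nilpotent_6_def)
  qed
qed

text \<open>The forms \<open>\<alpha>\<^sub>1\<^sub>4\<close>, \<open>\<alpha>\<^sub>1\<^sub>5 + \<alpha>\<^sub>2\<^sub>4\<close>, \<open>\<alpha>\<^sub>2\<^sub>5\<close> correspond to the quadratic forms \<open>X\<^sup>2\<close>, \<open>2 X
  Y\<close>, \<open>Y\<^sup>2\<close> on a plane. Completing the square leaves \<open>X\<^sup>2 + \<delta> Y\<^sup>2\<close>, and the sign of \<open>\<delta>\<close> decides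
  between \<open>L6_17_plus\<close>, \<open>L6_17_minus\<close> and \<open>L6_16\<close>.\<close>

lemma completion_L55_diagonal:
  assumes a: "a \<noteq> 0"
  shows "listed (lie6 (\<alpha> 1 2) (\<alpha> 1 3) (\<alpha> 2 3) (two_form 0 0 a m 0 m c 0 0 0))" (is "listed ?B")
proof -
  define k \<delta> where "k = m / a" and "\<delta> = (c - m * m / a) / a"
  have "\<delta> * a = c - m * (m / a)" "m / a = k"
    using a by (simp_all add: k_def \<delta>_def)
  moreover have "m = k * a"
    using a by (simp add: k_def)
  ultimately have m: "m = k * a" "c = \<delta> * a + k * k * a"
    by (simp_all add: algebra_simps)
  note B = m
  show ?thesis
  proof (cases "\<delta> = 0")
    case \<delta>: True
    note B = B[unfolded \<delta>]
    have "lie_isomorphic ?B L6_16"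
      unfolding B L6_16_def
      by (rule coordinate_isomorphism[of
          "\<lambda>x. x$1 + k * x$2" "\<lambda>x. x$2" "\<lambda>x. x$3"
          "\<lambda>x. x$4 + k * x$5" "\<lambda>x. x$5" "\<lambda>x. x$6 / a"])
        (use a in \<open>auto intro!: linear_coordinate_intros simp: form_simps field_simps\<close>)
    then show ?thesis
      by (rule listedI) (simp add: symplectic_nilpotent_6_def)
  next
    case \<delta>: False
    define l where "l = sqrt \<bar>\<delta>\<bar>"
    have l: "l \<noteq> 0" "\<delta> = l * l \<or> \<delta> = - (l * l)"
      using \<delta> by (auto simp: l_def)
    from l(2) show ?thesis
    proof
      assume pos: "\<delta> = l * l"
      have "lie_isomorphic ?B L6_17_plus"
        unfolding B L6_17_plus_def
        by (rule coordinate_isomorphism[of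
            "\<lambda>x. x$1 + k * x$2" "\<lambda>x. l * x$2" "\<lambda>x. l * x$3"
            "\<lambda>x. l * (x$4 + k * x$5)" "\<lambda>x. l * l * x$5" "\<lambda>x. l * x$6 / a"])
          (use a l(1) in \<open>auto intro!: linear_coordinate_intros simp: form_simps pos field_simps\<close>)
      then show ?thesis
        by (rule listedI) (simp add: symplectic_nilpotent_6_def)
    next
      assume neg: "\<delta> = - (l * l)"
      have "lie_isomorphic ?B L6_17_minus"
        unfolding B L6_17_minus_def
        by (rule coordinate_isomorphism[of
            "\<lambda>x. x$1 + k * x$2" "\<lambda>x. l * x$2" "\<lambda>x. l * x$3"
            "\<lambda>x. l * (x$4 + k * x$5)" "\<lambda>x. l * l * x$5" "\<lambda>x. l * x$6 / a"])
          (use a l(1) in \<open>auto intro!: linear_coordinate_intros simp: form_simps neg field_simps\<close>)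
      then show ?thesis
        by (rule listedI) (simp add: symplectic_nilpotent_6_def)
    qed
  qed
qed

text \<open>A nonzero quadratic form on the plane can be given a nonzero coefficient of \<open>X\<^sup>2\<close>. If it
  is zero, a closed form vanishes on the span of the last four basis vectors.\<close>

lemma completion_L55:
  assumes lie: "lie_algebra (lie6 (\<alpha> 1 2) (\<alpha> 1 3) (\<alpha> 2 3) (two_form c12 c13 c14 c15 c23 c24 c25 c34 c35 c45))"
    and symp: "admits_symplectic
      (lie6 (\<alpha> 1 2) (\<alpha> 1 3) (\<alpha> 2 3) (two_form c12 c13 c14 c15 c23 c24 c25 c34 c35 c45))"
  shows "listed (lie6 (\<alpha> 1 2) (\<alpha> 1 3) (\<alpha> 2 3) (two_form c12 c13 c14 c15 c23 c24 c25 c34 c35 c45))"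
    (is "listed ?B")
proof -
  note jac = jacobi_component[OF lie, where i = 6]
  have c24: "c24 = c15"
    using jac[of u1 u2 u3] by (simp add: form_simps)
  have c34: "c34 = 0"
    using jac[of u1 u2 u4] by (simp add: form_simps)
  have c35: "c35 = 0"
    using jac[of u1 u2 u5] by (simp add: form_simps)
  have c45: "c45 = 0"
    using jac[of u1 u3 u5] by (simp add: form_simps)
  note B = c24 c34 c35 c45
  show ?thesis
  proof (cases "c14 = 0")
    case a: False
    have iso: "lie_isomorphic ?B (lie6 (\<alpha> 1 2) (\<alpha> 1 3) (\<alpha> 2 3) (two_form 0 0 c14 c15 0 c15 c25 0 0 0))"
      unfolding B
      by (rule coordinate_isomorphism[of
          "\<lambda>x. x$1" "\<lambda>x. x$2" "\<lambda>x. x$3" "\<lambda>x. x$4"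
          "\<lambda>x. x$5" "\<lambda>x. x$6 - c12 * x$3 - c13 * x$4 - c23 * x$5"])
        (auto intro!: linear_coordinate_intros simp: form_simps algebra_simps)
    then show ?thesis
      by (rule listed_trans) (rule completion_L55_diagonal[OF a])
  next
    case a: True
    show ?thesis
    proof (cases "c25 = 0")
      case c: False
      have iso: "lie_isomorphic ?B (lie6 (\<alpha> 1 2) (\<alpha> 1 3) (\<alpha> 2 3) (two_form 0 0 c25 (- c15) 0 (- c15) 0
          0 0 0))"
        unfolding B
        by (rule coordinate_isomorphism[of
            "\<lambda>x. x$2" "\<lambda>x. - x$1" "\<lambda>x. x$3" "\<lambda>x. x$5"
            "\<lambda>x. - x$4" "\<lambda>x. x$6 - c12 * x$3 - c13 * x$4 - c23 * x$5"])
          (use a in \<open>auto intro!: linear_coordinate_intros simp: form_simps algebra_simps\<close>)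
      then show ?thesis
        by (rule listed_trans) (rule completion_L55_diagonal[OF c])
    next
      case c: True
      show ?thesis
      proof (cases "c15 = 0")
        case m: False
        then have m2: "2 * c15 \<noteq> 0"
          by simp
        have iso: "lie_isomorphic ?B (lie6 (\<alpha> 1 2) (\<alpha> 1 3) (\<alpha> 2 3) (two_form 0 0 (2 * c15) c15 0 c15 0
            0 0 0))"
          unfolding B
          by (rule coordinate_isomorphism[of
              "\<lambda>x. x$1" "\<lambda>x. x$2 - x$1" "\<lambda>x. x$3" "\<lambda>x. x$4"
              "\<lambda>x. x$5 - x$4" "\<lambda>x. x$6 - c12 * x$3 - c13 * x$4 - c23 * x$5"])
            (use a c in \<open>auto intro!: linear_coordinate_intros simp: form_simps algebra_simps\<close>)
        then show ?thesis
          by (rule listed_trans) (rule completion_L55_diagonal[OF m2])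
      next
        case m: True
        note B = B a c m
        obtain w12 w13 w14 w15 w16 w23 w24 w25 w26 w34 w35 w36 w45 w46 w56 \<omega>
          where w: "\<omega> = form6 w12 w13 w14 w15 w16 w23 w24 w25 w26 w34 w35 w36 w45 w46 w56"
          and closed: "\<And>x y z. \<omega> (?B x y) z + \<omega> (?B y z) x + \<omega> (?B z x) y = 0"
          and nondeg: "\<And>x. \<forall>y. \<omega> x y = 0 \<Longrightarrow> x = 0"
          by (rule admits_symplecticE[OF symp]) (rule that)
        note q126 = closed[of u1 u2 u6, unfolded w B]
        note q136 = closed[of u1 u3 u6, unfolded w B]
        note q236 = closed[of u2 u3 u6, unfolded w B]
        note q124 = closed[of u1 u2 u4, unfolded w B]
        note q125 = closed[of u1 u2 u5, unfolded w B]
        note q135 = closed[of u1 u3 u5, unfolded w B]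
        have "w36 = 0" "w46 = 0" "w56 = 0"
          using q126 q136 q236 by (simp_all add: form6_simps)
        moreover from this have "w34 = 0" "w35 = 0" "w45 = 0"
          using q124 q125 q135 by (simp_all add: form6_simps)
        ultimately show ?thesis
          using form6_no_isotropic_tail[OF nondeg[unfolded w]] by blast
      qed
    qed
  qed
qed

text \<open>If the last structure equation has rank four, the radical of every closed form contains
  the last basis vector.\<close>

lemma completion_A5:
  assumes symp: "admits_symplectic (lie6 0 0 0 (two_form 1 0 0 0 0 0 0 c34 c35 c45))"
  shows "listed (lie6 0 0 0 (two_form 1 0 0 0 0 0 0 c34 c35 c45))"
    (is "listed ?B")
proof -
  have zero: "c34 = 0 \<and> c35 = 0 \<and> c45 = 0"
  proof (rule ccontr)
    assume nz: "\<not> ?thesis"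
    obtain w12 w13 w14 w15 w16 w23 w24 w25 w26 w34 w35 w36 w45 w46 w56 \<omega>
      where w: "\<omega> = form6 w12 w13 w14 w15 w16 w23 w24 w25 w26 w34 w35 w36 w45 w46 w56"
      and closed: "\<And>x y z. \<omega> (?B x y) z + \<omega> (?B y z) x + \<omega> (?B z x) y = 0"
      and nondeg: "\<And>x. \<forall>y. \<omega> x y = 0 \<Longrightarrow> x = 0"
      by (rule admits_symplecticE[OF symp]) (rule that)
    note q123 = closed[of u1 u2 u3, unfolded w]
    note q124 = closed[of u1 u2 u4, unfolded w]
    note q125 = closed[of u1 u2 u5, unfolded w]
    note q134 = closed[of u1 u3 u4, unfolded w]
    note q234 = closed[of u2 u3 u4, unfolded w]
    note q135 = closed[of u1 u3 u5, unfolded w]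
    note q235 = closed[of u2 u3 u5, unfolded w]
    note q145 = closed[of u1 u4 u5, unfolded w]
    note q245 = closed[of u2 u4 u5, unfolded w]
    note q126 = closed[of u1 u2 u6, unfolded w]
    have "w36 = 0" "w46 = 0" "w56 = 0"
      using q123 q124 q125 by (simp_all add: form6_simps)
    moreover from this have "w16 = 0" "w26 = 0"
      using nz q134 q234 q135 q235 q145 q245 by (auto simp: form6_simps)
    ultimately show False
      using form6_last_coefficients[OF nondeg[unfolded w]] by blast
  qed
  note B = zero
  have "lie_isomorphic ?B L3_S_A3"
    unfolding L3_S_A3_def
    by (rule coordinate_isomorphism[of
        "\<lambda>x. x$1" "\<lambda>x. x$2" "\<lambda>x. x$3" "\<lambda>x. x$4"
        "\<lambda>x. x$5" "\<lambda>x. x$6"])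
      (use zero in \<open>auto intro!: linear_coordinate_intros simp: form_simps algebra_simps\<close>)
  then show ?thesis
    by (rule listedI) (simp add: symplectic_nilpotent_6_def)
qed

text \<open>Here \<open>x$1 + k * x$2\<close> is the functional that is multiplied by \<open>x$5\<close> in the last structure
  equation, and \<open>s\<close>, \<open>t\<close> are what remains of the terms with \<open>x$3\<close> and \<open>x$4\<close> after a change of
  \<open>x$5\<close>.\<close>

lemma completion_L3_A2_transversal:
  assumes c15: "c15 \<noteq> 0"
  shows "listed (lie6 0 0 (\<alpha> 1 2) (two_form c12 c13 c14 c15 c23 c24 c25 0 0 0))"
    (is "listed ?B")
proof -
  define k a b where "k = c25 / c15" and "a = c13 / c15" and "b = c14 / c15"
  define s t where "s = c23 / c15 - k * a" and "t = c24 / c15 - k * b"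
  have B: "c25 = k * c15" "c13 = a * c15" "c14 = b * c15" "c23 = (s + k * a) * c15" "c24 = (t + k * b) * c15"
    using c15 by (simp_all add: k_def a_def b_def s_def t_def)
  show ?thesis
  proof (cases "s = 0")
    case s: True
    show ?thesis
    proof (cases "t = 0")
      case t: True
      have "lie_isomorphic ?B L4_S_A2"
        unfolding B L4_S_A2_def
        by (rule coordinate_isomorphism[of
            "\<lambda>x. x$1 + k * x$2" "\<lambda>x. x$2" "\<lambda>x. x$3" "\<lambda>x. x$4"
            "\<lambda>x. x$5 + a * x$3 + b * x$4" "\<lambda>x. (x$6 - c12 * x$5) / c15"])
          (use c15 s t in \<open>auto intro!: linear_coordinate_intros simp: form_simps field_simps\<close>)
      then show ?thesis
        by (rule listedI) (simp add: symplectic_nilpotent_6_def)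
    next
      case t: False
      have "lie_isomorphic ?B L5_3_S_A1"
        unfolding B L5_3_S_A1_def
        by (rule coordinate_isomorphism[of
            "\<lambda>x. x$1 + k * x$2" "\<lambda>x. x$2" "\<lambda>x. t * x$4" "\<lambda>x. x$3"
            "\<lambda>x. x$5 + a * x$3 + b * x$4" "\<lambda>x. (x$6 - c12 * x$5) / c15"])
          (use c15 s t in \<open>auto intro!: linear_coordinate_intros simp: form_simps field_simps\<close>)
      then show ?thesis
        by (rule listedI) (simp add: symplectic_nilpotent_6_def)
    qed
  next
    case s: False
    have "lie_isomorphic ?B L5_3_S_A1"
      unfolding B L5_3_S_A1_def
      by (rule coordinate_isomorphism[of
          "\<lambda>x. x$1 + k * x$2" "\<lambda>x. x$2" "\<lambda>x. s * x$3 + t * x$4"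
          "\<lambda>x. x$4" "\<lambda>x. x$5 + a * x$3 + b * x$4"
          "\<lambda>x. (x$6 - c12 * x$5) / c15"])
        (use c15 s in \<open>auto intro!: linear_coordinate_intros simp: form_simps field_simps\<close>)
    then show ?thesis
      by (rule listedI) (simp add: symplectic_nilpotent_6_def)
  qed
qed

lemma completion_L3_A2:
  assumes lie: "lie_algebra (lie6 0 0 (\<alpha> 1 2) (two_form c12 c13 c14 c15 c23 c24 c25 c34 c35 c45))"
    and symp: "admits_symplectic
      (lie6 0 0 (\<alpha> 1 2) (two_form c12 c13 c14 c15 c23 c24 c25 c34 c35 c45))"
  shows "listed (lie6 0 0 (\<alpha> 1 2) (two_form c12 c13 c14 c15 c23 c24 c25 c34 c35 c45))"
    (is "listed ?B")
proof -
  note jac = jacobi_component[OF lie, where i = 6]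
  have c35: "c35 = 0"
    using jac[of u1 u2 u3] by (simp add: form_simps)
  have c45: "c45 = 0"
    using jac[of u1 u2 u4] by (simp add: form_simps)
  note B = c35 c45
  show ?thesis
  proof (cases "c15 = 0 \<and> c25 = 0")
    case False
    have c34: "c34 = 0"
    proof (rule ccontr)
      assume c34: "c34 \<noteq> 0"
      obtain w12 w13 w14 w15 w16 w23 w24 w25 w26 w34 w35 w36 w45 w46 w56 \<omega>
        where w: "\<omega> = form6 w12 w13 w14 w15 w16 w23 w24 w25 w26 w34 w35 w36 w45 w46 w56"
        and closed: "\<And>x y z. \<omega> (?B x y) z + \<omega> (?B y z) x + \<omega> (?B z x) y = 0"
        and nondeg: "\<And>x. \<forall>y. \<omega> x y = 0 \<Longrightarrow> x = 0"
        by (rule admits_symplecticE[OF symp]) (rule that)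
      note q126 = closed[of u1 u2 u6, unfolded w B]
      note q135 = closed[of u1 u3 u5, unfolded w B]
      note q235 = closed[of u2 u3 u5, unfolded w B]
      note q145 = closed[of u1 u4 u5, unfolded w B]
      note q245 = closed[of u2 u4 u5, unfolded w B]
      note q134 = closed[of u1 u3 u4, unfolded w B]
      note q234 = closed[of u2 u3 u4, unfolded w B]
      have "w56 = 0"
        using q126 by (simp add: form6_simps)
      moreover from this have "w36 = 0" "w46 = 0"
        using False q135 q235 q145 q245 by (auto simp: form6_simps)
      moreover from this have "w16 = 0" "w26 = 0"
        using c34 q134 q234 by (auto simp: form6_simps)
      ultimately show False
        using form6_last_coefficients[OF nondeg[unfolded w]] by blast
    qed
    note B = B c34
    show ?thesis
    proof (cases "c15 = 0")
      case c15: False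
      then show ?thesis
        unfolding B by (rule completion_L3_A2_transversal)
    next
      case c15: True
      then have c25: "c25 \<noteq> 0"
        using False by simp
      have iso: "lie_isomorphic ?B (lie6 0 0 (\<alpha> 1 2) (two_form c12 c23 c24 c25 (- c13) (- c14) 0 0 0 0))"
        unfolding B
        by (rule coordinate_isomorphism[of
            "\<lambda>x. x$2" "\<lambda>x. - x$1" "\<lambda>x. x$3" "\<lambda>x. x$4"
            "\<lambda>x. x$5" "\<lambda>x. x$6"])
          (use c15 in \<open>auto intro!: linear_coordinate_intros simp: form_simps algebra_simps\<close>)
      then show ?thesis
        by (rule listed_trans) (rule completion_L3_A2_transversal[OF c25])
    qed
  next
    case True
    then have z: "c15 = 0" "c25 = 0"
      by simp_all
    note B = B z
    show ?thesis
    proof (cases "c34 = 0")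
      case c34: False
      define p q r s where "p = c14 / c34" and "q = c24 / c34" and "r = c13 / c34" and "s = c23 / c34"
      then have c: "c14 = p * c34" "c24 = q * c34" "c13 = r * c34" "c23 = s * c34"
        using c34 by simp_all
      have "lie_isomorphic ?B L3_S_L3"
        unfolding B L3_S_L3_def
        by (rule coordinate_isomorphism[of
            "\<lambda>x. x$1" "\<lambda>x. x$2" "\<lambda>x. x$3 + p * x$1 + q * x$2"
            "\<lambda>x. c34 * (x$4 - r * x$1 - s * x$2)" "\<lambda>x. x$5"
            "\<lambda>x. x$6 - c12 * x$5 - c34 * (p * s - q * r) * x$5"])
          (use c34 in \<open>auto intro!: linear_coordinate_intros simp: form_simps c algebra_simps\<close>)
      then show ?thesis
        by (rule listedI) (simp add: symplectic_nilpotent_6_def)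
    next
      case c34: True
      note B = B c34
      show ?thesis
      proof (cases "c13 = 0")
        case c13: False
        define k d where "k = c14 / c13" and "d = c24 - c23 * k"
        then have c: "c14 = k * c13" "c24 = c23 * k + d"
          using c13 by simp_all
        show ?thesis
        proof (cases "d = 0")
          case d: True
          have "lie_isomorphic ?B L5_2_S_A1"
            unfolding B L5_2_S_A1_def
            by (rule coordinate_isomorphism[of
                "\<lambda>x. c13 * x$1 + c23 * x$2" "\<lambda>x. x$2" "\<lambda>x. x$3 + k * x$4"
                "\<lambda>x. x$4" "\<lambda>x. c13 * x$5" "\<lambda>x. x$6 - c12 * x$5"])
              (use c13 d in \<open>auto intro!: linear_coordinate_intros simp: form_simps c algebra_simps\<close>)
          then show ?thesis
            by (rule listedI) (simp add: symplectic_nilpotent_6_def)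
        next
          case d: False
          have "lie_isomorphic ?B L6_1"
            unfolding B L6_1_def
            by (rule coordinate_isomorphism[of
                "\<lambda>x. c13 * x$1 + c23 * x$2" "\<lambda>x. x$2" "\<lambda>x. x$3 + k * x$4"
                "\<lambda>x. d * x$4" "\<lambda>x. c13 * x$5" "\<lambda>x. x$6 - c12 * x$5"])
              (use c13 d in \<open>auto intro!: linear_coordinate_intros simp: form_simps c algebra_simps\<close>)
          then show ?thesis
            by (rule listedI) (simp add: symplectic_nilpotent_6_def)
        qed
      next
        case c13: True
        note B = B c13
        show ?thesis
        proof (cases "c14 = 0")
          case c14: False
          show ?thesis
          proof (cases "c23 = 0")
            case c23: True
            have "lie_isomorphic ?B L5_2_S_A1"
              unfolding B L5_2_S_A1_def
              by (rule coordinate_isomorphism[of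
                  "\<lambda>x. c14 * x$1 + c24 * x$2" "\<lambda>x. x$2" "\<lambda>x. x$4"
                  "\<lambda>x. x$3" "\<lambda>x. c14 * x$5" "\<lambda>x. x$6 - c12 * x$5"])
                (use c14 c23 in \<open>auto intro!: linear_coordinate_intros simp: form_simps algebra_simps\<close>)
            then show ?thesis
              by (rule listedI) (simp add: symplectic_nilpotent_6_def)
          next
            case c23: False
            have "lie_isomorphic ?B L6_1"
              unfolding B L6_1_def
              by (rule coordinate_isomorphism[of
                  "\<lambda>x. c14 * x$1 + c24 * x$2" "\<lambda>x. x$2" "\<lambda>x. x$4"
                  "\<lambda>x. c23 * x$3" "\<lambda>x. c14 * x$5" "\<lambda>x. x$6 - c12 * x$5"])
                (use c14 c23 in \<open>auto intro!: linear_coordinate_intros simp: form_simps algebra_simps\<close>)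
            then show ?thesis
              by (rule listedI) (simp add: symplectic_nilpotent_6_def)
          qed
        next
          case c14: True
          note B = B c14
          show ?thesis
          proof (cases "c23 = 0")
            case c23: False
            define k where "k = c24 / c23"
            then have k: "c24 = k * c23"
              using c23 by simp
            have "lie_isomorphic ?B L5_2_S_A1"
              unfolding B L5_2_S_A1_def
              by (rule coordinate_isomorphism[of
                  "\<lambda>x. c23 * x$2" "\<lambda>x. - x$1" "\<lambda>x. x$3 + k * x$4"
                  "\<lambda>x. x$4" "\<lambda>x. c23 * x$5" "\<lambda>x. x$6 - c12 * x$5"])
                (use c23 in \<open>auto intro!: linear_coordinate_intros simp: form_simps k algebra_simps\<close>)
            then show ?thesis
              by (rule listedI) (simp add: symplectic_nilpotent_6_def)
          next
            case c23: True
            show ?thesis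
            proof (cases "c24 = 0")
              case c24: False
              have "lie_isomorphic ?B L5_2_S_A1"
                unfolding B L5_2_S_A1_def
                by (rule coordinate_isomorphism[of
                    "\<lambda>x. c24 * x$2" "\<lambda>x. - x$1" "\<lambda>x. x$4" "\<lambda>x. x$3"
                    "\<lambda>x. c24 * x$5" "\<lambda>x. x$6 - c12 * x$5"])
                  (use c24 c23 in \<open>auto intro!: linear_coordinate_intros simp: form_simps algebra_simps\<close>)
              then show ?thesis
                by (rule listedI) (simp add: symplectic_nilpotent_6_def)
            next
              case c24: True
              have "lie_isomorphic ?B L3_S_A3"
                unfolding B L3_S_A3_def
                by (rule coordinate_isomorphism[of
                    "\<lambda>x. x$1" "\<lambda>x. x$2" "\<lambda>x. x$3" "\<lambda>x. x$4"
                    "\<lambda>x. x$6 - c12 * x$5" "\<lambda>x. x$5"])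
                  (use c24 c23 in \<open>auto intro!: linear_coordinate_intros simp: form_simps algebra_simps\<close>)
              then show ?thesis
                by (rule listedI) (simp add: symplectic_nilpotent_6_def)
            qed
          qed
        qed
      qed
    qed
  qed
qed

text \<open>By the condition on \<open>x\<close>, the combination of \<open>x\<close> times the fifth structure equation and the
  sixth is decomposable. As the new fifth equation it leads back to \<open>completion_L3_A2\<close>.\<close>

lemma completion_L51_isotropic:
  assumes lie: "lie_algebra (lie6 0 0 (\<alpha> 1 2 + \<alpha> 3 4) (two_form 0 p q 0 r s 0 t 0 0))"
    and symp: "admits_symplectic (lie6 0 0 (\<alpha> 1 2 + \<alpha> 3 4) (two_form 0 p q 0 r s 0 t 0 0))"
    and x: "x \<noteq> 0" "p * s - q * r = x * (x + t)"
  shows "listed (lie6 0 0 (\<alpha> 1 2 + \<alpha> 3 4) (two_form 0 p q 0 r s 0 t 0 0))"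
    (is "listed ?B")
proof -
  define p' q' r' s' where "p' = p / x" and "q' = q / x" and "r' = r / x" and "s' = s / x"
  then have B: "p = x * p'" "q = x * q'" "r = x * r'" "s = x * s'"
    using x by simp_all
  have "x * (x + t) = x * (x * (p' * s' - q' * r'))"
    using x(2) unfolding B by (simp add: algebra_simps)
  then have t: "t = x * (p' * s' - q' * r') - x"
    using x(1) by simp
  have iso: "lie_isomorphic ?B (lie6 0 0 (\<alpha> 1 2) (two_form (1 / x) (- p' / x) (- q' / x) 0 (- r') (-
      s') 0 (1 + p' * s' - q' * r') 0 0))"
    unfolding B
    by (rule coordinate_isomorphism[of
        "\<lambda>v. x * (v$1 - r' * v$3 - s' * v$4)" "\<lambda>v. v$2 + p' * v$3 + q' * v$4"
        "\<lambda>v. v$3" "\<lambda>v. v$4" "\<lambda>v. x * v$5 + v$6" "\<lambda>v. v$5"])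
      (use x(1) in \<open>auto intro!: linear_coordinate_intros simp: form_simps t field_simps\<close>)
  show ?thesis
    using completion_L3_A2[OF lie_algebra_transfer[OF lie iso] admits_symplectic_transfer[OF symp iso]]
    by (rule listed_trans[OF iso])
qed

text \<open>No member of the pencil is decomposable, and the algebra is the complex Heisenberg algebra
  \<open>L6_2\<close>, with \<open>l\<close> and \<open>m\<close> the real and imaginary part of a root.\<close>

lemma completion_L51_definite:
  assumes m: "m \<noteq> 0" and \<delta>: "p * s - q * r = - (l * l + m * m)" and t: "t = - 2 * l"
  shows "listed (lie6 0 0 (\<alpha> 1 2 + \<alpha> 3 4) (two_form 0 p q 0 r s 0 t 0 0))"
    (is "listed ?B")
proof -
  define \<delta> where "\<delta> = - (l * l + m * m)"
  have "m * m > 0"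
    using m not_real_square_gt_zero by blast
  then have "\<delta> < 0"
    unfolding \<delta>_def using zero_le_square[of l] by linarith
  then have \<delta>0: "\<delta> \<noteq> 0"
    by simp
  have std: "listed (lie6 0 0 (\<alpha> 1 2 + \<alpha> 3 4) (two_form 0 1 0 0 0 \<delta> 0 t 0 0))"
    (is "listed ?S")
  proof -
    \<comment> \<open>The constant \<open>\<delta>\<close> stays atomic; \<open>m * m\<close> is eliminated in favour of it.\<close>
    have mm: "m * m = - \<delta> - l * l" "m * (m * z) = (- \<delta> - l * l) * z" for z
      by (simp_all add: \<delta>_def algebra_simps)
    have "lie_isomorphic ?S L6_2"
      unfolding L6_2_def
      by (rule coordinate_isomorphism[of
        "\<lambda>x. x$1 + l * x$4" "\<lambda>x. - m * x$4" "\<lambda>x. \<delta> * x$2 - l * x$3" "\<lambda>x. m * x$3"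
        "\<lambda>x. \<delta> * x$5 - l * x$6" "\<lambda>x. m * x$6"])
        (use m \<delta>0 in \<open>auto intro!: linear_coordinate_intros simp: form_simps t mm algebra_simps\<close>)
    then show ?thesis
      by (rule listedI) (simp add: symplectic_nilpotent_6_def)
  qed
  have main: "listed (lie6 0 0 (\<alpha> 1 2 + \<alpha> 3 4) (two_form 0 p q 0 r s 0 t 0 0))"
    if p: "p \<noteq> 0" and \<delta>': "p * s - q * r = \<delta>" for p q r s
  proof -
    define k d where "k = q / p" and "d = s - r * k"
    have B: "q = k * p" "s = d + r * k"
      using p by (simp_all add: k_def d_def)
    have d: "\<delta> = p * d"
      using \<delta>' unfolding B by (simp add: algebra_simps)
    have iso: "lie_isomorphic (lie6 0 0 (\<alpha> 1 2 + \<alpha> 3 4) (two_form 0 p q 0 r s 0 t 0 0))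
        (lie6 0 0 (\<alpha> 1 2 + \<alpha> 3 4) (two_form 0 1 0 0 0 \<delta> 0 t 0 0))"
      by (rule coordinate_isomorphism[of
        "\<lambda>x. p * x$1 + r * x$2" "\<lambda>x. x$2 / p" "\<lambda>x. x$3 + k * x$4" "\<lambda>x. x$4" "\<lambda>x. x$5" "\<lambda>x. x$6"])
        (use p in \<open>auto intro!: linear_coordinate_intros simp: form_simps B d field_simps\<close>)
    then show ?thesis
      by (rule listed_trans) (rule std)
  qed
  show ?thesis
  proof (cases "p = 0")
    case False
    then show ?thesis
      by (rule main) (simp add: \<delta> \<delta>_def)
  next
    case p: True
    then have "q \<noteq> 0"
      using \<delta> \<delta>0 by (auto simp: \<delta>_def)
    moreover have "q * - r - - p * s = \<delta>"
      using \<delta> p by (simp add: \<delta>_def)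
    ultimately have "listed (lie6 0 0 (\<alpha> 1 2 + \<alpha> 3 4) (two_form 0 q (- p) 0 s (- r) 0 t 0 0))"
      using main[of q "- r" "- p" s] by simp
    moreover have "lie_isomorphic ?B (lie6 0 0 (\<alpha> 1 2 + \<alpha> 3 4) (two_form 0 q (- p) 0 s (- r) 0 t 0 0))"
      by (rule coordinate_isomorphism[of
        "\<lambda>x. x$1" "\<lambda>x. x$2" "\<lambda>x. x$4" "\<lambda>x. - x$3" "\<lambda>x. x$5" "\<lambda>x. x$6"])
        (auto intro!: linear_coordinate_intros simp: form_simps algebra_simps)
    ultimately show ?thesis
      by (metis listed_trans)
  qed
qed

text \<open>The root \<open>0\<close> is double: only the sixth structure equation itself is decomposable.\<close>

lemma completion_L51_degenerate:
  assumes "p * s - q * r = 0" and nz: "\<not> (p = 0 \<and> q = 0 \<and> r = 0 \<and> s = 0)"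
  shows "listed (lie6 0 0 (\<alpha> 1 2 + \<alpha> 3 4) (two_form 0 p q 0 r s 0 0 0 0))"
    (is "listed ?B")
proof (cases "p = 0")
  case p: False
  define k h where "k = q / p" and "h = r / p"
  have B: "s = h * k * p" "q = k * p" "r = h * p"
    using assms(1) p by (simp_all add: k_def h_def field_simps)
  have "lie_isomorphic ?B L6_1"
    unfolding B L6_1_def
    by (rule coordinate_isomorphism[of
        "\<lambda>x. p * (x$1 + h * x$2)" "\<lambda>x. x$3 + k * x$4" "\<lambda>x. x$2 / p"
        "\<lambda>x. x$4" "\<lambda>x. x$6" "\<lambda>x. x$5"])
      (use p in \<open>auto intro!: linear_coordinate_intros simp: form_simps field_simps\<close>)
  then show ?thesis
    by (rule listedI) (simp add: symplectic_nilpotent_6_def)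
next
  case p: True
  then have "q = 0 \<or> r = 0"
    using assms(1) by simp
  show ?thesis
  proof (cases "q = 0")
    case q: False
    then have r: "r = 0"
      using \<open>q = 0 \<or> r = 0\<close> by simp
    note B = p r
    have "lie_isomorphic ?B L6_1"
      unfolding B L6_1_def
      by (rule coordinate_isomorphism[of
          "\<lambda>x. q * x$1 + s * x$2" "\<lambda>x. x$4" "\<lambda>x. x$2 / q"
          "\<lambda>x. - x$3" "\<lambda>x. x$6" "\<lambda>x. x$5"])
        (use q in \<open>auto intro!: linear_coordinate_intros simp: form_simps field_simps\<close>)
    then show ?thesis
      by (rule listedI) (simp add: symplectic_nilpotent_6_def)
  next
    case q: True
    show ?thesis
    proof (cases "r = 0")
      case r: False
      note B = p q
      have "lie_isomorphic ?B L6_1"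
        unfolding B L6_1_def
        by (rule coordinate_isomorphism[of
            "\<lambda>x. x$2" "\<lambda>x. r * x$3 + s * x$4" "\<lambda>x. - x$1"
            "\<lambda>x. x$4 / r" "\<lambda>x. x$6" "\<lambda>x. x$5"])
          (use r in \<open>auto intro!: linear_coordinate_intros simp: form_simps field_simps\<close>)
      then show ?thesis
        by (rule listedI) (simp add: symplectic_nilpotent_6_def)
    next
      case r: True
      then have s: "s \<noteq> 0"
        using nz p q by simp
      note B = p q r
      have "lie_isomorphic ?B L6_1"
        unfolding B L6_1_def
        by (rule coordinate_isomorphism[of
            "\<lambda>x. s * x$2" "\<lambda>x. x$4" "\<lambda>x. - x$1 / s" "\<lambda>x. - x$3"
            "\<lambda>x. x$6" "\<lambda>x. x$5"])
          (use s in \<open>auto intro!: linear_coordinate_intros simp: form_simps field_simps\<close>)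
      then show ?thesis
        by (rule listedI) (simp add: symplectic_nilpotent_6_def)
    qed
  qed
qed

text \<open>The decomposable members of the pencil spanned by the last two structure equations are the
  roots of \<open>X\<^sup>2 + t X - \<delta>\<close>. If the second form of the pencil vanishes, the fifth basis vector is
  in the radical of every closed form.\<close>

lemma completion_L51:
  assumes lie: "lie_algebra (lie6 0 0 (\<alpha> 1 2 + \<alpha> 3 4) (two_form c12 c13 c14 c15 c23 c24 c25 c34 c35 c45))"
    and symp: "admits_symplectic
      (lie6 0 0 (\<alpha> 1 2 + \<alpha> 3 4) (two_form c12 c13 c14 c15 c23 c24 c25 c34 c35 c45))"
  shows "listed (lie6 0 0 (\<alpha> 1 2 + \<alpha> 3 4) (two_form c12 c13 c14 c15 c23 c24 c25 c34 c35 c45))"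
    (is "listed ?B")
proof -
  note jac = jacobi_component[OF lie, where i = 6]
  have c15: "c15 = 0"
    using jac[of u1 u3 u4] by (simp add: form_simps)
  have c25: "c25 = 0"
    using jac[of u2 u3 u4] by (simp add: form_simps)
  have c35: "c35 = 0"
    using jac[of u1 u2 u3] by (simp add: form_simps)
  have c45: "c45 = 0"
    using jac[of u1 u2 u4] by (simp add: form_simps)
  note B = c15 c25 c35 c45
  define t where "t = c34 - c12"
  have c34: "c34 = t + c12"
    by (simp add: t_def)
  have iso: "lie_isomorphic ?B (lie6 0 0 (\<alpha> 1 2 + \<alpha> 3 4) (two_form 0 c13 c14 0 c23 c24 0 t 0 0))"
    unfolding B
    by (rule coordinate_isomorphism[of
        "\<lambda>x. x$1" "\<lambda>x. x$2" "\<lambda>x. x$3" "\<lambda>x. x$4"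
        "\<lambda>x. x$5" "\<lambda>x. x$6 - c12 * x$5"])
      (auto intro!: linear_coordinate_intros simp: form_simps c34 algebra_simps)
  note lie' = lie_algebra_transfer[OF lie iso] and symp' = admits_symplectic_transfer[OF symp iso]
  define \<delta> where "\<delta> = c13 * c24 - c14 * c23"
  note isotropic = completion_L51_isotropic[OF lie' symp', folded \<delta>_def]
  consider (real) l m where "l \<noteq> m" "- t = l + m" "\<delta> = - (l * m)"
    | (double) l where "- t = 2 * l" "\<delta> = - (l * l)"
    | (complex) l m where "m \<noteq> 0" "- t = 2 * l" "\<delta> = - (l * l + m * m)"
    using quadratic_trichotomy[of "- t" \<delta>] by blast
  then have "listed (lie6 0 0 (\<alpha> 1 2 + \<alpha> 3 4) (two_form 0 c13 c14 0 c23 c24 0 t 0 0))"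
  proof cases
    case real
    then have t: "t = - l - m"
      by simp
    show ?thesis
    proof (cases "l = 0")
      case False
      then show ?thesis
        by (rule isotropic) (simp add: t real(3) algebra_simps)
    next
      case True
      then have "m \<noteq> 0"
        using real(1) by simp
      then show ?thesis
        by (rule isotropic) (simp add: t real(3) algebra_simps)
    qed
  next
    case double
    then have t: "t = - l - l"
      by simp
    show ?thesis
    proof (cases "l = 0")
      case False
      then show ?thesis
        by (rule isotropic) (simp add: t double(2) algebra_simps)
    next
      case l: True
      then have t0: "t = 0" and \<delta>0: "c13 * c24 - c14 * c23 = 0"
        using t double(2) by (simp_all add: \<delta>_def)
      have "\<not> (c13 = 0 \<and> c14 = 0 \<and> c23 = 0 \<and> c24 = 0)"
      proof
        assume "c13 = 0 \<and> c14 = 0 \<and> c23 = 0 \<and> c24 = 0"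
        then have z: "c13 = 0" "c14 = 0" "c23 = 0" "c24 = 0"
          by simp_all
        obtain w12 w13 w14 w15 w16 w23 w24 w25 w26 w34 w35 w36 w45 w46 w56 \<omega>
          where w: "\<omega> = form6 w12 w13 w14 w15 w16 w23 w24 w25 w26 w34 w35 w36 w45 w46 w56"
          and closed: "\<And>x y z. \<omega> (lie6 0 0 (\<alpha> 1 2 + \<alpha> 3 4) (two_form 0 c13 c14 0 c23 c24 0 t 0 0) x y)
              z + \<omega> (lie6 0 0 (\<alpha> 1 2 + \<alpha> 3 4) (two_form 0 c13 c14 0 c23 c24 0 t 0 0) y z) x + \<omega> (lie6 0
              0 (\<alpha> 1 2 + \<alpha> 3 4) (two_form 0 c13 c14 0 c23 c24 0 t 0 0) z x) y = 0"
          and nondeg: "\<And>x. \<forall>y. \<omega> x y = 0 \<Longrightarrow> x = 0"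
          by (rule admits_symplecticE[OF symp']) (rule that)
        note q123 = closed[of u1 u2 u3, unfolded w z t0]
        note q124 = closed[of u1 u2 u4, unfolded w z t0]
        note q134 = closed[of u1 u3 u4, unfolded w z t0]
        note q234 = closed[of u2 u3 u4, unfolded w z t0]
        note q126 = closed[of u1 u2 u6, unfolded w z t0]
        have "w15 = 0" "w25 = 0" "w35 = 0" "w45 = 0" "w56 = 0"
          using q134 q234 q123 q124 q126 by (simp_all add: form6_simps)
        then have "\<forall>y. \<omega> u5 y = 0"
          by (simp add: w form6_simps)
        then show False
          using nondeg[of u5] by (simp add: vec6_eq_iff)
      qed
      then show ?thesis
        unfolding t0 by (rule completion_L51_degenerate[OF \<delta>0])
    qed
  next
    case complex
    have "t = - 2 * l"
      using complex(2) by linarith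
    then show ?thesis
      by (rule completion_L51_definite[OF complex(1) complex(3)[unfolded \<delta>_def]])
  qed
  then show ?thesis
    by (rule listed_trans[OF iso])
qed

text \<open>The forms \<open>\<alpha>\<^sub>2\<^sub>4\<close>, \<open>\<alpha>\<^sub>2\<^sub>5 + \<alpha>\<^sub>3\<^sub>4\<close>, \<open>\<alpha>\<^sub>3\<^sub>5\<close> again correspond to quadratic forms on a
  plane; \<open>det\<close> makes the form a multiple of the square of \<open>X + k Y\<close>.\<close>

lemma completion_L52_rank_one:
  assumes lie: "lie_algebra (lie6 0 (\<alpha> 1 2) (\<alpha> 1 3) (two_form c12 c13 c14 c15 c23 c24 c25 c25 c35 0))"
    and symp: "admits_symplectic (lie6 0 (\<alpha> 1 2) (\<alpha> 1 3) (two_form c12 c13 c14 c15 c23 c24 c25 c25 c35 0))"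
    and det: "c24 * c35 = c25 * c25" and c24: "c24 \<noteq> 0"
  shows "listed (lie6 0 (\<alpha> 1 2) (\<alpha> 1 3) (two_form c12 c13 c14 c15 c23 c24 c25 c25 c35 0))"
    (is "listed ?B")
proof -
  define k where "k = c25 / c24"
  have k: "c25 = k * c24" "c35 = k * k * c24"
    using det c24 by (simp_all add: k_def field_simps)
  have c15: "c15 = k * c14"
  proof (rule ccontr)
    assume c15: "c15 \<noteq> k * c14"
    obtain w12 w13 w14 w15 w16 w23 w24 w25 w26 w34 w35 w36 w45 w46 w56 \<omega>
      where w: "\<omega> = form6 w12 w13 w14 w15 w16 w23 w24 w25 w26 w34 w35 w36 w45 w46 w56"
      and closed: "\<And>x y z. \<omega> (?B x y) z + \<omega> (?B y z) x + \<omega> (?B z x) y = 0"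
      and nondeg: "\<And>x. \<forall>y. \<omega> x y = 0 \<Longrightarrow> x = 0"
      by (rule admits_symplecticE[OF symp]) (rule that)
    note q126 = closed[of u1 u2 u6, unfolded w k]
    note q136 = closed[of u1 u3 u6, unfolded w k]
    note q234 = closed[of u2 u3 u4, unfolded w k]
    note q124 = closed[of u1 u2 u4, unfolded w k]
    note q125 = closed[of u1 u2 u5, unfolded w k]
    note q134 = closed[of u1 u3 u4, unfolded w k]
    have z: "w46 = 0" "w56 = 0"
      using q126 q136 by (simp_all add: form6_simps)
    have r2: "w16 * c24 = w26 * c14"
      and r3: "w16 * k * c24 = w26 * c15 + w45" and r4: "w16 * k * c24 = w36 * c14 - w45"
      using q124 q125 q134 z by (simp_all add: form6_simps algebra_simps)
    have w36: "w36 = k * w26"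
      using q234 z c24 by (auto simp: form6_simps algebra_simps)
    then have "w26 * (c15 - k * c14) = 0"
      using r2 r3 r4 by algebra
    then have "w26 = 0"
      using c15 by simp
    then have "w16 = 0 \<and> w26 = 0 \<and> w36 = 0 \<and> w46 = 0 \<and> w56 = 0"
      using r2 c24 w36 z by simp
    then show False
      using form6_last_coefficients[OF nondeg[unfolded w]] by blast
  qed
  define a b where "a = c14 / c24" and "b = c23 / c24"
  then have B: "c25 = k * c24" "c35 = k * k * c24" "c15 = k * a * c24" "c14 = a * c24" "c23 = b * c24"
    using c24 k c15 by simp_all
  have "lie_isomorphic ?B L6_6"
    unfolding B L6_6_def
    by (rule coordinate_isomorphism[of
        "\<lambda>x. x$1" "\<lambda>x. x$2 + k * x$3 + a * x$1" "\<lambda>x. x$3"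
        "\<lambda>x. x$4 + k * x$5 + b * x$3" "\<lambda>x. x$5"
        "\<lambda>x. (x$6 - c12 * x$4 - c13 * x$5) / c24 + a * b * x$5"])
      (use c24 in \<open>auto intro!: linear_coordinate_intros simp: form_simps field_simps\<close>)
  then show ?thesis
    by (rule listedI) (simp add: symplectic_nilpotent_6_def)
qed

text \<open>A nondegenerate quadratic form would put the last basis vector into the radical of every
  closed form.\<close>

lemma completion_L52:
  assumes lie: "lie_algebra (lie6 0 (\<alpha> 1 2) (\<alpha> 1 3) (two_form c12 c13 c14 c15 c23 c24 c25 c34 c35 c45))"
    and symp: "admits_symplectic
      (lie6 0 (\<alpha> 1 2) (\<alpha> 1 3) (two_form c12 c13 c14 c15 c23 c24 c25 c34 c35 c45))"
  shows "listed (lie6 0 (\<alpha> 1 2) (\<alpha> 1 3) (two_form c12 c13 c14 c15 c23 c24 c25 c34 c35 c45))"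
    (is "listed ?B")
proof -
  note jac = jacobi_component[OF lie, where i = 6]
  have c34: "c34 = c25"
    using jac[of u1 u2 u3] by (simp add: form_simps)
  have c45: "c45 = 0"
    using jac[of u1 u2 u5] by (simp add: form_simps)
  note B = c34 c45
  have det: "c24 * c35 = c25 * c25"
  proof (rule ccontr)
    assume det: "c24 * c35 \<noteq> c25 * c25"
    obtain w12 w13 w14 w15 w16 w23 w24 w25 w26 w34 w35 w36 w45 w46 w56 \<omega>
      where w: "\<omega> = form6 w12 w13 w14 w15 w16 w23 w24 w25 w26 w34 w35 w36 w45 w46 w56"
      and closed: "\<And>x y z. \<omega> (?B x y) z + \<omega> (?B y z) x + \<omega> (?B z x) y = 0"
      and nondeg: "\<And>x. \<forall>y. \<omega> x y = 0 \<Longrightarrow> x = 0"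
      by (rule admits_symplecticE[OF symp]) (rule that)
    note q126 = closed[of u1 u2 u6, unfolded w B]
    note q136 = closed[of u1 u3 u6, unfolded w B]
    note q234 = closed[of u2 u3 u4, unfolded w B]
    note q235 = closed[of u2 u3 u5, unfolded w B]
    note q124 = closed[of u1 u2 u4, unfolded w B]
    note q125 = closed[of u1 u2 u5, unfolded w B]
    note q134 = closed[of u1 u3 u4, unfolded w B]
    note q135 = closed[of u1 u3 u5, unfolded w B]
    have z: "w46 = 0" "w56 = 0"
      using q126 q136 by (simp_all add: form6_simps)
    have r: "w26 * c25 = w36 * c24" "w26 * c35 = w36 * c25"
      using q234 q235 z by (simp_all add: form6_simps algebra_simps)
    have "(c24 * c35 - c25 * c25) * w26 = 0" "(c24 * c35 - c25 * c25) * w36 = 0"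
      using r by algebra+
    then have z': "w26 = 0" "w36 = 0"
      using det by simp_all
    have "w16 * c24 = 0" "w16 * c35 = 0" "w16 * c25 = w45" "w16 * c25 = - w45"
      using q124 q125 q134 q135 z z' by (simp_all add: form6_simps algebra_simps)
    then have "w16 = 0"
      using det by auto
    then show False
      using z z' form6_last_coefficients[OF nondeg[unfolded w]] by blast
  qed
  show ?thesis
  proof (cases "c24 = 0")
    case c24: False
    show ?thesis
      using completion_L52_rank_one[OF lie[unfolded B] symp[unfolded B] det c24] by (simp add: B)
  next
    case c24: True
    then have c25: "c25 = 0"
      using det by simp
    show ?thesis
    proof (cases "c35 = 0")
      case c35: False
      have iso: "lie_isomorphic ?B (lie6 0 (\<alpha> 1 2) (\<alpha> 1 3) (two_form c13 c12 c15 c14 (- c23) c35 0 0 0 0))"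
        by (rule coordinate_isomorphism[of
            "\<lambda>x. x$1" "\<lambda>x. x$3" "\<lambda>x. x$2" "\<lambda>x. x$5" "\<lambda>x. x$4" "\<lambda>x. x$6"])
          (use B c24 c25 in \<open>auto intro!: linear_coordinate_intros simp: form_simps algebra_simps\<close>)
      show ?thesis
        using completion_L52_rank_one[OF lie_algebra_transfer[OF lie iso]
            admits_symplectic_transfer[OF symp iso] _ c35] by (intro listed_trans[OF iso]) simp
    next
      case c35: True
      note B = B c24 c25 c35
      show ?thesis
      proof (cases "c14 = 0")
        case c14: False
        define k where "k = c15 / c14"
        then have k: "c15 = k * c14"
          using c14 by simp
        show ?thesis
        proof (cases "c23 = 0")
          case c23: True
          note B = B k c23
          have "lie_isomorphic ?B L6_5"
            unfolding B L6_5_def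
            by (rule coordinate_isomorphism[of
                "\<lambda>x. x$1" "\<lambda>x. x$2 + k * x$3" "\<lambda>x. x$3"
                "\<lambda>x. x$4 + k * x$5" "\<lambda>x. x$5"
                "\<lambda>x. (x$6 - c12 * x$4 - c13 * x$5) / c14"])
              (use c14 in \<open>auto intro!: linear_coordinate_intros simp: form_simps field_simps\<close>)
          then show ?thesis
            by (rule listedI) (simp add: symplectic_nilpotent_6_def)
        next
          case c23: False
          define b where "b = c23 / c14"
          then have b: "c23 = b * c14" "b \<noteq> 0"
            using c14 c23 by simp_all
          note B = B k b(1)
          have "lie_isomorphic ?B L6_9"
            unfolding B L6_9_def
            by (rule coordinate_isomorphism[of
                "\<lambda>x. x$1" "\<lambda>x. x$2 + k * x$3" "\<lambda>x. b * x$3"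
                "\<lambda>x. x$4 + k * x$5" "\<lambda>x. b * x$5"
                "\<lambda>x. (x$6 - c12 * x$4 - c13 * x$5) / c14"])
              (use c14 b(2) in \<open>auto intro!: linear_coordinate_intros simp: form_simps field_simps\<close>)
          then show ?thesis
            by (rule listedI) (simp add: symplectic_nilpotent_6_def)
        qed
      next
        case c14: True
        note B = B c14
        show ?thesis
        proof (cases "c15 = 0")
          case c15: False
          show ?thesis
          proof (cases "c23 = 0")
            case c23: True
            note B = B c23
            have "lie_isomorphic ?B L6_5"
              unfolding B L6_5_def
              by (rule coordinate_isomorphism[of
                  "\<lambda>x. x$1" "\<lambda>x. x$3" "\<lambda>x. x$2" "\<lambda>x. x$5"
                  "\<lambda>x. x$4" "\<lambda>x. (x$6 - c12 * x$4 - c13 * x$5) / c15"])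
                (use c15 in \<open>auto intro!: linear_coordinate_intros simp: form_simps field_simps\<close>)
            then show ?thesis
              by (rule listedI) (simp add: symplectic_nilpotent_6_def)
          next
            case c23: False
            define b where "b = - c23 / c15"
            then have b: "c23 = - b * c15" "b \<noteq> 0"
              using c15 c23 by simp_all
            note B = B b(1)
            have "lie_isomorphic ?B L6_9"
              unfolding B L6_9_def
              by (rule coordinate_isomorphism[of
                  "\<lambda>x. x$1" "\<lambda>x. x$3" "\<lambda>x. b * x$2" "\<lambda>x. x$5"
                  "\<lambda>x. b * x$4" "\<lambda>x. (x$6 - c12 * x$4 - c13 * x$5) / c15"])
                (use c15 b(2) in \<open>auto intro!: linear_coordinate_intros simp: form_simps field_simps\<close>)
            then show ?thesis
              by (rule listedI) (simp add: symplectic_nilpotent_6_def)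
          qed
        next
          case c15: True
          note B = B c15
          show ?thesis
          proof (cases "c23 = 0")
            case c23: False
            have "lie_isomorphic ?B L6_4"
              unfolding B L6_4_def
              by (rule coordinate_isomorphism[of
                  "\<lambda>x. x$1" "\<lambda>x. x$2" "\<lambda>x. x$3" "\<lambda>x. x$4"
                  "\<lambda>x. x$5" "\<lambda>x. (x$6 - c12 * x$4 - c13 * x$5) / c23"])
                (use c23 in \<open>auto intro!: linear_coordinate_intros simp: form_simps field_simps\<close>)
            then show ?thesis
              by (rule listedI) (simp add: symplectic_nilpotent_6_def)
          next
            case c23: True
            note B = B c23
            have "lie_isomorphic ?B L5_2_S_A1"
              unfolding B L5_2_S_A1_def
              by (rule coordinate_isomorphism[of
                  "\<lambda>x. x$1" "\<lambda>x. x$2" "\<lambda>x. x$3"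
                  "\<lambda>x. x$6 - c12 * x$4 - c13 * x$5" "\<lambda>x. x$4" "\<lambda>x. x$5"])
                (auto intro!: linear_coordinate_intros simp: form_simps algebra_simps)
            then show ?thesis
              by (rule listedI) (simp add: symplectic_nilpotent_6_def)
          qed
        qed
      qed
    qed
  qed
qed

section \<open>The classification in dimensions two, four and six\<close>

context flagged_lie_algebra
begin

lemma reduction_to_completions:
  assumes n: "n = 6" and nil: "nilpotent_lie_algebra br" and symp: "admits_symplectic br"
  shows "\<exists>L\<in>symplectic_nilpotent_6. lie_isomorphic br L"
proof -
  have conclude: ?thesis if iso: "lie_isomorphic br B"
    and comp: "lie_algebra B \<Longrightarrow> admits_symplectic B \<Longrightarrow> listed B" for B
  proof -
    have "lie_algebra br"
      by unfold_locales
    then have "listed B"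
      using comp lie_algebra_transfer admits_symplectic_transfer iso symp by blast
    then show ?thesis
      using iso lie_isomorphic_trans unfolding listed_def by blast
  qed
  note coordinates = coordinates_of_flag[OF n]
  obtain f where fl: "flag br n f"
    using nilpotent_has_flag[OF nil dim] n by auto
  obtain f where fl: "flag br n f"
    and st: "structure4 br f 0 0 \<or> structure4 br f 0 (\<beta> 1 2) \<or> structure4 br f (\<beta> 1 2) (\<beta> 1 3)"
    using first_four_differentials[OF fl] n by auto
  have n5: "5 \<le> n"
    using n by simp
  consider (A5) f where "flag br n f" "structure5 br f 0 0 0"
    | (L3_A2) f where "flag br n f" "structure5 br f 0 0 (\<beta> 1 2)"
    | (L51) f where "flag br n f" "structure5 br f 0 0 (\<beta> 1 2 + \<beta> 3 4)"
    | (L52) f where "flag br n f" "structure5 br f 0 (\<beta> 1 2) (\<beta> 1 3)"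
    | (L4_A1) f where "flag br n f" "structure5 br f 0 (\<beta> 1 2) (\<beta> 1 4)"
    | (L53) f where "flag br n f" "structure5 br f 0 (\<beta> 1 2) (\<beta> 1 4 + \<beta> 2 3)"
    | (L55) f where "flag br n f" "structure5 br f (\<beta> 1 2) (\<beta> 1 3) (\<beta> 2 3)"
    | (L54) f where "flag br n f" "structure5 br f (\<beta> 1 2) (\<beta> 1 3) (\<beta> 1 4)"
    | (L56) f where "flag br n f" "structure5 br f (\<beta> 1 2) (\<beta> 1 3) (\<beta> 1 4 + \<beta> 2 3)"
    using st fifth_differential_A4[OF fl n5] fifth_differential_L3_A1[OF fl n5]
      fifth_differential_L4[OF fl n5] by meson
  then show ?thesis
  proof cases
    case A5
    have lin6: "linear (f 6)"
      using flag_linear(1)[OF A5(1)] n by simp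
    have cl: "f 1 (br x y) = 0" "f 2 (br x y) = 0" "f 3 (br x y) = 0" "f 4 (br x y) = 0"
        "f 5 (br x y) = 0" for x y
      using A5(2) by (simp_all add: structure5_def structure4_def)
    show ?thesis
    proof (cases "\<forall>x y. f 6 (br x y) = 0")
      case True
      have "lie_isomorphic br A6"
        unfolding A6_def
        by (rule flag_to_coordinates[OF n A5 refl]) (use True in simp_all)
      then show ?thesis
        by (intro bexI[of _ A6]) (auto simp: symplectic_nilpotent_6_def)
    next
      case False
      then obtain x0 y0 where nz: "- f 6 (br x0 y0) \<noteq> 0"
        by auto
      have 5: "5 \<in> {3, 4, 5 :: nat}" "5 \<le> n"
        using n by auto
      have clK: "f i (br x y) = 0" if "i \<in> {1..5}" for i x y
        using that cl by (auto simp: intervals_numeral)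
      have van: "- f 6 (br x y) = 0" if "\<forall>i\<in>{1..5}. f i y = 0" for x y
      proof -
        have "6 \<in> {1..n}" "\<forall>i\<in>{1..<6}. f i y = 0"
          using that n by (simp_all add: intervals_numeral)
        then show ?thesis
          using A5(1) unfolding flag_def by (metis neg_equal_0_iff_equal)
      qed
      obtain g a b c where g: "flag br n g" "\<And>i x y. i \<in> {1..5} \<Longrightarrow> g i (br x y) = 0"
          "\<And>i. i > 5 \<Longrightarrow> g i = f i"
        and eq: "\<And>x y. - f 6 (br x y) = wedge (g 1) (g 2) x y
          + (if (5::nat) = 3 then 0 else a * wedge (g 3) (g 4) x y)
          + (if (5::nat) = 5 then b * wedge (g 3) (g 5) x y + c * wedge (g 4) (g 5) x y else 0)"
        using split_off_plane_expansion[OF A5(1) 5 clK differential_form[OF lin6] van nz] by blast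
      have st: "structure5 br g 0 0 0"
        using g(2) by (simp add: structure5_def structure4_def intervals_numeral)
      have "g 6 (br x y) = - (wedge (g 1) (g 2) x y + a * wedge (g 3) (g 4) x y
          + (b * wedge (g 3) (g 5) x y + c * wedge (g 4) (g 5) x y))" for x y
        using eq[of x y] g(3)[of 6] by simp
      then have "lie_isomorphic br (lie6 0 0 0 (two_form 1 0 0 0 0 0 0 a b c))"
        by (intro flag_to_coordinates[OF n g(1) st refl]) (simp_all add: form_simps wedge_def mult.commute)
      then show ?thesis
        by (rule conclude) (rule completion_A5)
    qed
  next
    case L3_A2
    have "\<exists>c12 c13 c14 c15 c23 c24 c25 c34 c35 c45. lie_isomorphic br
        (lie6 0 0 (\<alpha> 1 2) (two_form c12 c13 c14 c15 c23 c24 c25 c34 c35 c45))"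
      by (rule coordinates[OF L3_A2]) (simp_all add: \<alpha>_def \<beta>_def)
    then show ?thesis
      using conclude completion_L3_A2 by blast
  next
    case L51
    have "\<exists>c12 c13 c14 c15 c23 c24 c25 c34 c35 c45. lie_isomorphic br
        (lie6 0 0 (\<alpha> 1 2 + \<alpha> 3 4) (two_form c12 c13 c14 c15 c23 c24 c25 c34 c35 c45))"
      by (rule coordinates[OF L51]) (simp_all add: \<alpha>_def \<beta>_def)
    then show ?thesis
      using conclude completion_L51 by blast
  next
    case L52
    have "\<exists>c12 c13 c14 c15 c23 c24 c25 c34 c35 c45. lie_isomorphic br
        (lie6 0 (\<alpha> 1 2) (\<alpha> 1 3) (two_form c12 c13 c14 c15 c23 c24 c25 c34 c35 c45))"
      by (rule coordinates[OF L52]) (simp_all add: \<alpha>_def \<beta>_def)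
    then show ?thesis
      using conclude completion_L52 by blast
  next
    case L4_A1
    have "\<exists>c12 c13 c14 c15 c23 c24 c25 c34 c35 c45. lie_isomorphic br
        (lie6 0 (\<alpha> 1 2) (\<alpha> 1 4) (two_form c12 c13 c14 c15 c23 c24 c25 c34 c35 c45))"
      by (rule coordinates[OF L4_A1]) (simp_all add: \<alpha>_def \<beta>_def)
    then show ?thesis
      using conclude completion_L4_A1 by blast
  next
    case L53
    have "\<exists>c12 c13 c14 c15 c23 c24 c25 c34 c35 c45. lie_isomorphic br
        (lie6 0 (\<alpha> 1 2) (\<alpha> 1 4 + \<alpha> 2 3) (two_form c12 c13 c14 c15 c23 c24 c25 c34 c35 c45))"
      by (rule coordinates[OF L53]) (simp_all add: \<alpha>_def \<beta>_def)
    then show ?thesis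
      using conclude completion_L53 by blast
  next
    case L55
    have "\<exists>c12 c13 c14 c15 c23 c24 c25 c34 c35 c45. lie_isomorphic br
        (lie6 (\<alpha> 1 2) (\<alpha> 1 3) (\<alpha> 2 3) (two_form c12 c13 c14 c15 c23 c24 c25 c34 c35 c45))"
      by (rule coordinates[OF L55]) (simp_all add: \<alpha>_def \<beta>_def)
    then show ?thesis
      using conclude completion_L55 by blast
  next
    case L54
    have "\<exists>c12 c13 c14 c15 c23 c24 c25 c34 c35 c45. lie_isomorphic br
        (lie6 (\<alpha> 1 2) (\<alpha> 1 3) (\<alpha> 1 4) (two_form c12 c13 c14 c15 c23 c24 c25 c34 c35 c45))"
      by (rule coordinates[OF L54]) (simp_all add: \<alpha>_def \<beta>_def)
    then show ?thesis
      using conclude completion_L54 by blast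
  next
    case L56
    have "\<exists>c12 c13 c14 c15 c23 c24 c25 c34 c35 c45. lie_isomorphic br
        (lie6 (\<alpha> 1 2) (\<alpha> 1 3) (\<alpha> 1 4 + \<alpha> 2 3) (two_form c12 c13 c14 c15 c23 c24 c25 c34 c35 c45))"
      by (rule coordinates[OF L56]) (simp_all add: \<alpha>_def \<beta>_def)
    then show ?thesis
      using conclude completion_L56 by blast
  qed
qed

end

lemma classification_dim_6:
  fixes br :: "'a::real_vector \<Rightarrow> 'a \<Rightarrow> 'a"
  assumes "nilpotent_lie_algebra br" "dim (UNIV :: 'a set) = 6" "admits_symplectic br"
  shows "\<exists>L\<in>symplectic_nilpotent_6. lie_isomorphic br L"
proof -
  interpret flagged_lie_algebra br 6
    using assms by (intro flagged_lie_algebra.intro flagged_lie_algebra_axioms.intro)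
      (simp_all add: nilpotent_lie_algebra_def)
  show ?thesis
    by (rule reduction_to_completions) (use assms in simp_all)
qed

definition vec4 :: "real \<Rightarrow> real \<Rightarrow> real \<Rightarrow> real \<Rightarrow> real^4" where
  "vec4 a b c d = (\<chi> i. if i = 1 then a else if i = 2 then b else if i = 3 then c else d)"

lemma vec4_nth [simp]:
  "vec4 a b c d $ 1 = a" "vec4 a b c d $ 2 = b" "vec4 a b c d $ 3 = c" "vec4 a b c d $ 4 = d"
  by (simp_all add: vec4_def)

lemma vec4_eq_iff: "x = y \<longleftrightarrow> x$1 = y$1 \<and> x$2 = y$2 \<and> x$3 = y$3 \<and> x$4 = y$4" for x y :: "real^4"
  by (simp add: vec_eq_iff forall_4)

lemma lie4_nth [simp]:
  "lie4 d3 d4 x y $ 1 = 0" "lie4 d3 d4 x y $ 2 = 0"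
  "lie4 d3 d4 x y $ 3 = - d3 x y" "lie4 d3 d4 x y $ 4 = - d4 x y"
  by (simp_all add: lie4_def bracket_of_def)

context flagged_lie_algebra
begin

lemma flag_to_coordinates_4:
  assumes n: "n = 4" and fl: "flag br n f" and st: "structure4 br f d3 d4"
    and D: "\<And>x y. d3 x y = D3 (vec4 (x 1) (x 2) (x 3) (x 4)) (vec4 (y 1) (y 2) (y 3) (y 4))"
      "\<And>x y. d4 x y = D4 (vec4 (x 1) (x 2) (x 3) (x 4)) (vec4 (y 1) (y 2) (y 3) (y 4))"
  shows "lie_isomorphic br (lie4 D3 D4)"
proof -
  define V where "V x = vec4 (f 1 x) (f 2 x) (f 3 x) (f 4 x)" for x
  have "linear V"
    using flag_linear(2,3)[OF fl] n by (intro linearI) (simp_all add: V_def vec4_eq_iff)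
  moreover have "bij V"
  proof (rule linear_injective_imp_bij)
    show "x = 0" if "V x = 0" for x
    proof -
      have "\<forall>i\<in>{1..n}. f i x = 0"
        using that n by (simp add: V_def vec4_eq_iff intervals_numeral)
      then show ?thesis
        using fl unfolding flag_def by blast
    qed
  qed (use dim n \<open>linear V\<close> in simp_all)
  moreover have "V (br x y) = lie4 D3 D4 (V x) (V y)" for x y
    using st by (simp add: vec4_eq_iff structure4_def D) (simp add: V_def)
  ultimately show ?thesis
    unfolding lie_isomorphic_def by blast
qed

end

lemma classification_dim_4:
  fixes br :: "'a::real_vector \<Rightarrow> 'a \<Rightarrow> 'a"
  assumes nil: "nilpotent_lie_algebra br" and dim: "dim (UNIV :: 'a set) = 4"
  shows "\<exists>L\<in>nilpotent_4. lie_isomorphic br L"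
proof -
  interpret flagged_lie_algebra br 4
    using assms by (intro flagged_lie_algebra.intro flagged_lie_algebra_axioms.intro)
      (simp_all add: nilpotent_lie_algebra_def)
  obtain f where "flag br 4 f"
    using nilpotent_has_flag[OF nil dim] by auto
  then obtain f where fl: "flag br 4 f"
    and st: "structure4 br f 0 0 \<or> structure4 br f 0 (\<beta> 1 2) \<or> structure4 br f (\<beta> 1 2) (\<beta> 1 3)"
    using first_four_differentials[of f] by auto
  note coordinates = flag_to_coordinates_4[OF refl fl]
  from st have "lie_isomorphic br A4 \<or> lie_isomorphic br L3_S_A1 \<or> lie_isomorphic br L4"
  proof (elim disjE)
    assume "structure4 br f 0 0"
    then have "lie_isomorphic br A4"
      unfolding A4_def by (rule coordinates) simp_all
    then show ?thesis ..
  next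
    assume "structure4 br f 0 (\<beta> 1 2)"
    then have "lie_isomorphic br L3_S_A1"
      unfolding L3_S_A1_def by (rule coordinates) (simp_all add: \<alpha>_def \<beta>_def)
    then show ?thesis by blast
  next
    assume "structure4 br f (\<beta> 1 2) (\<beta> 1 3)"
    then have "lie_isomorphic br L4"
      unfolding L4_def by (rule coordinates) (simp_all add: \<alpha>_def \<beta>_def)
    then show ?thesis by blast
  qed
  then show ?thesis
    by (auto simp: nilpotent_4_def)
qed

lemma classification_dim_2:
  fixes br :: "'a::real_vector \<Rightarrow> 'a \<Rightarrow> 'a"
  assumes nil: "nilpotent_lie_algebra br" and dim: "dim (UNIV :: 'a set) = 2"
  shows "lie_isomorphic br A2"
proof -
  interpret flagged_lie_algebra br 2
    using assms by (intro flagged_lie_algebra.intro flagged_lie_algebra_axioms.intro)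
      (simp_all add: nilpotent_lie_algebra_def)
  obtain f where fl: "flag br 2 f"
    using nilpotent_has_flag[OF nil dim] by auto
  define V :: "'a \<Rightarrow> real^2" where "V x = (\<chi> i. if i = 1 then f 1 x else f 2 x)" for x
  have V: "V x $ 1 = f 1 x" "V x $ 2 = f 2 x" for x
    by (simp_all add: V_def)
  have "linear V"
    using flag_linear(2,3)[OF fl] by (intro linearI) (simp_all add: V vec_eq_iff forall_2)
  moreover have "bij V"
  proof (rule linear_injective_imp_bij)
    show "x = 0" if "V x = 0" for x
    proof -
      have "\<forall>i\<in>{1..2}. f i x = 0"
        using that by (simp add: V vec_eq_iff forall_2 intervals_numeral)
      then show ?thesis
        using fl unfolding flag_def by blast
    qed
  qed (use dim \<open>linear V\<close> in simp_all)
  moreover have "V (br x y) = A2 (V x) (V y)" for x y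
    using differential_expansions(1,2)[OF fl]
    by (simp add: vec_eq_iff forall_2 V A2_def bracket_of_def)
  ultimately show ?thesis
    unfolding lie_isomorphic_def by blast
qed

section \<open>Isomorphism invariants\<close>

definition coordinate_subspace :: "'n::finite set \<Rightarrow> (real^'n) set" where
  "coordinate_subspace I = {x. \<forall>i. i \<notin> I \<longrightarrow> x $ i = 0}"

lemma coordinate_subspace_eq_span:
  fixes I :: "'n::finite set"
  shows "coordinate_subspace I = span ((\<lambda>i. axis i 1) ` I)" (is "?S = span ?A")
proof
  show "span ?A \<subseteq> ?S"
    by (rule span_minimal) (auto simp: coordinate_subspace_def subspace_def axis_def)
  show "?S \<subseteq> span ?A"
  proof
    fix x :: "real^'n" assume x: "x \<in> ?S"
    have "x = (\<Sum>i\<in>UNIV. x $ i *\<^sub>R axis i 1)"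
      using basis_expansion[of x] by (simp add: scalar_mult_eq_scaleR)
    also have "\<dots> \<in> span ?A"
    proof (rule span_sum)
      fix i
      show "x $ i *\<^sub>R axis i 1 \<in> span ?A"
      proof (cases "i \<in> I")
        case True
        then show ?thesis
          by (intro span_scale span_base imageI)
      next
        case False
        then show ?thesis
          using x by (simp add: coordinate_subspace_def span_zero)
      qed
    qed
    finally show "x \<in> span ?A" .
  qed
qed

lemma subspace_coordinate_subspace: "subspace (coordinate_subspace I)"
  by (simp add: coordinate_subspace_eq_span subspace_span)

lemma dim_coordinate_subspace:
  fixes I :: "'n::finite set"
  shows "dim (coordinate_subspace I) = card I"
proof -
  have "independent ((\<lambda>i::'n. axis i (1::real)) ` I)"
    by (rule independent_mono[OF independent_Basis]) (auto simp: Basis_vec_def)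
  moreover have "card ((\<lambda>i::'n. axis i (1::real)) ` I) = card I"
    by (rule card_image) (auto simp: inj_on_def axis_eq_axis)
  ultimately show ?thesis
    by (simp add: coordinate_subspace_eq_span dim_eq_card_independent)
qed

definition derived_algebra :: "('a::real_vector \<Rightarrow> 'a \<Rightarrow> 'a) \<Rightarrow> 'a set" where
  "derived_algebra br = span {br x y |x y. True}"

definition center :: "('a::real_vector \<Rightarrow> 'a \<Rightarrow> 'a) \<Rightarrow> 'a set" where
  "center br = {x. \<forall>y. br x y = 0}"

definition second_center :: "('a::real_vector \<Rightarrow> 'a \<Rightarrow> 'a) \<Rightarrow> 'a set" where
  "second_center br = {x. \<forall>y. br x y \<in> center br}"

definition derived_centralizer :: "('a::real_vector \<Rightarrow> 'a \<Rightarrow> 'a) \<Rightarrow> 'a set" where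
  "derived_centralizer br = {x. \<forall>y\<in>derived_algebra br. br x y = 0}"

text \<open>Among the listed algebras, the four dimensions coincide within five groups only; these are
  the subject of the tags below.\<close>

definition profile :: "('a::real_vector \<Rightarrow> 'a \<Rightarrow> 'a) \<Rightarrow> nat list" where
  "profile br = map dim [derived_algebra br, center br, second_center br, derived_centralizer br]"

locale lie_isomorphism =
  fixes b :: "'a::real_vector \<Rightarrow> 'a \<Rightarrow> 'a" and b' :: "'b::real_vector \<Rightarrow> 'b \<Rightarrow> 'b" and \<phi> :: "'a \<Rightarrow> 'b"
  assumes lin: "linear \<phi>" and bij: "bij \<phi>" and hom: "\<phi> (b x y) = b' (\<phi> x) (\<phi> y)"
begin

lemma inj: "\<phi> x = \<phi> y \<longleftrightarrow> x = y"
  using bij by (simp add: bij_def inj_eq)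

lemma zero: "b' (\<phi> x) (\<phi> y) = 0 \<longleftrightarrow> b x y = 0"
  using inj[of "b x y" 0] lin by (simp add: hom linear_0)

lemma surj: obtains x where "u = \<phi> x"
  using bij unfolding bij_def by (meson surjD)

lemma all: "(\<forall>u. P u) \<longleftrightarrow> (\<forall>x. P (\<phi> x))"
  by (metis surj)

lemma derived: "derived_algebra b' = \<phi> ` derived_algebra b"
proof -
  have "{b' x y |x y. True} = \<phi> ` {b x y |x y. True}"
  proof
    show "{b' x y |x y. True} \<subseteq> \<phi> ` {b x y |x y. True}"
    proof
      fix z assume "z \<in> {b' x y |x y. True}"
      then obtain u v where z: "z = b' u v"
        by auto
      obtain x where "u = \<phi> x"
        by (rule surj)
      moreover obtain y where "v = \<phi> y"
        by (rule surj)
      ultimately show "z \<in> \<phi> ` {b x y |x y. True}"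
        using z by (auto simp: hom[symmetric])
    qed
    show "\<phi> ` {b x y |x y. True} \<subseteq> {b' x y |x y. True}"
      using hom by auto
  qed
  then show ?thesis
    using lin by (simp add: derived_algebra_def linear_span_image)
qed

lemma center_iff: "\<phi> x \<in> center b' \<longleftrightarrow> x \<in> center b"
  using all[of "\<lambda>u. b' (\<phi> x) u = 0"] by (simp add: center_def zero)

lemma derived_iff: "\<phi> x \<in> derived_algebra b' \<longleftrightarrow> x \<in> derived_algebra b"
  by (auto simp: derived inj)

lemma second_center_iff: "\<phi> x \<in> second_center b' \<longleftrightarrow> x \<in> second_center b"
  using all[of "\<lambda>u. b' (\<phi> x) u \<in> center b'"] by (simp add: second_center_def hom[symmetric] center_iff)

lemma derived_centralizer_iff: "\<phi> x \<in> derived_centralizer b' \<longleftrightarrow> x \<in> derived_centralizer b"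
  by (simp add: derived_centralizer_def derived zero)

lemma image_eq:
  assumes "\<And>x. \<phi> x \<in> A' \<longleftrightarrow> x \<in> A"
  shows "A' = \<phi> ` A"
proof
  show "A' \<subseteq> \<phi> ` A"
  proof
    fix u assume "u \<in> A'"
    moreover obtain x where "u = \<phi> x"
      by (rule surj)
    ultimately show "u \<in> \<phi> ` A"
      using assms by blast
  qed
qed (use assms in blast)

lemma profile_eq: "profile b' = profile b"
proof -
  have "dim A' = dim A" if "\<And>x. \<phi> x \<in> A' \<longleftrightarrow> x \<in> A" for A' A
    using dim_linear_bij_image[OF lin, of A] bij image_eq[OF that] by (simp add: bij_def)
  then show ?thesis
    using derived_iff center_iff second_center_iff derived_centralizer_iff by (simp add: profile_def)
qed

end

context lie_isomorphism
begin

text \<open>The graph of the isomorphism as a relation between the two algebras, through which the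
  transfer package carries over properties formulated with the bracket.\<close>

definition R :: "'a \<Rightarrow> 'b \<Rightarrow> bool" where
  "R x u \<longleftrightarrow> u = \<phi> x"

lemma R_bi_total [transfer_rule]: "bi_total R"
  unfolding bi_total_def R_def by (metis surj)

lemma R_bi_unique [transfer_rule]: "bi_unique R"
  unfolding bi_unique_def R_def by (simp add: inj)

lemma R_bracket [transfer_rule]: "rel_fun R (rel_fun R R) b b'"
  by (simp add: rel_fun_def R_def hom)

lemma R_zero [transfer_rule]: "R 0 0"
  using lin by (simp add: R_def linear_0)

lemma R_scaleR [transfer_rule]: "rel_fun (=) (rel_fun R R) (*\<^sub>R) (*\<^sub>R)"
  using lin by (simp add: rel_fun_def R_def linear_scale)

lemma R_image:
  assumes "\<And>x. \<phi> x \<in> A' \<longleftrightarrow> x \<in> A"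
  shows "rel_set R A A'"
  unfolding image_eq[OF assms] by (auto simp: rel_set_def R_def)

lemmas R_center [transfer_rule] = R_image[OF center_iff]
lemmas R_derived_centralizer [transfer_rule] = R_image[OF derived_centralizer_iff]

end

definition ad_rank_one :: "('a::real_vector \<Rightarrow> 'a \<Rightarrow> 'a) \<Rightarrow> 'a \<Rightarrow> 'a \<Rightarrow> bool" where
  "ad_rank_one b x y \<longleftrightarrow> b x y \<noteq> 0 \<and> (\<forall>z. \<exists>c. b x z = c *\<^sub>R b x y)"

definition annihilates :: "('a::real_vector \<Rightarrow> 'a \<Rightarrow> 'a) \<Rightarrow> 'a \<Rightarrow> 'a \<Rightarrow> bool" where
  "annihilates b x z \<longleftrightarrow>
     x \<notin> derived_centralizer b \<and> z \<in> derived_centralizer b \<and> z \<notin> center b \<and> b x z = 0"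

text \<open>For \<open>L3_S_L3\<close>, \<open>L6_1\<close>, \<open>L6_2\<close>: in the first algebra two elements of rank one do not
  commute, in the second all of them commute, and in the third, whose bracket is complex bilinear,
  there are none.\<close>

definition two_step_tag :: "('a::real_vector \<Rightarrow> 'a \<Rightarrow> 'a) \<Rightarrow> nat" where
  "two_step_tag b = (if \<exists>x y. ad_rank_one b x y \<and> ad_rank_one b y x then 2
     else if \<exists>x y. ad_rank_one b x y then 1 else 0)"

text \<open>For \<open>L6_5\<close>, \<open>L6_9\<close>, \<open>L6_6\<close>: the centralizer of the derived algebra is abelian, has its
  brackets in the third term of the lower central series, or neither.\<close>

definition centralizer_tag :: "('a::real_vector \<Rightarrow> 'a \<Rightarrow> 'a) \<Rightarrow> nat" where
  "centralizer_tag b = (if \<forall>x\<in>derived_centralizer b. \<forall>y\<in>derived_centralizer b. b x y = 0 then 2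
     else if \<forall>x\<in>derived_centralizer b. \<forall>y\<in>derived_centralizer b. \<exists>u v w. b x y = b u (b v w) then 1 else 0)"

text \<open>For \<open>L6_10\<close>, \<open>L6_11\<close>, \<open>L6_12\<close>, which come from a pencil with two, one or no real roots:
  the number of roots is the number of directions \<open>x\<close> that annihilate a noncentral element of the
  centralizer of the derived algebra.\<close>

definition annihilator_tag :: "('a::real_vector \<Rightarrow> 'a \<Rightarrow> 'a) \<Rightarrow> nat" where
  "annihilator_tag b =
     (if \<exists>x z x' z'. annihilates b x z \<and> annihilates b x' z' \<and> b x z' \<noteq> 0 then 2
     else if \<exists>x z. annihilates b x z then 1 else 0)"

text \<open>For \<open>L6_17_minus\<close> and \<open>L6_17_plus\<close>: the map \<open>(ad x)\<^sup>2\<close> on the derived algebra is governed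
  by \<open>(x$1)\<^sup>2 - (x$2)\<^sup>2\<close> and \<open>(x$1)\<^sup>2 + (x$2)\<^sup>2\<close>, and only the first form has nontrivial zeros.\<close>

definition square_tag :: "('a::real_vector \<Rightarrow> 'a \<Rightarrow> 'a) \<Rightarrow> nat" where
  "square_tag b = (if \<exists>x. x \<notin> derived_centralizer b \<and> (\<forall>y z. b x (b x (b y z)) = 0) then 1 else 0)"

text \<open>For \<open>L6_19\<close> and \<open>L6_21\<close>: whether some \<open>x\<close> outside the centralizer of the derived algebra
  acts trivially on the third term of the lower central series.\<close>

definition cube_tag :: "('a::real_vector \<Rightarrow> 'a \<Rightarrow> 'a) \<Rightarrow> nat" where
  "cube_tag b = (if \<exists>x. x \<notin> derived_centralizer b \<and> (\<forall>y z w. b x (b y (b z w)) = 0) then 1 else 0)"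

definition tag :: "('a::real_vector \<Rightarrow> 'a \<Rightarrow> 'a) \<Rightarrow> nat" where
  "tag b = (if profile b = [2, 2, 6, 6] then two_step_tag b
     else if profile b = [3, 2, 4, 5] then centralizer_tag b
     else if profile b = [3, 2, 4, 4] then annihilator_tag b
     else if profile b = [4, 1, 3, 4] then square_tag b
     else if profile b = [4, 1, 2, 4] then cube_tag b else 0)"

context lie_isomorphism
begin

lemma R_ad_rank_one [transfer_rule]: "rel_fun R (rel_fun R (=)) (ad_rank_one b) (ad_rank_one b')"
  unfolding ad_rank_one_def by transfer_prover

lemma R_annihilates [transfer_rule]: "rel_fun R (rel_fun R (=)) (annihilates b) (annihilates b')"
  unfolding annihilates_def by transfer_prover

lemma tags_eq:
  "two_step_tag b = two_step_tag b'" "centralizer_tag b = centralizer_tag b'"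
  "annihilator_tag b = annihilator_tag b'" "square_tag b = square_tag b'" "cube_tag b = cube_tag b'"
proof -
  show "two_step_tag b = two_step_tag b'"
    unfolding two_step_tag_def by transfer_prover
  show "centralizer_tag b = centralizer_tag b'"
    unfolding centralizer_tag_def by transfer_prover
  show "annihilator_tag b = annihilator_tag b'"
    unfolding annihilator_tag_def by transfer_prover
  show "square_tag b = square_tag b'"
    unfolding square_tag_def by transfer_prover
  show "cube_tag b = cube_tag b'"
    unfolding cube_tag_def by transfer_prover
qed

end

lemma invariants_of_isomorphic:
  assumes "lie_isomorphic b b'"
  shows "profile b = profile b'" "tag b = tag b'"
proof -
  obtain \<phi> where "lie_isomorphism b b' \<phi>"
    using assms unfolding lie_isomorphic_def lie_isomorphism_def by blast
  then interpret lie_isomorphism b b' \<phi> .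
  show "profile b = profile b'"
    by (rule profile_eq[symmetric])
  then show "tag b = tag b'"
    by (simp add: tag_def tags_eq)
qed

section \<open>Invariants of the listed algebras\<close>

text \<open>For the listed algebras all four subspaces are spanned by basis vectors.\<close>

definition series :: "6 bracket \<Rightarrow> 6 set \<Rightarrow> 6 set \<Rightarrow> 6 set \<Rightarrow> 6 set \<Rightarrow> bool" where
  "series B I1 I2 I3 I4 \<longleftrightarrow>
     derived_algebra B = coordinate_subspace I1 \<and> center B = coordinate_subspace I2 \<and>
     second_center B = coordinate_subspace I3 \<and> derived_centralizer B = coordinate_subspace I4"

lemma bilinear_zero_iff:
  fixes B :: "real^'n \<Rightarrow> real^'n \<Rightarrow> 'a::real_vector"
  assumes B: "bilinear B" and h: "linear h"
  shows "(\<forall>y\<in>coordinate_subspace I. h (B x y) = (0::real)) \<longleftrightarrow> (\<forall>i\<in>I. h (B x (axis i 1)) = 0)"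
proof
  assume "\<forall>y\<in>coordinate_subspace I. h (B x y) = 0"
  then show "\<forall>i\<in>I. h (B x (axis i 1)) = 0"
    by (auto simp: coordinate_subspace_eq_span span_base)
next
  assume z: "\<forall>i\<in>I. h (B x (axis i 1)) = 0"
  have "linear (B x)"
    using B by (simp add: bilinear_def)
  then have "linear (\<lambda>y. h (B x y))"
    using linear_compose[OF _ h] by (simp add: o_def)
  have "h (B x y) = 0" if y: "y \<in> span ((\<lambda>i. axis i 1) ` I)" for y
  proof (rule linear_eq_0_on_span[OF \<open>linear (\<lambda>y. h (B x y))\<close> _ y])
    fix v assume "v \<in> (\<lambda>i. axis i (1::real)) ` I"
    then obtain i where "i \<in> I" "v = axis i 1"
      by blast
    then show "h (B x v) = 0"
      using z by simp
  qed
  then show "\<forall>y\<in>coordinate_subspace I. h (B x y) = 0"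
    by (simp add: coordinate_subspace_eq_span)
qed

lemma bilinear_component_zero_iff:
  fixes B :: "6 bracket"
  assumes "bilinear B"
  shows "(\<forall>y. B x y $ j = 0) \<longleftrightarrow> (\<forall>i. B x (axis i 1) $ j = 0)"
  using bilinear_zero_iff[OF assms linear_vec_component, of UNIV x j]
  unfolding coordinate_subspace_def by simp

lemma axis_vec6:
  "axis 1 1 = u1" "axis 2 1 = u2" "axis 3 1 = u3" "axis 4 1 = u4" "axis 5 1 = u5" "axis 6 1 = u6"
  by (simp_all add: vec6_eq_iff axis_def)

text \<open>By bilinearity the subspaces are determined by brackets with basis vectors, which makes
  the hypotheses finite computations.\<close>

lemma seriesI:
  assumes B: "bilinear B"
    and I1: "\<And>x y. \<forall>i. i \<notin> I1 \<longrightarrow> B x y $ i = 0" "\<forall>i. i \<in> I1 \<longrightarrow> (\<exists>j k. B (axis j 1) (axis k 1) = axis i 1)"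
    and I2: "\<And>x. (\<forall>j i. B x (axis i 1) $ j = 0) \<longleftrightarrow> (\<forall>i. i \<notin> I2 \<longrightarrow> x $ i = 0)"
    and I3: "\<And>x. (\<forall>j. j \<notin> I2 \<longrightarrow> (\<forall>i. B x (axis i 1) $ j = 0)) \<longleftrightarrow> (\<forall>i. i \<notin> I3 \<longrightarrow> x $ i = 0)"
    and I4: "\<And>x. (\<forall>j i. i \<in> I1 \<longrightarrow> B x (axis i 1) $ j = 0) \<longleftrightarrow> (\<forall>i. i \<notin> I4 \<longrightarrow> x $ i = 0)"
  shows "series B I1 I2 I3 I4"
proof -
  have 1: "derived_algebra B = coordinate_subspace I1"
  proof
    show "derived_algebra B \<subseteq> coordinate_subspace I1"
      unfolding derived_algebra_def
      by (rule span_minimal) (use I1(1) subspace_coordinate_subspace in \<open>auto simp: coordinate_subspace_def\<close>)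
    have "(\<lambda>i. axis i 1) ` I1 \<subseteq> derived_algebra B"
    proof
      fix v assume "v \<in> (\<lambda>i. axis i (1::real)) ` I1"
      then obtain i where i: "i \<in> I1" "v = axis i 1"
        by blast
      then obtain j k where "B (axis j 1) (axis k 1) = v"
        using I1(2) by blast
      then show "v \<in> derived_algebra B"
        unfolding derived_algebra_def by (intro span_base) blast
    qed
    then show "coordinate_subspace I1 \<subseteq> derived_algebra B"
      unfolding coordinate_subspace_eq_span derived_algebra_def by (intro span_minimal subspace_span)
  qed
  have 2: "center B = coordinate_subspace I2"
    unfolding center_def coordinate_subspace_def I2[symmetric] vec_eq_iff zero_index
      bilinear_component_zero_iff[OF B, symmetric] by blast
  have 3: "second_center B = coordinate_subspace I3"
    unfolding second_center_def 2 unfolding coordinate_subspace_def I3[symmetric]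
      bilinear_component_zero_iff[OF B, symmetric] by blast
  have "(\<forall>y\<in>coordinate_subspace I1. B x y = 0) \<longleftrightarrow> (\<forall>j. \<forall>i\<in>I1. B x (axis i 1) $ j = 0)" for x
    unfolding bilinear_zero_iff[OF B linear_vec_component, symmetric] vec_eq_iff zero_index by blast
  then have "(\<forall>y\<in>coordinate_subspace I1. B x y = 0) \<longleftrightarrow> x \<in> coordinate_subspace I4" for x
    using I4[of x] unfolding coordinate_subspace_def[of I4] by (simp add: Ball_def)
  then have 4: "derived_centralizer B = coordinate_subspace I4"
    unfolding derived_centralizer_def 1 by simp
  show ?thesis
    using 1 2 3 4 by (simp add: series_def)
qed

lemma series_profile:
  assumes "series B I1 I2 I3 I4"
  shows "profile B = map card [I1, I2, I3, I4]"
  using assms by (simp add: profile_def series_def dim_coordinate_subspace)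

lemma ex_6: "(\<exists>i::6. P i) \<longleftrightarrow> P 1 \<or> P 2 \<or> P 3 \<or> P 4 \<or> P 5 \<or> P 6"
  using forall_6[of "\<lambda>i. \<not> P i"] by blast

lemma lie_algebra_componentI:
  fixes B :: "'n::finite bracket"
  assumes "\<And>x y i. B x y $ i = - B y x $ i" "\<And>x y z i. B x (y + z) $ i = B x y $ i + B x z $ i"
    and "\<And>x y c i. B x (c *\<^sub>R y) $ i = c * B x y $ i"
    and "\<And>x y z i. (B (B x y) z + B (B y z) x + B (B z x) y) $ i = 0"
  shows "lie_algebra B"
proof
  have add: "B x (y + z) = B x y + B x z" and scale: "B x (c *\<^sub>R y) = c *\<^sub>R B x y" for x y z c
    using assms(2,3) by (simp_all add: vec_eq_iff)
  have skew: "B x y = - B y x" for x y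
    unfolding vec_eq_iff using assms(1)[of x y] by simp
  have "B (x + y) z = B x z + B y z" "B (c *\<^sub>R x) z = c *\<^sub>R B x z" for x y z c
    using add[of z x y] scale[of z c x] skew[of "x + y" z] skew[of x z] skew[of y z] skew[of
        "c *\<^sub>R x" z] by simp_all
  then show "bilinear B"
    using add scale by (simp add: bilinear_def linear_iff)
  have "B x x $ i = 0" for x i
    using assms(1)[of x x i] by linarith
  then show "B x x = 0" for x
    by (simp add: vec_eq_iff)
  show "B (B x y) z + B (B y z) x + B (B z x) y = 0" for x y z
    using assms(4) by (simp add: vec_eq_iff)
qed

lemma component_6I:
  assumes "P 1" "P 2" "P 3" "P 4" "P 5" "P 6"
  shows "P (i::6)"
  using assms forall_6[of P] by blast

lemmas listed_defs =
  A6_def L3_S_A3_def L5_2_S_A1_def L3_S_L3_def L6_1_def L6_2_def L4_S_A2_def L5_3_S_A1_def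
  L6_4_def L6_5_def L6_6_def L6_9_def L6_10_def L6_11_def L6_12_def L5_4_S_A1_def L6_13_def
  L5_6_S_A1_def L6_14_def L6_15_def L6_16_def L6_17_plus_def L6_17_minus_def L6_18_def
  L6_19_def L6_21_def

lemma listed_lie_algebra:
  "lie_algebra A6" "lie_algebra L3_S_A3" "lie_algebra L5_2_S_A1" "lie_algebra L3_S_L3"
  "lie_algebra L6_1" "lie_algebra L6_2" "lie_algebra L4_S_A2" "lie_algebra L5_3_S_A1"
  "lie_algebra L6_4" "lie_algebra L6_5" "lie_algebra L6_6" "lie_algebra L6_9"
  "lie_algebra L6_10" "lie_algebra L6_11" "lie_algebra L6_12" "lie_algebra L5_4_S_A1"
  "lie_algebra L6_13" "lie_algebra L5_6_S_A1" "lie_algebra L6_14" "lie_algebra L6_15"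
  "lie_algebra L6_16" "lie_algebra L6_17_plus" "lie_algebra L6_17_minus" "lie_algebra L6_18"
  "lie_algebra L6_19" "lie_algebra L6_21"
  unfolding listed_defs
  by (rule lie_algebra_componentI; rule component_6I; simp add: form_simps algebra_simps)+

lemma
  shows series_A6: "series A6 {} {1, 2, 3, 4, 5, 6} {1, 2, 3, 4, 5, 6} {1, 2, 3, 4, 5, 6}"
    and series_L3_S_A3: "series L3_S_A3 {6} {3, 4, 5, 6} {1, 2, 3, 4, 5, 6} {1, 2, 3, 4, 5, 6}"
    and series_L5_2_S_A1: "series L5_2_S_A1 {5, 6} {4, 5, 6} {1, 2, 3, 4, 5, 6} {1, 2, 3, 4, 5, 6}"
    and series_L3_S_L3: "series L3_S_L3 {5, 6} {5, 6} {1, 2, 3, 4, 5, 6} {1, 2, 3, 4, 5, 6}"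
    and series_L6_1: "series L6_1 {5, 6} {5, 6} {1, 2, 3, 4, 5, 6} {1, 2, 3, 4, 5, 6}"
    and series_L6_2: "series L6_2 {5, 6} {5, 6} {1, 2, 3, 4, 5, 6} {1, 2, 3, 4, 5, 6}"
    and series_L4_S_A2: "series L4_S_A2 {5, 6} {3, 4, 6} {3, 4, 5, 6} {2, 3, 4, 5, 6}"
    and series_L5_3_S_A1: "series L5_3_S_A1 {5, 6} {4, 6} {3, 4, 5, 6} {2, 3, 4, 5, 6}"
    and series_L6_4: "series L6_4 {4, 5, 6} {4, 5, 6} {1, 2, 3, 4, 5, 6} {1, 2, 3, 4, 5, 6}"
    and series_L6_5: "series L6_5 {4, 5, 6} {5, 6} {3, 4, 5, 6} {2, 3, 4, 5, 6}"
    and series_L6_6: "series L6_6 {4, 5, 6} {5, 6} {3, 4, 5, 6} {1, 3, 4, 5, 6}"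
    and series_L6_9: "series L6_9 {4, 5, 6} {5, 6} {3, 4, 5, 6} {2, 3, 4, 5, 6}"
    and series_L6_10: "series L6_10 {4, 5, 6} {5, 6} {3, 4, 5, 6} {3, 4, 5, 6}"
    and series_L6_11: "series L6_11 {4, 5, 6} {5, 6} {3, 4, 5, 6} {3, 4, 5, 6}"
    and series_L6_12: "series L6_12 {4, 5, 6} {5, 6} {3, 4, 5, 6} {3, 4, 5, 6}"
    and series_L5_4_S_A1: "series L5_4_S_A1 {4, 5, 6} {3, 6} {3, 5, 6} {2, 3, 4, 5, 6}"
    and series_L6_13: "series L6_13 {4, 5, 6} {6} {3, 5, 6} {2, 3, 4, 5, 6}"
    and series_L5_6_S_A1: "series L5_6_S_A1 {4, 5, 6} {3, 6} {3, 5, 6} {3, 4, 5, 6}"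
    and series_L6_14: "series L6_14 {4, 5, 6} {6} {3, 5, 6} {3, 4, 5, 6}"
    and series_L6_15: "series L6_15 {4, 5, 6} {6} {5, 6} {2, 4, 5, 6}"
    and series_L6_16: "series L6_16 {3, 4, 5, 6} {5, 6} {4, 5, 6} {3, 4, 5, 6}"
    and series_L6_17_plus: "series L6_17_plus {3, 4, 5, 6} {6} {4, 5, 6} {3, 4, 5, 6}"
    and series_L6_17_minus: "series L6_17_minus {3, 4, 5, 6} {6} {4, 5, 6} {3, 4, 5, 6}"
    and series_L6_18: "series L6_18 {3, 4, 5, 6} {6} {5, 6} {2, 3, 4, 5, 6}"
    and series_L6_19: "series L6_19 {3, 4, 5, 6} {6} {5, 6} {3, 4, 5, 6}"
    and series_L6_21: "series L6_21 {3, 4, 5, 6} {6} {5, 6} {3, 4, 5, 6}"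
  by (rule seriesI[OF lie_algebra.bilinear_bracket], rule listed_lie_algebra;
      auto simp: listed_defs forall_6 ex_6 axis_vec6 vec6_eq_iff form_simps)+

lemmas listed_series =
  series_A6 series_L3_S_A3 series_L5_2_S_A1 series_L3_S_L3 series_L6_1 series_L6_2
  series_L4_S_A2 series_L5_3_S_A1 series_L6_4 series_L6_5 series_L6_6 series_L6_9 series_L6_10
  series_L6_11 series_L6_12 series_L5_4_S_A1 series_L6_13 series_L5_6_S_A1 series_L6_14
  series_L6_15 series_L6_16 series_L6_17_plus series_L6_17_minus series_L6_18 series_L6_19
  series_L6_21

lemma listed_profile:
  "profile A6 = [0, 6, 6, 6]"
  "profile L3_S_A3 = [1, 4, 6, 6]"
  "profile L5_2_S_A1 = [2, 3, 6, 6]"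
  "profile L3_S_L3 = [2, 2, 6, 6]"
  "profile L6_1 = [2, 2, 6, 6]"
  "profile L6_2 = [2, 2, 6, 6]"
  "profile L4_S_A2 = [2, 3, 4, 5]"
  "profile L5_3_S_A1 = [2, 2, 4, 5]"
  "profile L6_4 = [3, 3, 6, 6]"
  "profile L6_5 = [3, 2, 4, 5]"
  "profile L6_6 = [3, 2, 4, 5]"
  "profile L6_9 = [3, 2, 4, 5]"
  "profile L6_10 = [3, 2, 4, 4]"
  "profile L6_11 = [3, 2, 4, 4]"
  "profile L6_12 = [3, 2, 4, 4]"
  "profile L5_4_S_A1 = [3, 2, 3, 5]"
  "profile L6_13 = [3, 1, 3, 5]"
  "profile L5_6_S_A1 = [3, 2, 3, 4]"
  "profile L6_14 = [3, 1, 3, 4]"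
  "profile L6_15 = [3, 1, 2, 4]"
  "profile L6_16 = [4, 2, 3, 4]"
  "profile L6_17_plus = [4, 1, 3, 4]"
  "profile L6_17_minus = [4, 1, 3, 4]"
  "profile L6_18 = [4, 1, 2, 5]"
  "profile L6_19 = [4, 1, 2, 4]"
  "profile L6_21 = [4, 1, 2, 4]"
  by (simp_all add: listed_series[THEN series_profile])

lemma ad_rank_one_minors:
  fixes b :: "real^'n \<Rightarrow> real^'n \<Rightarrow> real^'n"
  assumes "ad_rank_one b x y"
  shows "b x z $ i * b x w $ j = b x z $ j * b x w $ i"
proof -
  obtain c d where "b x z = c *\<^sub>R b x y" "b x w = d *\<^sub>R b x y"
    using assms unfolding ad_rank_one_def by metis
  then show ?thesis
    by simp
qed

lemma two_step_tag_L3_S_L3: "two_step_tag L3_S_L3 = 2"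
proof -
  have "ad_rank_one L3_S_L3 u1 u2" "ad_rank_one L3_S_L3 u2 u1"
    unfolding ad_rank_one_def
    by (auto simp: L3_S_L3_def vec6_eq_iff form_simps intro: exI[of _ "_ $ _"])
  then show ?thesis
    unfolding two_step_tag_def by auto
qed

lemma two_step_tag_L6_1: "two_step_tag L6_1 = 1"
proof -
  have zero: "x$1 = 0 \<and> x$2 = 0" if "ad_rank_one L6_1 x y" for x y
    using ad_rank_one_minors[OF that, of u1 5 u3 6] ad_rank_one_minors[OF that, of u2 5 u3 6]
      ad_rank_one_minors[OF that, of u1 5 u4 6]
    by (simp add: L6_1_def form_simps)
  have "\<not> (ad_rank_one L6_1 x y \<and> ad_rank_one L6_1 y x)" for x y
  proof
    assume r: "ad_rank_one L6_1 x y \<and> ad_rank_one L6_1 y x"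
    then have "L6_1 x y = 0"
      using zero[of x y] zero[of y x] by (simp add: L6_1_def vec6_eq_iff form_simps)
    then show False
      using r by (simp add: ad_rank_one_def)
  qed
  moreover have "ad_rank_one L6_1 u3 u1"
    unfolding ad_rank_one_def
    by (auto simp: L6_1_def vec6_eq_iff form_simps intro: exI[of _ "_ $ _"])
  ultimately show ?thesis
    unfolding two_step_tag_def by auto
qed

lemma two_step_tag_L6_2: "two_step_tag L6_2 = 0"
proof -
  have "\<not> ad_rank_one L6_2 x y" for x y
  proof
    assume r: "ad_rank_one L6_2 x y"
    have "x$3 * x$3 + x$4 * x$4 = 0" "x$1 * x$1 + x$2 * x$2 = 0"
      using ad_rank_one_minors[OF r, of u1 5 u2 6] ad_rank_one_minors[OF r, of u3 5 u4 6]
      by (simp_all add: L6_2_def form_simps)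
    then have "x$1 = 0" "x$2 = 0" "x$3 = 0" "x$4 = 0"
      by (simp_all add: sum_squares_eq_zero_iff)
    then have "L6_2 x y = 0"
      by (simp add: L6_2_def vec6_eq_iff form_simps)
    then show False
      using r by (simp add: ad_rank_one_def)
  qed
  then show ?thesis
    unfolding two_step_tag_def by auto
qed

lemma series_mem_iff:
  assumes "series B I1 I2 I3 I4"
  shows "x \<in> derived_centralizer B \<longleftrightarrow> (\<forall>i. i \<notin> I4 \<longrightarrow> x $ i = 0)"
    and "x \<in> center B \<longleftrightarrow> (\<forall>i. i \<notin> I2 \<longrightarrow> x $ i = 0)"
  using assms by (simp_all add: series_def coordinate_subspace_def)

lemmas L6_5_subspaces = series_mem_iff[OF series_L6_5, unfolded forall_6, simplified]
lemmas L6_6_subspaces = series_mem_iff[OF series_L6_6, unfolded forall_6, simplified]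

lemmas L6_9_subspaces = series_mem_iff[OF series_L6_9, unfolded forall_6, simplified]
lemmas L6_10_subspaces = series_mem_iff[OF series_L6_10, unfolded forall_6, simplified]

lemmas L6_11_subspaces = series_mem_iff[OF series_L6_11, unfolded forall_6, simplified]
lemmas L6_12_subspaces = series_mem_iff[OF series_L6_12, unfolded forall_6, simplified]

lemmas L6_17_plus_subspaces = series_mem_iff[OF series_L6_17_plus, unfolded forall_6, simplified]
lemmas L6_17_minus_subspaces = series_mem_iff[OF series_L6_17_minus, unfolded forall_6, simplified]

lemmas L6_19_subspaces = series_mem_iff[OF series_L6_19, unfolded forall_6, simplified]
lemmas L6_21_subspaces = series_mem_iff[OF series_L6_21, unfolded forall_6, simplified]

lemma centralizer_tags:
  "centralizer_tag L6_5 = 2" "centralizer_tag L6_9 = 1" "centralizer_tag L6_6 = 0"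
proof -
  have "L6_5 x y = 0" if "x \<in> derived_centralizer L6_5" "y \<in> derived_centralizer L6_5" for x y
    using that by (simp add: L6_5_subspaces vec6_eq_iff) (simp add: L6_5_def form_simps)
  then show "centralizer_tag L6_5 = 2"
    unfolding centralizer_tag_def by auto
  have "u2 \<in> derived_centralizer L6_9" "u3 \<in> derived_centralizer L6_9" "L6_9 u2 u3 \<noteq> 0"
    by (simp_all add: L6_9_subspaces vec6_eq_iff) (simp_all add: L6_9_def form_simps)
  moreover have "\<exists>u v w. L6_9 x y = L6_9 u (L6_9 v w)"
    if "x \<in> derived_centralizer L6_9" "y \<in> derived_centralizer L6_9" for x y
    using that by (intro exI[of _ u1] exI[of _ "vec6 0 (x$3 * y$2 - x$2 * y$3) 0 0 0 0"])
      (simp add: L6_9_subspaces vec6_eq_iff, simp add: L6_9_def form_simps)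
  ultimately show "centralizer_tag L6_9 = 1"
    unfolding centralizer_tag_def by auto
  have "L6_6 u1 u3 \<noteq> L6_6 u (L6_6 v w)" "L6_6 u1 u3 \<noteq> 0" for u v w
    by (simp_all add: vec6_eq_iff) (simp_all add: L6_6_def form_simps)
  moreover have "u1 \<in> derived_centralizer L6_6" "u3 \<in> derived_centralizer L6_6"
    by (simp_all add: L6_6_subspaces)
  ultimately have
    "\<not> (\<forall>x\<in>derived_centralizer L6_6. \<forall>y\<in>derived_centralizer L6_6. \<exists>u v w. L6_6 x y = L6_6 u (L6_6 v w))"
    "\<not> (\<forall>x\<in>derived_centralizer L6_6. \<forall>y\<in>derived_centralizer L6_6. L6_6 x y = 0)"
    by blast+
  then show "centralizer_tag L6_6 = 0"
    unfolding centralizer_tag_def by (simp only: if_False)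
qed

lemma annihilator_tags:
  "annihilator_tag L6_10 = 2" "annihilator_tag L6_11 = 1" "annihilator_tag L6_12 = 0"
proof -
  have "annihilates L6_10 u1 u3" "annihilates L6_10 u2 (vec6 0 0 1 (- 1) 0 0)"
    "L6_10 u1 (vec6 0 0 1 (- 1) 0 0) \<noteq> 0"
    by (simp_all add: annihilates_def L6_10_subspaces vec6_eq_iff) (simp_all add: L6_10_def form_simps)
  then show "annihilator_tag L6_10 = 2"
    unfolding annihilator_tag_def by auto
  have "annihilates L6_11 u2 u3"
    by (simp add: annihilates_def L6_11_subspaces vec6_eq_iff) (simp add: L6_11_def form_simps)
  moreover have zero: "x$1 = 0 \<and> z$1 = 0 \<and> z$2 = 0 \<and> z$4 = 0" if "annihilates L6_11 x z" for x z
    using that by (auto simp: annihilates_def L6_11_subspaces vec6_eq_iff) (auto simp: L6_11_def form_simps)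
  have "\<not> (annihilates L6_11 x z \<and> annihilates L6_11 x' z' \<and> L6_11 x z' \<noteq> 0)" for x z x' z'
    using zero[of x z] zero[of x' z'] by (auto simp: vec6_eq_iff) (auto simp: L6_11_def form_simps)
  ultimately show "annihilator_tag L6_11 = 1"
    unfolding annihilator_tag_def by auto
  have "\<not> annihilates L6_12 x z" for x z
  proof
    assume a: "annihilates L6_12 x z"
    have z: "z$1 = 0" "z$2 = 0"
      using a by (simp_all add: annihilates_def L6_12_subspaces)
    have eqs: "x$1 * z$4 + x$2 * z$3 = 0" "x$1 * z$3 - x$2 * z$4 = 0"
      using a z by (simp_all add: annihilates_def vec6_eq_iff) (simp_all add: L6_12_def form_simps)
    have "(x$1)\<^sup>2 + (x$2)\<^sup>2 \<noteq> 0"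
      using a by (auto simp: annihilates_def L6_12_subspaces sum_power2_eq_zero_iff)
    then have "z$4 = 0" "z$3 = 0"
      using rotation_eq_0[OF eqs] by blast+
    then show False
      using a z by (simp add: annihilates_def L6_12_subspaces)
  qed
  then show "annihilator_tag L6_12 = 0"
    unfolding annihilator_tag_def by auto
qed

lemma square_tags: "square_tag L6_17_minus = 1" "square_tag L6_17_plus = 0"
proof -
  let ?x = "vec6 1 1 0 0 0 0"
  have "?x \<notin> derived_centralizer L6_17_minus"
    by (simp add: L6_17_minus_subspaces)
  moreover have "L6_17_minus ?x (L6_17_minus ?x (L6_17_minus y z)) = 0" for y z
    by (simp add: vec6_eq_iff) (simp add: L6_17_minus_def form_simps)
  ultimately show "square_tag L6_17_minus = 1"
    unfolding square_tag_def by auto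
  have "x \<in> derived_centralizer L6_17_plus"
    if "\<forall>y z. L6_17_plus x (L6_17_plus x (L6_17_plus y z)) = 0" for x
  proof -
    have "L6_17_plus x (L6_17_plus x (L6_17_plus u1 u2)) $ 6 = - (x$1 * x$1 + x$2 * x$2)"
      by (simp add: L6_17_plus_def form_simps)
    moreover have "L6_17_plus x (L6_17_plus x (L6_17_plus u1 u2)) = 0"
      using that by blast
    ultimately have "x$1 * x$1 + x$2 * x$2 = 0"
      by (simp only: zero_index neg_0_equal_iff_equal)
    then have "x$1 = 0 \<and> x$2 = 0"
      unfolding sum_squares_eq_zero_iff .
    then show ?thesis
      by (simp add: L6_17_plus_subspaces)
  qed
  then show "square_tag L6_17_plus = 0"
    unfolding square_tag_def by auto
qed

lemma cube_tags: "cube_tag L6_19 = 1" "cube_tag L6_21 = 0"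
proof -
  have "u2 \<notin> derived_centralizer L6_19"
    by (simp add: L6_19_subspaces)
  moreover have "L6_19 u2 (L6_19 y (L6_19 z w)) = 0" for y z w
    by (simp add: vec6_eq_iff) (simp add: L6_19_def form_simps)
  ultimately show "cube_tag L6_19 = 1"
    unfolding cube_tag_def by auto
  have "x \<in> derived_centralizer L6_21"
    if "\<forall>y z w. L6_21 x (L6_21 y (L6_21 z w)) = 0" for x
  proof -
    have "L6_21 x (L6_21 u1 (L6_21 u1 u2)) = 0"
      using that by blast
    then show ?thesis
      by (simp add: L6_21_subspaces vec6_eq_iff) (simp add: L6_21_def form_simps)
  qed
  then show "cube_tag L6_21 = 0"
    unfolding cube_tag_def by auto
qed

lemma listed_tag:
  "tag L3_S_L3 = 2"
  "tag L6_1 = 1"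
  "tag L6_2 = 0"
  "tag L6_5 = 2"
  "tag L6_9 = 1"
  "tag L6_6 = 0"
  "tag L6_10 = 2"
  "tag L6_11 = 1"
  "tag L6_12 = 0"
  "tag L6_17_minus = 1"
  "tag L6_17_plus = 0"
  "tag L6_19 = 1"
  "tag L6_21 = 0"
  by (simp_all add: tag_def listed_profile two_step_tag_L3_S_L3 two_step_tag_L6_1 two_step_tag_L6_2
      centralizer_tags annihilator_tags square_tags cube_tags)

definition listed_algebras :: "6 bracket list" where
  "listed_algebras =
    [A6, L3_S_A3, L5_2_S_A1, L3_S_L3, L6_1, L6_2, L4_S_A2, L5_3_S_A1, L6_4,
     L6_5, L6_6, L6_9, L6_10, L6_11, L6_12, L5_4_S_A1, L6_13, L5_6_S_A1,
     L6_14, L6_15, L6_16, L6_17_plus, L6_17_minus, L6_18, L6_19, L6_21]"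

lemma set_listed_algebras: "set listed_algebras = symplectic_nilpotent_6"
  by (simp add: listed_algebras_def symplectic_nilpotent_6_def)

lemma listed_invariants_distinct: "distinct (map (\<lambda>b. (profile b, tag b)) listed_algebras)"
  by (simp add: listed_algebras_def listed_profile listed_tag)

lemma isomorphic_listed_eq:
  assumes "L \<in> symplectic_nilpotent_6" "L' \<in> symplectic_nilpotent_6" "lie_isomorphic L L'"
  shows "L = L'"
proof -
  have "inj_on (\<lambda>b. (profile b, tag b)) symplectic_nilpotent_6"
    using listed_invariants_distinct by (simp add: distinct_map set_listed_algebras)
  then show ?thesis
    using assms invariants_of_isomorphic[OF assms(3)] by (simp add: inj_on_def)
qed

lemma distinct_listed_algebras: "distinct listed_algebras"
  using listed_invariants_distinct distinct_map by blast

lemma card_symplectic_nilpotent_6: "card symplectic_nilpotent_6 = 26"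
  using distinct_card[OF distinct_listed_algebras]
  by (simp add: set_listed_algebras) (simp add: listed_algebras_def)

section \<open>Nilpotency and symplectic forms\<close>

lemma lower_central_series_step:
  assumes "lower_central_series B k \<subseteq> coordinate_subspace I"
    and "\<And>x y. y \<in> coordinate_subspace I \<Longrightarrow> B x y \<in> coordinate_subspace J"
  shows "lower_central_series B (Suc k) \<subseteq> coordinate_subspace J"
  unfolding lower_central_series.simps
  by (rule span_minimal) (use assms subspace_coordinate_subspace in auto)

lemma nilpotent_if_series_vanishes:
  assumes "lie_algebra B" "lower_central_series B (Suc k) \<subseteq> coordinate_subspace {}"
  shows "nilpotent_lie_algebra B"
proof -
  have "coordinate_subspace {} = {0}"
    by (auto simp: coordinate_subspace_def vec_eq_iff)
  then have "lower_central_series B (Suc k) = {0}"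
    using assms(2) by (auto simp: span_zero)
  then show ?thesis
    using assms(1) unfolding nilpotent_lie_algebra_def by blast
qed

lemma nilpotent_6I:
  fixes B :: "6 bracket"
  assumes lie: "lie_algebra B"
    and "\<And>x y. B x y $ 1 = 0" "\<And>x y. B x y $ 2 = 0"
    and "\<And>x y. y$1 = 0 \<Longrightarrow> y$2 = 0 \<Longrightarrow> B x y $ 3 = 0"
    and "\<And>x y. y$1 = 0 \<Longrightarrow> y$2 = 0 \<Longrightarrow> y$3 = 0 \<Longrightarrow> B x y $ 4 = 0"
    and "\<And>x y. y$1 = 0 \<Longrightarrow> y$2 = 0 \<Longrightarrow> y$3 = 0 \<Longrightarrow> y$4 = 0 \<Longrightarrow> B x y $ 5 = 0"
    and "\<And>x y. y$1 = 0 \<Longrightarrow> y$2 = 0 \<Longrightarrow> y$3 = 0 \<Longrightarrow> y$4 = 0 \<Longrightarrow> y$5 = 0 \<Longrightarrow> B x y $ 6 = 0"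
  shows "nilpotent_lie_algebra B"
proof -
  have "lower_central_series B 0 \<subseteq> coordinate_subspace UNIV"
    by (simp add: coordinate_subspace_def)
  then have "lower_central_series B (Suc 0) \<subseteq> coordinate_subspace {3, 4, 5, 6}"
    by (rule lower_central_series_step) (use assms in \<open>simp add: coordinate_subspace_def forall_6\<close>)
  then have "lower_central_series B (Suc (Suc 0)) \<subseteq> coordinate_subspace {4, 5, 6}"
    by (rule lower_central_series_step) (use assms in \<open>simp add: coordinate_subspace_def forall_6\<close>)
  then have "lower_central_series B (Suc (Suc (Suc 0))) \<subseteq> coordinate_subspace {5, 6}"
    by (rule lower_central_series_step) (use assms in \<open>simp add: coordinate_subspace_def forall_6\<close>)
  then have "lower_central_series B (Suc (Suc (Suc (Suc 0)))) \<subseteq> coordinate_subspace {6}"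
    by (rule lower_central_series_step) (use assms in \<open>simp add: coordinate_subspace_def forall_6\<close>)
  then have "lower_central_series B (Suc (Suc (Suc (Suc (Suc 0))))) \<subseteq> coordinate_subspace {}"
    by (rule lower_central_series_step) (use assms in \<open>simp add: coordinate_subspace_def forall_6\<close>)
  then show ?thesis
    by (rule nilpotent_if_series_vanishes[OF lie])
qed

lemma listed_nilpotent:
  "nilpotent_lie_algebra A6" "nilpotent_lie_algebra L3_S_A3" "nilpotent_lie_algebra L5_2_S_A1"
  "nilpotent_lie_algebra L3_S_L3" "nilpotent_lie_algebra L6_1" "nilpotent_lie_algebra L6_2"
  "nilpotent_lie_algebra L4_S_A2" "nilpotent_lie_algebra L5_3_S_A1" "nilpotent_lie_algebra L6_4"
  "nilpotent_lie_algebra L6_5" "nilpotent_lie_algebra L6_6" "nilpotent_lie_algebra L6_9"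
  "nilpotent_lie_algebra L6_10" "nilpotent_lie_algebra L6_11" "nilpotent_lie_algebra L6_12"
  "nilpotent_lie_algebra L5_4_S_A1" "nilpotent_lie_algebra L6_13" "nilpotent_lie_algebra L5_6_S_A1"
  "nilpotent_lie_algebra L6_14" "nilpotent_lie_algebra L6_15" "nilpotent_lie_algebra L6_16"
  "nilpotent_lie_algebra L6_17_plus" "nilpotent_lie_algebra L6_17_minus" "nilpotent_lie_algebra L6_18"
  "nilpotent_lie_algebra L6_19" "nilpotent_lie_algebra L6_21"
  by (rule nilpotent_6I, rule listed_lie_algebra; simp add: listed_defs form_simps)+

lemma symplectic_6I:
  fixes c12 c13 c14 c15 c16 c23 c24 c25 c26 c34 c35 c36 c45 c46 c56
  defines "\<omega> \<equiv> form6 c12 c13 c14 c15 c16 c23 c24 c25 c26 c34 c35 c36 c45 c46 c56"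
  assumes "\<And>x y z. \<omega> (B x y) z + \<omega> (B y z) x + \<omega> (B z x) y = 0"
    and nondeg: "\<And>x. \<omega> x u1 = 0 \<Longrightarrow> \<omega> x u2 = 0 \<Longrightarrow> \<omega> x u3 = 0 \<Longrightarrow> \<omega> x u4 = 0 \<Longrightarrow> \<omega> x u5 = 0 \<Longrightarrow> \<omega> x u6 = 0 \<Longrightarrow>
      x$1 = 0 \<and> x$2 = 0 \<and> x$3 = 0 \<and> x$4 = 0 \<and> x$5 = 0 \<and> x$6 = 0"
  shows "symplectic_form B \<omega>"
  unfolding symplectic_form_def
  using assms(2) form6_bilinear form6_self nondeg by (auto simp: \<omega>_def vec6_eq_iff)

lemma
  shows symplectic_A6: "symplectic_form A6 (form6 0 0 (- 1) 0 0 0 0 0 2 0 1 0 0 0 0)"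
    and symplectic_L3_S_A3: "symplectic_form L3_S_A3 (form6 0 0 0 0 (- 1) 0 1 0 0 0 (- 1) 0 0 0 0)"
    and symplectic_L5_2_S_A1: "symplectic_form L5_2_S_A1 (form6 0 0 (- 1) 0 0 0 0 0 (- 1) 0 (- 1) 0 0 0 0)"
    and symplectic_L3_S_L3: "symplectic_form L3_S_L3 (form6 0 1 0 0 0 0 0 1 0 0 0 0 0 (- 1) 0)"
    and symplectic_L6_1: "symplectic_form L6_1 (form6 0 0 (- 1) 0 0 0 0 0 1 0 1 0 0 0 0)"
    and symplectic_L6_2: "symplectic_form L6_2 (form6 0 0 0 (- 1) 0 0 0 0 1 1 0 0 0 0 0)"
    and symplectic_L4_S_A2: "symplectic_form L4_S_A2 (form6 0 0 0 0 2 0 0 (- 1) 0 (- 1) 0 0 0 0 0)"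
    and symplectic_L5_3_S_A1: "symplectic_form L5_3_S_A1 (form6 0 0 0 0 (- 1) 0 2 0 0 0 1 0 0 0 0)"
    and symplectic_L6_4: "symplectic_form L6_4 (form6 0 0 0 0 (- 1) 0 0 1 0 2 0 0 0 0 0)"
    and symplectic_L6_5: "symplectic_form L6_5 (form6 0 0 0 0 1 0 0 (- 1) 0 (- 1) 0 0 0 0 0)"
    and symplectic_L6_6: "symplectic_form L6_6 (form6 0 0 0 1 0 0 0 1 (- 1) 1 0 0 0 0 0)"
    and symplectic_L6_9: "symplectic_form L6_9 (form6 0 0 0 0 (- 2) 0 0 (- 1) 0 1 0 0 0 0 0)"
    and symplectic_L6_10: "symplectic_form L6_10 (form6 0 0 0 0 1 0 0 1 0 (- 1) 0 0 0 0 0)"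
    and symplectic_L6_11: "symplectic_form L6_11 (form6 0 0 0 0 (- 1) 0 0 (- 1) (- 1) (- 1) 0 0 0 0 0)"
    and symplectic_L6_12: "symplectic_form L6_12 (form6 0 0 0 0 1 0 0 (- 1) 1 1 0 0 0 0 0)"
    and symplectic_L5_4_S_A1: "symplectic_form L5_4_S_A1 (form6 0 (- 1) 0 0 0 0 0 0 (- 1) 0 0 0 1 0 0)"
    and symplectic_L6_13: "symplectic_form L6_13 (form6 0 1 0 0 0 0 0 0 1 0 0 0 (- 1) 0 0)"
    and symplectic_L5_6_S_A1: "symplectic_form L5_6_S_A1 (form6 0 (- 1) 0 0 0 0 0 0 1 0 0 0 (- 1) 0 0)"
    and symplectic_L6_14: "symplectic_form L6_14 (form6 0 (- 1) 0 0 0 0 0 0 1 0 0 0 (- 1) 0 0)"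
    and symplectic_L6_15: "symplectic_form L6_15 (form6 0 0 0 0 (- 1) 0 1 0 0 0 1 0 0 0 0)"
    and symplectic_L6_16: "symplectic_form L6_16 (form6 0 0 0 (- 1) 0 0 (- 1) 0 (- 1) 1 0 0 0 0 0)"
    and symplectic_L6_17_plus: "symplectic_form L6_17_plus (form6 0 0 0 1 0 0 1 0 1 (- 1) 0 0 0 0 0)"
    and symplectic_L6_17_minus: "symplectic_form L6_17_minus (form6 0 0 0 (- 1) (- 1) 0 (- 1) 0 0 0 1 0
        0 0 0)"
    and symplectic_L6_18: "symplectic_form L6_18 (form6 0 0 0 0 1 0 0 (- 1) 0 1 0 0 0 0 0)"
    and symplectic_L6_19: "symplectic_form L6_19 (form6 0 0 0 0 (- 1) 0 (- 1) 1 0 (- 1) 0 0 0 0 0)"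
    and symplectic_L6_21: "symplectic_form L6_21 (form6 0 0 0 0 1 0 0 (- 1) 0 2 0 0 0 0 0)"
  by (rule symplectic_6I; auto simp: listed_defs form6_simps algebra_simps)+

lemma listed_admits_symplectic:
  assumes "L \<in> symplectic_nilpotent_6"
  shows "admits_symplectic L"
  using assms unfolding symplectic_nilpotent_6_def admits_symplectic_def
  by (elim insertE emptyE; hypsubst; blast intro:
      symplectic_A6 symplectic_L3_S_A3 symplectic_L5_2_S_A1 symplectic_L3_S_L3 symplectic_L6_1
      symplectic_L6_2 symplectic_L4_S_A2 symplectic_L5_3_S_A1 symplectic_L6_4 symplectic_L6_5
      symplectic_L6_6 symplectic_L6_9 symplectic_L6_10 symplectic_L6_11 symplectic_L6_12
      symplectic_L5_4_S_A1 symplectic_L6_13 symplectic_L5_6_S_A1 symplectic_L6_14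
      symplectic_L6_15 symplectic_L6_16 symplectic_L6_17_plus symplectic_L6_17_minus
      symplectic_L6_18 symplectic_L6_19 symplectic_L6_21)

section \<open>Bi-Lagrangian structures\<close>

text \<open>The Lagrangian subalgebras are the preimages of two complementary coordinate subspaces
  under a linear automorphism \<open>V\<close> of the vector space. For most of the algebras \<open>V\<close> is the
  identity.\<close>

lemma bi_lagrangianI:
  fixes B :: "real^'n \<Rightarrow> real^'n \<Rightarrow> real^'n" and V :: "real^'n \<Rightarrow> real^'n"
  assumes symp: "symplectic_form B \<omega>"
    and V: "linear V" "\<And>x. V x = 0 \<Longrightarrow> x = 0"
    and IJ: "I \<union> J = UNIV" "I \<inter> J = {}" "card I = card J"
    and F: "\<And>x y. V x \<in> coordinate_subspace I \<Longrightarrow> V y \<in> coordinate_subspace I \<Longrightarrow>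
      V (B x y) \<in> coordinate_subspace I \<and> \<omega> x y = 0"
    and G: "\<And>x y. V x \<in> coordinate_subspace J \<Longrightarrow> V y \<in> coordinate_subspace J \<Longrightarrow>
      V (B x y) \<in> coordinate_subspace J \<and> \<omega> x y = 0"
  shows "admits_bi_lagrangian B"
proof -
  have bij: "bij V"
    using V by (intro linear_injective_imp_bij) simp_all
  have sub: "subspace {x. V x \<in> coordinate_subspace K}" for K
    using linear_subspace_vimage[OF V(1) subspace_coordinate_subspace[of K]] by (simp add: vimage_def)
  have card: "CARD('n) = card I + card J"
    using IJ(1,2) by (metis card_Un_disjoint finite_code finite)
  have dim: "dim {x. V x \<in> coordinate_subspace K} = card K" for K
  proof -
    have "V ` {x. V x \<in> coordinate_subspace K} = coordinate_subspace K"
      using bij by (auto simp: bij_def surj_def image_iff)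
    then show ?thesis
      using dim_linear_bij_image[OF V(1), of "{x. V x \<in> coordinate_subspace K}"] bij
      by (simp add: bij_def dim_coordinate_subspace)
  qed
  let ?F = "{x. V x \<in> coordinate_subspace I}" and ?G = "{x. V x \<in> coordinate_subspace J}"
  have "?F \<inter> ?G = {0}"
  proof
    show "?F \<inter> ?G \<subseteq> {0}"
    proof
      fix x assume x: "x \<in> ?F \<inter> ?G"
      have "V x $ i = 0" for i
        using x IJ(2) by (auto simp: coordinate_subspace_def)
      then show "x \<in> {0}"
        using V(2)[of x] by (simp add: vec_eq_iff)
    qed
    show "{0} \<subseteq> ?F \<inter> ?G"
      using V(1) by (simp add: linear_0 coordinate_subspace_def)
  qed
  moreover have "\<exists>y\<in>?F. \<exists>z\<in>?G. x = y + z" for x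
  proof -
    define p where "p = (\<chi> i. if i \<in> I then V x $ i else 0)"
    obtain y where y: "V y = p"
      using bij by (metis bij_pointE)
    have "V (x - y) = V x - p"
      using V(1) y by (simp add: linear_diff)
    then have "x - y \<in> ?G"
      using IJ(1) by (auto simp: coordinate_subspace_def p_def)
    moreover have "y \<in> ?F"
      using y by (simp add: coordinate_subspace_def p_def)
    ultimately show ?thesis
      by (intro bexI[of _ y] bexI[of _ "x - y"]) simp_all
  qed
  ultimately have "bi_lagrangian_structure B \<omega> ?F ?G"
    unfolding bi_lagrangian_structure_def lie_subalgebra_def lagrangian_def dim
    using symp sub F G card IJ(3) by auto
  then show ?thesis
    unfolding admits_bi_lagrangian_def by blast
qed

lemmas bi_lagrangian_simps =
  set_eq_iff forall_6 coordinate_subspace_def form6_simps linear_iff vec6_eq_iff algebra_simps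

lemma bi_lagrangian_A6: "admits_bi_lagrangian A6"
  by (rule bi_lagrangianI[OF symplectic_A6, of "\<lambda>x. x" "{1, 2, 3}" "{4, 5, 6}"])
    (auto simp: A6_def bi_lagrangian_simps)

lemma bi_lagrangian_L3_S_A3: "admits_bi_lagrangian L3_S_A3"
  by (rule bi_lagrangianI[OF symplectic_L3_S_A3, of "\<lambda>x. x" "{1, 3, 4}" "{2, 5, 6}"])
    (auto simp: L3_S_A3_def bi_lagrangian_simps)

lemma bi_lagrangian_L5_2_S_A1: "admits_bi_lagrangian L5_2_S_A1"
  by (rule bi_lagrangianI[OF symplectic_L5_2_S_A1, of "\<lambda>x. x" "{1, 2, 5}" "{3, 4, 6}"])
    (auto simp: L5_2_S_A1_def bi_lagrangian_simps)

lemma bi_lagrangian_L3_S_L3: "admits_bi_lagrangian L3_S_L3"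
  by (rule bi_lagrangianI[OF symplectic_L3_S_L3, of "\<lambda>x. x" "{1, 4, 5}" "{2, 3, 6}"])
    (auto simp: L3_S_L3_def bi_lagrangian_simps)

lemma bi_lagrangian_L6_1: "admits_bi_lagrangian L6_1"
  by (rule bi_lagrangianI[OF symplectic_L6_1, of "\<lambda>x. x" "{1, 2, 5}" "{3, 4, 6}"])
    (auto simp: L6_1_def bi_lagrangian_simps)

lemma bi_lagrangian_L5_3_S_A1: "admits_bi_lagrangian L5_3_S_A1"
  by (rule bi_lagrangianI[OF symplectic_L5_3_S_A1, of "\<lambda>x. x" "{1, 3, 4}" "{2, 5, 6}"])
    (auto simp: L5_3_S_A1_def bi_lagrangian_simps)

lemma bi_lagrangian_L6_4: "admits_bi_lagrangian L6_4"
  by (rule bi_lagrangianI[OF symplectic_L6_4, of "\<lambda>x. x" "{1, 3, 5}" "{2, 4, 6}"])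
    (auto simp: L6_4_def bi_lagrangian_simps)

lemma bi_lagrangian_L6_5: "admits_bi_lagrangian L6_5"
  by (rule bi_lagrangianI[OF symplectic_L6_5, of "\<lambda>x. x" "{1, 3, 5}" "{2, 4, 6}"])
    (auto simp: L6_5_def bi_lagrangian_simps)

lemma bi_lagrangian_L6_9: "admits_bi_lagrangian L6_9"
  by (rule bi_lagrangianI[OF symplectic_L6_9, of "\<lambda>x. x" "{1, 3, 5}" "{2, 4, 6}"])
    (auto simp: L6_9_def bi_lagrangian_simps)

lemma bi_lagrangian_L6_10: "admits_bi_lagrangian L6_10"
  by (rule bi_lagrangianI[OF symplectic_L6_10, of "\<lambda>x. x" "{1, 3, 5}" "{2, 4, 6}"])
    (auto simp: L6_10_def bi_lagrangian_simps)

lemma bi_lagrangian_L5_4_S_A1: "admits_bi_lagrangian L5_4_S_A1"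
  by (rule bi_lagrangianI[OF symplectic_L5_4_S_A1, of "\<lambda>x. x" "{1, 5, 6}" "{2, 3, 4}"])
    (auto simp: L5_4_S_A1_def bi_lagrangian_simps)

lemma bi_lagrangian_L6_16: "admits_bi_lagrangian L6_16"
  by (rule bi_lagrangianI[OF symplectic_L6_16, of "\<lambda>x. x" "{1, 4, 6}" "{2, 3, 5}"])
    (auto simp: L6_16_def bi_lagrangian_simps)

lemma bi_lagrangian_L6_2: "admits_bi_lagrangian L6_2"
  by (rule bi_lagrangianI[OF symplectic_L6_2, of "\<lambda>x. vec6 (x$1) (x$3) (x$6) (x$2 + x$1) (x$4) (x$5
      + x$6)" "{1, 2, 3}" "{4, 5, 6}"])
    (auto simp: L6_2_def bi_lagrangian_simps add_eq_0_iff)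

lemma bi_lagrangian_L6_6: "admits_bi_lagrangian L6_6"
  by (rule bi_lagrangianI[OF symplectic_L6_6, of "\<lambda>x. vec6 (x$1) (x$4) (x$6 - x$5) (x$2) (x$3) (x$5)"
      "{1, 2, 3}" "{4, 5, 6}"])
    (auto simp: L6_6_def bi_lagrangian_simps add_eq_0_iff)

lemma bi_lagrangian_L6_11: "admits_bi_lagrangian L6_11"
  by (rule bi_lagrangianI[OF symplectic_L6_11, of "\<lambda>x. vec6 (x$1 + x$2) (x$4) (x$5) (x$2) (x$3) (x$6)"
      "{1, 2, 3}" "{4, 5, 6}"])
    (auto simp: L6_11_def bi_lagrangian_simps add_eq_0_iff)

lemma bi_lagrangian_L6_12: "admits_bi_lagrangian L6_12"
  by (rule bi_lagrangianI[OF symplectic_L6_12, of "\<lambda>x. vec6 (x$1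
      + x$2) (x$4 - x$3) (x$5) (x$2) (x$3) (x$6)" "{1, 2, 3}" "{4, 5, 6}"])
    (auto simp: L6_12_def bi_lagrangian_simps add_eq_0_iff)

lemma admits_bi_lagrangian_A2: "admits_bi_lagrangian A2"
proof -
  have "symplectic_form A2 (\<alpha> 1 2)"
    unfolding symplectic_form_def
  proof (intro conjI allI impI)
    show "bilinear (\<alpha> 1 2 :: 2 form2)"
      unfolding bilinear_def \<alpha>_def by (intro conjI allI linear_coordinate_intros)
    show "x = 0" if "\<forall>y. \<alpha> 1 2 x y = 0" for x :: "real^2"
      using spec[OF that, of "axis 1 1"] spec[OF that, of "axis 2 1"]
      by (simp add: \<alpha>_def axis_def vec_eq_iff forall_2)
  qed (simp_all add: \<alpha>_def A2_def bracket_of_def)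
  then show ?thesis
    by (rule bi_lagrangianI[of _ _ "\<lambda>x. x" "{1}" "{2}"])
      (auto simp: A2_def bracket_of_def set_eq_iff forall_2 coordinate_subspace_def \<alpha>_def linear_iff)
qed

abbreviation (input) "v1 \<equiv> vec4 1 0 0 0"
abbreviation (input) "v2 \<equiv> vec4 0 1 0 0"
abbreviation (input) "v3 \<equiv> vec4 0 0 1 0"
abbreviation (input) "v4 \<equiv> vec4 0 0 0 1"

lemma symplectic_4I:
  fixes \<omega> :: "4 form2"
  assumes "bilinear \<omega>" "\<And>x. \<omega> x x = 0"
    and "\<And>x y z. \<omega> (B x y) z + \<omega> (B y z) x + \<omega> (B z x) y = 0"
    and "\<And>x. \<omega> x v1 = 0 \<Longrightarrow> \<omega> x v2 = 0 \<Longrightarrow> \<omega> x v3 = 0 \<Longrightarrow> \<omega> x v4 = 0 \<Longrightarrow>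
      x$1 = 0 \<and> x$2 = 0 \<and> x$3 = 0 \<and> x$4 = 0"
  shows "symplectic_form B \<omega>"
  unfolding symplectic_form_def using assms by (auto simp: vec4_eq_iff)

lemma bilinear_14_23: "bilinear (\<lambda>x y. \<alpha> 1 4 x y + \<alpha> 2 3 x y)"
  unfolding bilinear_def \<alpha>_def by (intro conjI allI linear_coordinate_intros)

lemma symplectic_A4: "symplectic_form A4 (\<lambda>x y. \<alpha> 1 4 x y + \<alpha> 2 3 x y)"
  and symplectic_L3_S_A1: "symplectic_form L3_S_A1 (\<lambda>x y. \<alpha> 1 4 x y + \<alpha> 2 3 x y)"
  and symplectic_L4: "symplectic_form L4 (\<lambda>x y. \<alpha> 1 4 x y + \<alpha> 2 3 x y)"
  by (rule symplectic_4I[OF bilinear_14_23];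
      simp add: A4_def L3_S_A1_def L4_def \<alpha>_def algebra_simps)+

lemma admits_bi_lagrangian_A4: "admits_bi_lagrangian A4"
  by (rule bi_lagrangianI[OF symplectic_A4, of "\<lambda>x. x" "{1, 3}" "{2, 4}"])
    (auto simp: A4_def set_eq_iff forall_4 coordinate_subspace_def \<alpha>_def linear_iff)

lemma admits_bi_lagrangian_L3_S_A1: "admits_bi_lagrangian L3_S_A1"
  by (rule bi_lagrangianI[OF symplectic_L3_S_A1, of "\<lambda>x. x" "{1, 3}" "{2, 4}"])
    (auto simp: L3_S_A1_def set_eq_iff forall_4 coordinate_subspace_def \<alpha>_def linear_iff)

section \<open>Obstructions to bi-Lagrangian structures\<close>

definition lagrangian_subalgebra ::
  "('a::real_vector \<Rightarrow> 'a \<Rightarrow> 'a) \<Rightarrow> ('a \<Rightarrow> 'a \<Rightarrow> real) \<Rightarrow> 'a set \<Rightarrow> bool" where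
  "lagrangian_subalgebra B \<omega> K \<longleftrightarrow> lie_subalgebra B K \<and> lagrangian \<omega> K"

lemma independent_insert_functional:
  fixes v :: "'a::real_vector"
  assumes "independent S" "linear h" "h v \<noteq> (0::real)" "\<And>u. u \<in> S \<Longrightarrow> h u = 0"
  shows "independent (insert v S)" "v \<notin> S"
proof -
  have "h u = 0" if "u \<in> span S" for u
    using linear_eq_0_on_span[OF assms(2,4) that] by simp
  then have "v \<notin> span S"
    using assms(3) by blast
  then show "independent (insert v S)" "v \<notin> S"
    using assms(1,3,4) by (auto simp: independent_insert)
qed

lemma no_four_independent:
  fixes K :: "'a::euclidean_space set"
  assumes K: "dim K = 3" and v: "a1 \<in> K" "a2 \<in> K" "a3 \<in> K" "a4 \<in> K"
    and h: "linear h1" "linear h2" "linear h3"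
    and h1: "h1 a1 \<noteq> (0::real)" "h1 a2 = 0" "h1 a3 = 0" "h1 a4 = 0"
    and h2: "h2 a2 \<noteq> (0::real)" "h2 a3 = 0" "h2 a4 = 0"
    and h3: "h3 a3 \<noteq> (0::real)" "h3 a4 = 0" and a4: "a4 \<noteq> 0"
  shows False
proof -
  have 4: "independent {a4}"
    using a4 by (simp add: dependent_single)
  have 3: "independent {a3, a4}" "a3 \<notin> {a4}"
    using independent_insert_functional[OF 4 h(3) h3(1)] h3 by auto
  have 2: "independent {a2, a3, a4}" "a2 \<notin> {a3, a4}"
    using independent_insert_functional[OF 3(1) h(2) h2(1)] h2 by auto
  have 1: "independent {a1, a2, a3, a4}" "a1 \<notin> {a2, a3, a4}"
    using independent_insert_functional[OF 2(1) h(1) h1(1)] h1 by auto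
  have "card {a1, a2, a3, a4} = 4"
    using 1(2) 2(2) 3(2) by simp
  moreover have "card {a1, a2, a3, a4} \<le> dim K"
    using independent_card_le_dim[OF _ 1(1), of K] v by simp
  ultimately show False
    using K by simp
qed

lemma lagrangian_subalgebraD:
  fixes B :: "6 bracket"
  assumes "lagrangian_subalgebra B \<omega> K"
  shows "subspace K" "\<And>x y. x \<in> K \<Longrightarrow> y \<in> K \<Longrightarrow> B x y \<in> K" "\<And>x y. x \<in> K \<Longrightarrow> y \<in> K \<Longrightarrow> \<omega> x y = 0"
    and "dim K = 3"
  using assms by (auto simp: lagrangian_subalgebra_def lie_subalgebra_def lagrangian_def)

lemma lagrangian_common_zero:
  fixes B :: "6 bracket"
  assumes K: "lagrangian_subalgebra B \<omega> K" and h: "linear h1" "linear h2"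
  obtains y where "y \<in> K" "y \<noteq> 0" "h1 y = (0::real)" "h2 y = (0::real)"
proof -
  have "card {h1, h2} \<le> 2"
    by (simp add: card_insert_if)
  then have "\<exists>y\<in>K. y \<noteq> 0 \<and> (\<forall>h\<in>{h1, h2}. h y = 0)"
    using lagrangian_subalgebraD(1,4)[OF K] h by (intro exists_common_zero) auto
  then show thesis
    using that by auto
qed

text \<open>The triangular shape of the values of the three functionals makes \<open>x\<close>, \<open>y\<close>, \<open>[x, y]\<close>, \<open>[x,
  [x, y]]\<close> independent, which is one vector too many.\<close>

lemma no_bracket_chain:
  fixes B :: "6 bracket"
  assumes K: "lagrangian_subalgebra B \<omega> K" and xy: "x \<in> K" "y \<in> K"
    and h: "linear h1" "linear h2" "linear h3"
    and "h1 x \<noteq> (0::real)" "h1 y = 0" "h1 (B x y) = 0" "h1 (B x (B x y)) = 0"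
    and "h2 y \<noteq> (0::real)" "h2 (B x y) = 0" "h2 (B x (B x y)) = 0"
    and "h3 (B x y) \<noteq> (0::real)" "h3 (B x (B x y)) = 0" "B x (B x y) $ i \<noteq> 0"
  shows False
proof -
  have K2: "B x y \<in> K"
    using lagrangian_subalgebraD(2)[OF K] xy by blast
  then have K3: "B x (B x y) \<in> K"
    using lagrangian_subalgebraD(2)[OF K] xy by blast
  have "B x (B x y) \<noteq> 0"
    using assms(16) by auto
  then show False
    using no_four_independent[OF lagrangian_subalgebraD(4)[OF K] xy K2 K3 h] assms(7-15) by blast
qed

lemma admits_bi_lagrangianE:
  assumes "admits_bi_lagrangian (B :: 6 bracket)"
  obtains c12 c13 c14 c15 c16 c23 c24 c25 c26 c34 c35 c36 c45 c46 c56 \<omega> F G where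
    "\<omega> = form6 c12 c13 c14 c15 c16 c23 c24 c25 c26 c34 c35 c36 c45 c46 c56"
    "\<And>x y z. \<omega> (B x y) z + \<omega> (B y z) x + \<omega> (B z x) y = 0"
    "\<And>x. \<forall>y. \<omega> x y = 0 \<Longrightarrow> x = 0"
    "lagrangian_subalgebra B \<omega> F" "lagrangian_subalgebra B \<omega> G" "F \<inter> G = {0}"
    "\<And>x. \<exists>y\<in>F. \<exists>z\<in>G. x = y + z"
proof -
  obtain \<omega> F G where s: "bi_lagrangian_structure B \<omega> F G"
    using assms unfolding admits_bi_lagrangian_def by blast
  then have \<omega>: "symplectic_form B \<omega>"
    by (simp add: bi_lagrangian_structure_def)
  obtain c12 c13 c14 c15 c16 c23 c24 c25 c26 c34 c35 c36 c45 c46 c56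
    where "\<omega> = form6 c12 c13 c14 c15 c16 c23 c24 c25 c26 c34 c35 c36 c45 c46 c56"
    using symplectic_form_expansion[OF \<omega>] by blast
  moreover have "\<And>x y z. \<omega> (B x y) z + \<omega> (B y z) x + \<omega> (B z x) y = 0" "\<And>x. \<forall>y. \<omega> x y = 0 \<Longrightarrow> x = 0"
    using \<omega> unfolding symplectic_form_def by blast+
  moreover have "lagrangian_subalgebra B \<omega> F" "lagrangian_subalgebra B \<omega> G" "F \<inter> G = {0}"
    "\<And>x. \<exists>y\<in>F. \<exists>z\<in>G. x = y + z"
    using s unfolding bi_lagrangian_structure_def lagrangian_subalgebra_def by blast+
  ultimately show thesis
    by (rule that)
qed

lemma complement_component:
  fixes F G :: "(real^'n) set"
  assumes "\<And>x. \<exists>y\<in>F. \<exists>z\<in>G. x = y + z"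
  obtains x where "x \<in> F \<or> x \<in> G" "x $ i \<noteq> 0"
proof -
  obtain y z where yz: "y \<in> F" "z \<in> G" "axis i 1 = y + z"
    using assms by blast
  then have "y $ i + z $ i = 1"
    by (metis axis_nth vector_add_component)
  then have "y $ i \<noteq> 0 \<or> z $ i \<noteq> 0"
    by auto
  then show thesis
    using that yz(1,2) by blast
qed

lemma complement_commute:
  assumes "\<And>x. \<exists>y\<in>F. \<exists>z\<in>G. x = y + (z :: 'a::ab_semigroup_add)"
  shows "\<exists>y\<in>G. \<exists>z\<in>F. x = y + z"
proof -
  obtain y z where "y \<in> F" "z \<in> G" "x = z + y"
    using assms[of x] by (auto simp: add.commute)
  then show ?thesis
    by blast
qed

lemma vec6_last_mem:
  assumes "subspace K" "v \<in> K" "v = vec6 0 0 0 0 0 c" "c \<noteq> 0"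
  shows "u6 \<in> K"
proof -
  have "u6 = (1 / c) *\<^sub>R v"
    using assms(3,4) by (simp add: vec6_eq_iff)
  then show ?thesis
    using assms(1,2) by (simp add: subspace_scale)
qed

text \<open>The algebras \<open>L6_18\<close>, \<open>L6_19\<close>, \<open>L6_21\<close>. Let \<open>x\<close> in the Lagrangian subalgebra have \<open>x$1 \<noteq>
  0\<close>. The chain condition shows successively that the second, third and fourth coordinate of a \<open>y\<close>
  in the subalgebra with \<open>y$1 = 0\<close> vanish. Dimension three then leaves a multiple of the last
  basis vector, which is not orthogonal to \<open>x\<close>.\<close>

lemma no_bi_lagrangian_filiform:
  fixes p q r :: real
  defines "B \<equiv> lie6 (\<alpha> 1 2) (\<alpha> 1 3) (\<lambda>x y. \<alpha> 1 4 x y + p * \<alpha> 2 3 x y)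
    (\<lambda>x y. \<alpha> 1 5 x y + q * \<alpha> 2 3 x y + r * \<alpha> 2 4 x y)"
  shows "\<not> admits_bi_lagrangian B"
proof
  assume "admits_bi_lagrangian B"
  then obtain w12 w13 w14 w15 w16 w23 w24 w25 w26 w34 w35 w36 w45 w46 w56 \<omega> F G
    where w: "\<omega> = form6 w12 w13 w14 w15 w16 w23 w24 w25 w26 w34 w35 w36 w45 w46 w56"
    and closed: "\<And>x y z. \<omega> (B x y) z + \<omega> (B y z) x + \<omega> (B z x) y = 0"
    and nondeg: "\<And>x. \<forall>y. \<omega> x y = 0 \<Longrightarrow> x = 0"
    and FG: "lagrangian_subalgebra B \<omega> F" "lagrangian_subalgebra B \<omega> G" "F \<inter> G = {0}"
    and complement: "\<And>x. \<exists>y\<in>F. \<exists>z\<in>G. x = y + z"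
    by (rule admits_bi_lagrangianE) (rule that)
  note q126 = closed[of u1 u2 u6, unfolded w B_def]
  note q136 = closed[of u1 u3 u6, unfolded w B_def]
  note q146 = closed[of u1 u4 u6, unfolded w B_def]
  note q134 = closed[of u1 u3 u4, unfolded w B_def]
  note q125 = closed[of u1 u2 u5, unfolded w B_def]
  have z0: "w36 = 0" "w46 = 0"
    using q126 q136 by (simp_all add: form6_simps)
  have z1: "w56 = 0"
    using q146 z0 by (simp_all add: form6_simps)
  have z2: "w35 = 0"
    using q134 z0 z1 by (simp_all add: form6_simps)
  have z3: "w26 = 0"
    using q125 z0 z1 z2 by (simp_all add: form6_simps)
  have w16: "w16 \<noteq> 0"
    using form6_last_coefficients[OF nondeg[unfolded w]] z0 z1 z3 by blast
  have False if K: "lagrangian_subalgebra B \<omega> K" and x: "x \<in> K" "x$1 \<noteq> 0" for K x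
  proof -
    note K' = lagrangian_subalgebraD[OF K]
    have y2: "y$2 = 0" if "y \<in> K" "y$1 = 0" for y
    proof (rule ccontr)
      assume "y$2 \<noteq> 0"
      then show False
        using no_bracket_chain[OF K x(1) that(1) linear_vec_component[of 1] linear_vec_component[of 2]
            linear_vec_component[of 3], of 4] x(2) that(2-)
        by (simp add: B_def form_simps)
    qed
    have y3: "y$3 = 0" if "y \<in> K" "y$1 = 0" "y$2 = 0" for y
    proof (rule ccontr)
      assume "y$3 \<noteq> 0"
      then show False
        using no_bracket_chain[OF K x(1) that(1) linear_vec_component[of 1] linear_vec_component[of 3]
            linear_vec_component[of 4], of 5] x(2) that(2-)
        by (simp add: B_def form_simps)
    qed
    have y4: "y$4 = 0" if "y \<in> K" "y$1 = 0" "y$2 = 0" "y$3 = 0" for y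
    proof (rule ccontr)
      assume "y$4 \<noteq> 0"
      then show False
        using no_bracket_chain[OF K x(1) that(1) linear_vec_component[of 1] linear_vec_component[of 4]
            linear_vec_component[of 5], of 6] x(2) that(2-)
        by (simp add: B_def form_simps)
    qed
    obtain y where y: "y \<in> K" "y \<noteq> 0" "y$1 = 0" "y$5 = 0"
      by (rule lagrangian_common_zero[OF K linear_vec_component[of 1] linear_vec_component[of 5]])
    have "y$2 = 0" "y$3 = 0" "y$4 = 0"
      using y2[OF y(1,3)] y3[OF y(1,3)] y4[OF y(1,3)] by simp_all
    moreover from this have "y$6 \<noteq> 0"
      using y(2-4) by (simp add: vec6_eq_iff)
    ultimately show False
      using K'(3)[OF x(1) y(1)] y(3,4) x(2) w16 z0 z1 z3 by (simp add: w form6_simps)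
  qed
  moreover obtain x where "x \<in> F \<or> x \<in> G" "x$1 \<noteq> 0"
    by (rule complement_component[OF complement])
  ultimately show False
    using FG(1,2) by blast
qed

lemma no_bi_lagrangian_L6_18: "\<not> admits_bi_lagrangian L6_18"
proof -
  have "L6_18 = lie6 (\<alpha> 1 2) (\<alpha> 1 3) (\<lambda>x y. \<alpha> 1 4 x y + 0 * \<alpha> 2 3 x y)
      (\<lambda>x y. \<alpha> 1 5 x y + 0 * \<alpha> 2 3 x y + 0 * \<alpha> 2 4 x y)"
    by (simp add: L6_18_def plus_fun_def)
  then show ?thesis
    using no_bi_lagrangian_filiform[of 0 0 0] by simp
qed

lemma no_bi_lagrangian_L6_19: "\<not> admits_bi_lagrangian L6_19"
proof -
  have "L6_19 = lie6 (\<alpha> 1 2) (\<alpha> 1 3) (\<lambda>x y. \<alpha> 1 4 x y + 0 * \<alpha> 2 3 x y)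
      (\<lambda>x y. \<alpha> 1 5 x y + 1 * \<alpha> 2 3 x y + 0 * \<alpha> 2 4 x y)"
    by (simp add: L6_19_def plus_fun_def)
  then show ?thesis
    using no_bi_lagrangian_filiform[of 0 1 0] by simp
qed

lemma no_bi_lagrangian_L6_21: "\<not> admits_bi_lagrangian L6_21"
proof -
  have "L6_21 = lie6 (\<alpha> 1 2) (\<alpha> 1 3) (\<lambda>x y. \<alpha> 1 4 x y + 1 * \<alpha> 2 3 x y)
      (\<lambda>x y. \<alpha> 1 5 x y + 0 * \<alpha> 2 3 x y + 1 * \<alpha> 2 4 x y)"
    by (simp add: L6_21_def plus_fun_def)
  then show ?thesis
    using no_bi_lagrangian_filiform[of 1 0 1] by simp
qed

text \<open>For \<open>y\<close> with \<open>y$1 = 0\<close> the chain condition gives \<open>y$2 = 0\<close>, and orthogonality of \<open>x\<close> and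
  \<open>[x, y]\<close> gives \<open>y$5 = 0\<close>. In the remaining coordinates, orthogonality to \<open>x\<close> prevents \<open>y$3\<close> and
  \<open>y$4\<close> from vanishing together; but then the element with \<open>y$3 = 0\<close> and the one with \<open>z$4 = 0\<close>
  are not orthogonal to each other.\<close>

lemma no_bi_lagrangian_L4_S_A2: "\<not> admits_bi_lagrangian L4_S_A2"
proof
  assume "admits_bi_lagrangian L4_S_A2"
  then obtain w12 w13 w14 w15 w16 w23 w24 w25 w26 w34 w35 w36 w45 w46 w56 \<omega> F G
    where w: "\<omega> = form6 w12 w13 w14 w15 w16 w23 w24 w25 w26 w34 w35 w36 w45 w46 w56"
    and closed: "\<And>x y z. \<omega> (L4_S_A2 x y) z + \<omega> (L4_S_A2 y z) x + \<omega> (L4_S_A2 z x) y = 0"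
    and nondeg: "\<And>x. \<forall>y. \<omega> x y = 0 \<Longrightarrow> x = 0"
    and FG: "lagrangian_subalgebra L4_S_A2 \<omega> F" "lagrangian_subalgebra L4_S_A2 \<omega> G" "F \<inter> G = {0}"
    and complement: "\<And>x. \<exists>y\<in>F. \<exists>z\<in>G. x = y + z"
    by (rule admits_bi_lagrangianE) (rule that)
  note q126 = closed[of u1 u2 u6, unfolded w L4_S_A2_def]
  note q123 = closed[of u1 u2 u3, unfolded w L4_S_A2_def]
  note q124 = closed[of u1 u2 u4, unfolded w L4_S_A2_def]
  note q135 = closed[of u1 u3 u5, unfolded w L4_S_A2_def]
  note q145 = closed[of u1 u4 u5, unfolded w L4_S_A2_def]
  note q125 = closed[of u1 u2 u5, unfolded w L4_S_A2_def]
  have z0: "w56 = 0"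
    using q126 by (simp_all add: form6_simps)
  have z1: "w35 = 0" "w45 = 0"
    using q123 q124 z0 by (simp_all add: form6_simps)
  have z2: "w36 = 0" "w46 = 0" "w26 = 0"
    using q135 q145 q125 z0 z1 by (simp_all add: form6_simps)
  have w16: "w16 \<noteq> 0"
    using form6_last_coefficients[OF nondeg[unfolded w]] z0 z2 by blast
  have w34: "w34 \<noteq> 0"
    using form6_no_isotropic_tail[OF nondeg[unfolded w]] z0 z1 z2 by blast
  have False if K: "lagrangian_subalgebra L4_S_A2 \<omega> K" and x: "x \<in> K" "x$1 \<noteq> 0" for K x
  proof -
    note K' = lagrangian_subalgebraD[OF K]
    have y2: "y$2 = 0" if "y \<in> K" "y$1 = 0" for y
    proof (rule ccontr)
      assume "y$2 \<noteq> 0"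
      then show False
        using no_bracket_chain[OF K x(1) that(1) linear_vec_component[of 1] linear_vec_component[of 2]
            linear_vec_component[of 5], of 6] x(2) that(2-)
        by (simp add: L4_S_A2_def form_simps)
    qed
    have y5: "y$5 = 0" if y: "y \<in> K" "y$1 = 0" for y
      using K'(3)[OF x(1) K'(2)[OF x(1) y(1)]] y2[OF y] y(2) x(2) w16 z0 z2
      by (simp add: w form6_simps L4_S_A2_def)
    have tail: "y$3 = 0 \<Longrightarrow> y$4 \<noteq> 0" "y$4 = 0 \<Longrightarrow> y$3 \<noteq> 0" if y: "y \<in> K" "y \<noteq> 0" "y$1 = 0" for y
      using K'(3)[OF x(1) y(1)] y2[OF y(1,3)] y5[OF y(1,3)] y(2,3) x(2) w16 z0 z2
      by (auto simp: w form6_simps vec6_eq_iff)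
    obtain y where y: "y \<in> K" "y \<noteq> 0" "y$1 = 0" "y$3 = 0"
      by (rule lagrangian_common_zero[OF K linear_vec_component[of 1] linear_vec_component[of 3]])
    obtain z where z: "z \<in> K" "z \<noteq> 0" "z$1 = 0" "z$4 = 0"
      by (rule lagrangian_common_zero[OF K linear_vec_component[of 1] linear_vec_component[of 4]])
    show False
      using K'(3)[OF z(1) y(1)] tail(1)[OF y(1-3) y(4)] tail(2)[OF z(1-3) z(4)]
        y2[OF y(1,3)] y2[OF z(1,3)] y5[OF y(1,3)] y5[OF z(1,3)] y(3,4) z(3,4) w34 z2
      by (simp add: w form6_simps)
  qed
  moreover obtain x where "x \<in> F \<or> x \<in> G" "x$1 \<noteq> 0"
    by (rule complement_component[OF complement])
  ultimately show False
    using FG(1,2) by blast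
qed

text \<open>Two chains, the second one measured by the functional \<open>x$1 * y$4 + x$2 * y$3\<close>, and
  orthogonality of \<open>x\<close> and \<open>[x, y]\<close> again leave a multiple of the last basis vector, which is not
  orthogonal to \<open>x\<close>.\<close>

lemma no_bi_lagrangian_L6_15: "\<not> admits_bi_lagrangian L6_15"
proof
  assume "admits_bi_lagrangian L6_15"
  then obtain w12 w13 w14 w15 w16 w23 w24 w25 w26 w34 w35 w36 w45 w46 w56 \<omega> F G
    where w: "\<omega> = form6 w12 w13 w14 w15 w16 w23 w24 w25 w26 w34 w35 w36 w45 w46 w56"
    and closed: "\<And>x y z. \<omega> (L6_15 x y) z + \<omega> (L6_15 y z) x + \<omega> (L6_15 z x) y = 0"
    and nondeg: "\<And>x. \<forall>y. \<omega> x y = 0 \<Longrightarrow> x = 0"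
    and FG: "lagrangian_subalgebra L6_15 \<omega> F" "lagrangian_subalgebra L6_15 \<omega> G" "F \<inter> G = {0}"
    and complement: "\<And>x. \<exists>y\<in>F. \<exists>z\<in>G. x = y + z"
    by (rule admits_bi_lagrangianE) (rule that)
  note q126 = closed[of u1 u2 u6, unfolded w L6_15_def]
  note q146 = closed[of u1 u4 u6, unfolded w L6_15_def]
  note q135 = closed[of u1 u3 u5, unfolded w L6_15_def]
  have z0: "w46 = 0"
    using q126 by (simp_all add: form6_simps)
  have z1: "w56 = 0"
    using q146 z0 by (simp_all add: form6_simps)
  have z2: "w36 = 0"
    using q135 z0 z1 by (simp_all add: form6_simps)
  note q125 = closed[of u1 u2 u5, unfolded w L6_15_def]
  note q234 = closed[of u2 u3 u4, unfolded w L6_15_def]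
  have z3: "w26 = 0"
    using q125 q234 by (simp add: form6_simps)
  have w16: "w16 \<noteq> 0"
    using form6_last_coefficients[OF nondeg[unfolded w]] z0 z1 z2 z3 by blast
  have False if K: "lagrangian_subalgebra L6_15 \<omega> K" and x: "x \<in> K" "x$1 \<noteq> 0" for K x
  proof -
    note K' = lagrangian_subalgebraD[OF K]
    have y2: "y$2 = 0" if "y \<in> K" "y$1 = 0" for y
    proof (rule ccontr)
      assume "y$2 \<noteq> 0"
      then show False
        using no_bracket_chain[OF K x(1) that(1) linear_vec_component[of 1] linear_vec_component[of 2]
            linear_vec_component[of 4], of 5] x(2) that(2-)
        by (simp add: L6_15_def form_simps)
    qed
    have t: "x$1 * y$4 + x$2 * y$3 = 0" if y: "y \<in> K" "y$1 = 0" for y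
    proof (rule ccontr)
      let ?h = "\<lambda>v::real^6. x$1 * v$4 + x$2 * v$3"
      assume nz: "?h y \<noteq> 0"
      have h: "linear ?h"
        by (intro linear_coordinate_intros)
      have "L6_15 x (L6_15 x y) $ 6 = x$1 * ?h y" "L6_15 x y $ 5 = - ?h y"
        using y2[OF y] y(2) by (simp_all add: L6_15_def form_simps algebra_simps)
      then show False
        using no_bracket_chain[OF K x(1) y(1) linear_vec_component[of 1] h linear_vec_component[of 5], of 6]
          x(2) y(2) y2[OF y] nz by (simp add: L6_15_def form_simps)
    qed
    have y5: "y$5 = 0" if y: "y \<in> K" "y$1 = 0" "y$3 = 0" for y
      using K'(3)[OF x(1) K'(2)[OF x(1) y(1)]] y2[OF y(1,2)] t[OF y(1,2)] y(2,3) x(2) w16 z0 z1 z2 z3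
      by (simp add: w form6_simps L6_15_def)
    obtain y where y: "y \<in> K" "y \<noteq> 0" "y$1 = 0" "y$3 = 0"
      by (rule lagrangian_common_zero[OF K linear_vec_component[of 1] linear_vec_component[of 3]])
    have "y$2 = 0" "y$4 = 0" "y$5 = 0"
      using y2[OF y(1,3)] t[OF y(1,3)] y5[OF y(1,3,4)] y(4) x(2) by simp_all
    moreover from this have "y$6 \<noteq> 0"
      using y(2-4) by (simp add: vec6_eq_iff)
    ultimately show False
      using K'(3)[OF x(1) y(1)] y(3,4) x(2) w16 z0 z1 z2 z3 by (simp add: w form6_simps)
  qed
  moreover obtain x where "x \<in> F \<or> x \<in> G" "x$1 \<noteq> 0"
    by (rule complement_component[OF complement])
  ultimately show False
    using FG(1,2) by blast
qed

text \<open>The algebras \<open>L6_13\<close>, \<open>L6_14\<close>, \<open>L5_6_S_A1\<close>. A Lagrangian subalgebra that contains an \<open>x\<close>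
  with \<open>x$1 \<noteq> 0\<close> contains the last basis vector, so this holds for one of the two only, say \<open>F\<close>.
  Then \<open>G\<close> lies in the hyperplane of first coordinate zero and contains a \<open>g\<close> with \<open>g$2 = 1\<close>;
  bracketing with \<open>g\<close> produces multiples of the last basis vector, which must be zero, and this is
  a linear relation on \<open>G\<close>. For \<open>p \<noteq> 0\<close> it yields two elements of \<open>G\<close> whose orthogonality,
  together with that of \<open>x\<close> and the last basis vector, makes the form degenerate. For \<open>p = 0\<close> the
  planes of \<open>F\<close> and \<open>G\<close> on which the first two coordinates vanish both lie in the span of the
  third, fifth and sixth basis vector, so they intersect.\<close>

lemma no_bi_lagrangian_central_family:
  fixes p q :: real
  defines "B \<equiv> lie6 0 (\<alpha> 1 2) (\<alpha> 1 4) (\<lambda>x y. \<alpha> 1 5 x y + p * \<alpha> 2 3 x y + q * \<alpha> 2 4 x y)"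
  assumes pq: "p \<noteq> 0 \<or> q \<noteq> 0"
  shows "\<not> admits_bi_lagrangian B"
proof
  assume "admits_bi_lagrangian B"
  then obtain w12 w13 w14 w15 w16 w23 w24 w25 w26 w34 w35 w36 w45 w46 w56 \<omega> F G
    where w: "\<omega> = form6 w12 w13 w14 w15 w16 w23 w24 w25 w26 w34 w35 w36 w45 w46 w56"
    and closed: "\<And>x y z. \<omega> (B x y) z + \<omega> (B y z) x + \<omega> (B z x) y = 0"
    and nondeg: "\<And>x. \<forall>y. \<omega> x y = 0 \<Longrightarrow> x = 0"
    and FG: "lagrangian_subalgebra B \<omega> F" "lagrangian_subalgebra B \<omega> G" "F \<inter> G = {0}"
    and complement: "\<And>x. \<exists>y\<in>F. \<exists>z\<in>G. x = y + z"
    by (rule admits_bi_lagrangianE) (rule that)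
  note q126 = closed[of u1 u2 u6, unfolded w B_def]
  note q146 = closed[of u1 u4 u6, unfolded w B_def]
  note q135 = closed[of u1 u3 u5, unfolded w B_def]
  note q134 = closed[of u1 u3 u4, unfolded w B_def]
  have z0: "w46 = 0"
    using q126 by (simp_all add: form6_simps)
  have z1: "w56 = 0"
    using q146 z0 by (simp_all add: form6_simps)
  have z2: "w36 = 0"
    using q135 z0 z1 by (simp_all add: form6_simps)
  have z3: "w35 = 0"
    using q134 z0 z1 z2 by (simp_all add: form6_simps)
  have w45: "w45 = - w26"
    using closed[of u1 u2 u5, unfolded w B_def] z0 z1 z2 by (simp add: form6_simps)
  have tail: "y$2 = 0" "y$4 = 0"
    if K: "lagrangian_subalgebra B \<omega> K" and x: "x \<in> K" "x$1 \<noteq> 0" and y: "y \<in> K" "y$1 = 0" for K x y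
  proof -
    show y2: "y$2 = 0"
    proof (rule ccontr)
      assume "y$2 \<noteq> 0"
      then show False
        using no_bracket_chain[OF K x(1) y(1) linear_vec_component[of 1] linear_vec_component[of 2]
            linear_vec_component[of 4], of 5] x(2) y(2) by (simp add: B_def form_simps)
    qed
    show "y$4 = 0"
    proof (rule ccontr)
      assume "y$4 \<noteq> 0"
      then show False
        using no_bracket_chain[OF K x(1) y(1) linear_vec_component[of 1] linear_vec_component[of 4]
            linear_vec_component[of 5], of 6] x(2) y(2) y2 by (simp add: B_def form_simps)
    qed
  qed
  have centre: "u6 \<in> K" if K: "lagrangian_subalgebra B \<omega> K" and x: "x \<in> K" "x$1 \<noteq> 0" for K x
  proof -
    note K' = lagrangian_subalgebraD[OF K]
    obtain y where y: "y \<in> K" "y \<noteq> 0" "y$1 = 0" "y$3 = 0"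
      by (rule lagrangian_common_zero[OF K linear_vec_component[of 1] linear_vec_component[of 3]])
    note t = tail[OF K x y(1,3)]
    show ?thesis
    proof (cases "y$5 = 0")
      case True
      then show ?thesis
        using vec6_last_mem[OF K'(1) y(1), of "y$6"] t y(2-4) by (simp add: vec6_eq_iff)
    next
      case False
      have "B x y = vec6 0 0 0 0 0 (- (x$1 * y$5))"
        using t y(3,4) by (simp add: vec6_eq_iff B_def form_simps)
      then show ?thesis
        using vec6_last_mem[OF K'(1) K'(2)[OF x(1) y(1)], of "- (x$1 * y$5)"] x(2) False by simp
    qed
  qed
  have False
    if F: "lagrangian_subalgebra B \<omega> F" and G: "lagrangian_subalgebra B \<omega> G"
      and FG: "F \<inter> G = {0}" and complement: "\<And>x. \<exists>y\<in>F. \<exists>z\<in>G. x = y + z"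
      and x: "x \<in> F" "x$1 \<noteq> 0" for F G x
  proof -
    note F' = lagrangian_subalgebraD[OF F] and G' = lagrangian_subalgebraD[OF G]
    have u6F: "u6 \<in> F"
      by (rule centre[OF F x])
    have "u6 \<noteq> 0"
      by (simp add: vec6_eq_iff)
    then have u6G: "u6 \<notin> G"
      using u6F FG by blast
    have G1: "g$1 = 0" if "g \<in> G" for g
      using centre[OF G that] u6G by blast
    obtain f g where fg: "f \<in> F" "g \<in> G" "u2 = f + g"
      using complement by blast
    have "f$1 = 0"
      using G1[OF fg(2)] arg_cong[OF fg(3), of "\<lambda>v. v$1"] by simp
    then have g2: "g$2 = 1"
      using tail(1)[OF F x fg(1)] arg_cong[OF fg(3), of "\<lambda>v. v$2"] by simp
    have rel: "p * z$3 + q * z$4 = 0" if z: "z \<in> G" "z$2 = 0" for z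
    proof -
      have "B g z = vec6 0 0 0 0 0 (- (p * z$3 + q * z$4))"
        using G1[OF fg(2)] G1[OF z(1)] z(2) g2 by (simp add: vec6_eq_iff B_def form_simps)
      then have "- (p * z$3 + q * z$4) = 0"
        using vec6_last_mem[OF G'(1) G'(2)[OF fg(2) z(1)]] u6G by blast
      then show ?thesis
        by (simp only: neg_equal_0_iff_equal)
    qed
    show False
    proof (cases "p = 0")
      case True
      then have z40: "z$4 = 0" if z: "z \<in> G" "z$2 = 0" for z
        using rel[OF z] pq by simp
      obtain f where f: "f \<in> F" "f \<noteq> 0" "f$1 = 0" "f$6 = 0"
        by (rule lagrangian_common_zero[OF F linear_vec_component[of 1] linear_vec_component[of 6]])
      note f24 = tail[OF F x f(1,3)]
      have "linear (\<lambda>v::real^6. f$5 * v$3 - f$3 * v$5)"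
        by (intro linear_coordinate_intros)
      then obtain z where z: "z \<in> G" "z \<noteq> 0" "z$2 = 0" "f$5 * z$3 - f$3 * z$5 = 0"
        by (rule lagrangian_common_zero[OF G linear_vec_component[of 2]])
      define c where "c = (if f$3 = 0 then z$5 / f$5 else z$3 / f$3)"
      have "f$3 \<noteq> 0 \<or> f$5 \<noteq> 0"
        using f(2-4) f24 by (auto simp: vec6_eq_iff)
      then have "z$3 = c * f$3" "z$5 = c * f$5"
        using z(4) by (auto simp: c_def field_simps)
      then have "z = c *\<^sub>R f + (z$6) *\<^sub>R u6"
        using f(3,4) f24 z40[OF z(1,3)] G1[OF z(1)] z(3) by (simp add: vec6_eq_iff)
      also have "\<dots> \<in> F"
        using F'(1) f(1) u6F by (intro subspace_add subspace_scale)
      finally show False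
        using z(1,2) FG by blast
    next
      case p: False
      obtain y where y: "y \<in> G" "y \<noteq> 0" "y$2 = 0" "y$4 = 0"
        by (rule lagrangian_common_zero[OF G linear_vec_component[of 2] linear_vec_component[of 4]])
      obtain z where z: "z \<in> G" "z \<noteq> 0" "z$2 = 0" "z$5 = 0"
        by (rule lagrangian_common_zero[OF G linear_vec_component[of 2] linear_vec_component[of 5]])
      have y3: "y$1 = 0" "y$3 = 0" and zr: "z$1 = 0" "p * z$3 = - (q * z$4)"
        using G1[OF y(1)] G1[OF z(1)] rel[OF y(1,3)] rel[OF z(1,3)] y(4) p by (simp_all add:
            eq_neg_iff_add_eq_0)
      have y5: "y$5 \<noteq> 0"
      proof
        assume "y$5 = 0"
        then have "y = vec6 0 0 0 0 0 (y$6)" "y$6 \<noteq> 0"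
          using y(2-4) y3 by (auto simp: vec6_eq_iff)
        then show False
          using vec6_last_mem[OF G'(1) y(1)] u6G by blast
      qed
      have z4: "z$4 \<noteq> 0"
      proof
        assume "z$4 = 0"
        then have "z = vec6 0 0 0 0 0 (z$6)" "z$6 \<noteq> 0"
          using z(2-4) zr p by (auto simp: vec6_eq_iff)
        then show False
          using vec6_last_mem[OF G'(1) z(1)] u6G by blast
      qed
      have "w45 = 0"
        using G'(3)[OF z(1) y(1)] y(3,4) z(3,4) y3 zr y5 z4 z0 z1 z2 z3 by (simp add: w form6_simps)
      then have "w26 = 0"
        using w45 by simp
      moreover from this have "w16 = 0"
        using F'(3)[OF x(1) u6F] x(2) z0 z1 z2 z3 by (simp add: w form6_simps)
      ultimately show False
        using form6_last_coefficients[OF nondeg[unfolded w]] z0 z1 z2 z3 by blast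
    qed
  qed
  note no = this
  obtain x where "x \<in> F \<or> x \<in> G" "x$1 \<noteq> 0"
    by (rule complement_component[OF complement])
  then show False
    using no[OF FG complement] no[OF FG(2,1) _ complement_commute[OF complement]] FG(3)
    by (auto simp: Int_commute)
qed

lemma no_bi_lagrangian_L6_13: "\<not> admits_bi_lagrangian L6_13"
proof -
  have "L6_13 = lie6 0 (\<alpha> 1 2) (\<alpha> 1 4) (\<lambda>x y. \<alpha> 1 5 x y + 1 * \<alpha> 2 3 x y + 0 * \<alpha> 2 4 x y)"
    by (simp add: L6_13_def plus_fun_def)
  then show ?thesis
    using no_bi_lagrangian_central_family[of 1 0] by simp
qed

lemma no_bi_lagrangian_L6_14: "\<not> admits_bi_lagrangian L6_14"
proof -
  have "L6_14 = lie6 0 (\<alpha> 1 2) (\<alpha> 1 4) (\<lambda>x y. \<alpha> 1 5 x y + 1 * \<alpha> 2 3 x y + 1 * \<alpha> 2 4 x y)"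
    by (simp add: L6_14_def plus_fun_def)
  then show ?thesis
    using no_bi_lagrangian_central_family[of 1 1] by simp
qed

lemma no_bi_lagrangian_L5_6_S_A1: "\<not> admits_bi_lagrangian L5_6_S_A1"
proof -
  have "L5_6_S_A1 = lie6 0 (\<alpha> 1 2) (\<alpha> 1 4) (\<lambda>x y. \<alpha> 1 5 x y + 0 * \<alpha> 2 3 x y + 1 * \<alpha> 2 4 x y)"
    by (simp add: L5_6_S_A1_def plus_fun_def)
  then show ?thesis
    using no_bi_lagrangian_central_family[of 0 1] by simp
qed

text \<open>The algebras \<open>L6_17_plus\<close> (\<open>s = 1\<close>) and \<open>L6_17_minus\<close> (\<open>s = - 1\<close>). A Lagrangian subalgebra
  has parallel projections to the first two coordinates, so \<open>F\<close> and \<open>G\<close> project to two different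
  lines. Splitting the third basis vector then produces, in one of them, a vector with first
  coordinates \<open>0, 0\<close> and nonzero third coordinate. The chain condition makes the projection of
  that subalgebra isotropic for \<open>X\<^sup>2 + s Y\<^sup>2\<close>, which is impossible for \<open>s = 1\<close>. For \<open>s = - 1\<close> the
  orthogonality relations in both subalgebras are linear equations for \<open>w16\<close> and \<open>w26\<close> with only
  the trivial solution, and the form is degenerate.\<close>

lemma no_bi_lagrangian_17:
  fixes s :: real
  defines "B \<equiv> lie6 (\<alpha> 1 2) (\<alpha> 1 3) (\<alpha> 2 3) (\<lambda>x y. \<alpha> 1 4 x y + s * \<alpha> 2 5 x y)"
  assumes s: "s = 1 \<or> s = - 1"
  shows "\<not> admits_bi_lagrangian B"
proof
  assume "admits_bi_lagrangian B"
  then obtain w12 w13 w14 w15 w16 w23 w24 w25 w26 w34 w35 w36 w45 w46 w56 \<omega> F G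
    where w: "\<omega> = form6 w12 w13 w14 w15 w16 w23 w24 w25 w26 w34 w35 w36 w45 w46 w56"
    and closed: "\<And>x y z. \<omega> (B x y) z + \<omega> (B y z) x + \<omega> (B z x) y = 0"
    and nondeg: "\<And>x. \<forall>y. \<omega> x y = 0 \<Longrightarrow> x = 0"
    and FG: "lagrangian_subalgebra B \<omega> F" "lagrangian_subalgebra B \<omega> G" "F \<inter> G = {0}"
    and complement: "\<And>x. \<exists>y\<in>F. \<exists>z\<in>G. x = y + z"
    by (rule admits_bi_lagrangianE) (rule that)
  have s0: "s \<noteq> 0"
    using s by auto
  have z0: "w36 = 0" "w46 = 0" "w56 = 0"
    using closed[of u1 u2 u6] closed[of u1 u3 u6] closed[of u2 u3 u6] by (simp_all add: w B_def form6_simps)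
  have z1: "w45 = 0"
    using closed[of u1 u3 u5] z0 by (simp add: w B_def form6_simps)
  have w34: "w34 = - w26"
    using closed[of u1 u2 u4] z0 by (simp add: w B_def form6_simps)
  have w35: "w35 = s * w16"
    using closed[of u1 u2 u5] z0 by (simp add: w B_def form6_simps mult.commute)
  have w1626: "w16 \<noteq> 0 \<or> w26 \<noteq> 0"
    using form6_last_coefficients[OF nondeg[unfolded w]] z0 by blast
  \<comment> \<open>Otherwise \<open>u\<close>, \<open>v\<close>, \<open>[u, v]\<close>, \<open>[u, [u, v]]\<close> form a chain.\<close>
  have parallel: "u$1 * v$2 - u$2 * v$1 = 0"
    if K: "lagrangian_subalgebra B \<omega> K" and uv: "u \<in> K" "v \<in> K" for K u v
  proof (rule ccontr)
    let ?h1 = "\<lambda>c::real^6. c$1 * v$2 - c$2 * v$1" and ?h2 = "\<lambda>c::real^6. u$1 * c$2 - u$2 * c$1"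
    assume D: "u$1 * v$2 - u$2 * v$1 \<noteq> 0"
    have h: "linear ?h1" "linear ?h2"
      by (intro linear_coordinate_intros)+
    have c: "B u v $ 1 = 0" "B u v $ 2 = 0" "B u v $ 3 \<noteq> 0" "B u (B u v) $ 1 = 0" "B u (B u v) $ 2 = 0"
      "B u (B u v) $ 3 = 0" and c4: "B u (B u v) $ 4 = - (u$1 * B u v $ 3)"
          "B u (B u v) $ 5 = - (u$2 * B u v $ 3)"
      using D by (simp_all add: B_def form_simps algebra_simps)
    have "u$1 \<noteq> 0 \<or> u$2 \<noteq> 0"
      using D by auto
    then have "B u (B u v) $ 4 \<noteq> 0 \<or> B u (B u v) $ 5 \<noteq> 0"
      unfolding c4 using c(3) by simp
    then obtain i where i: "B u (B u v) $ i \<noteq> 0"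
      by blast
    show False
      by (rule no_bracket_chain[OF K uv h linear_vec_component[of 3] _ _ _ _ _ _ _ _ _ i])
        (use D c in simp_all)
  qed
  \<comment> \<open>The last coordinate of \<open>[x, [x, v]]\<close> is the value of the quadratic form, times \<open>v$3\<close>.\<close>
  have isotropic: "x$1 * x$1 + s * (x$2 * x$2) = 0"
    if K: "lagrangian_subalgebra B \<omega> K" and x: "x \<in> K" "x$1 \<noteq> 0 \<or> x$2 \<noteq> 0"
      and v: "v \<in> K" "v$1 = 0" "v$2 = 0" "v$3 \<noteq> 0" for K x v
  proof (rule ccontr)
    let ?h1 = "\<lambda>c::real^6. x$1 * c$1 + x$2 * c$2" and ?h3 = "\<lambda>c::real^6. x$1 * c$4 + x$2 * c$5"
    assume q: "x$1 * x$1 + s * (x$2 * x$2) \<noteq> 0"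
    have h: "linear ?h1" "linear ?h3"
      by (intro linear_coordinate_intros)+
    have p: "x$1 * x$1 + x$2 * x$2 \<noteq> 0"
      using x(2) by (simp add: sum_squares_eq_zero_iff)
    have c: "B x v $ 1 = 0" "B x v $ 2 = 0" "B x v $ 3 = 0" "B x v $ 4 = - (x$1 * v$3)"
        "B x v $ 5 = - (x$2 * v$3)"
      using v(2,3) by (simp_all add: B_def form_simps)
    have c': "B x (B x v) $ 1 = 0" "B x (B x v) $ 2 = 0" "B x (B x v) $ 3 = 0" "B x (B x v) $ 4 = 0"
      "B x (B x v) $ 5 = 0" "B x (B x v) $ 6 = - (x$1 * B x v $ 4 + s * (x$2 * B x v $ 5))"
      using c(1-3) by (simp_all add: B_def form_simps)
    have "B x (B x v) $ 6 = v$3 * (x$1 * x$1 + s * (x$2 * x$2))"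
      unfolding c'(6) c by (simp add: algebra_simps)
    then have i: "B x (B x v) $ 6 \<noteq> 0"
      using v(4) q by simp
    have "?h3 (B x v) = - (v$3 * (x$1 * x$1 + x$2 * x$2))"
      unfolding c by (simp add: algebra_simps)
    then have h3: "?h3 (B x v) \<noteq> 0"
      using v(4) p by simp
    show False
      by (rule no_bracket_chain[OF K x(1) v(1) h(1) linear_vec_component[of 3] h(2) _ _ _ _ _ _ _ h3 _ i])
        (use p v(2-4) c(1-3) c' in simp_all)
  qed
  \<comment> \<open>Both \<open>v\<close> and \<open>[x, v]\<close> lie in \<open>K\<close>, so they are orthogonal.\<close>
  have compat: "s * (x$2 * w16) = x$1 * w26"
    if K: "lagrangian_subalgebra B \<omega> K" and x: "x \<in> K"
      and v: "v \<in> K" "v$1 = 0" "v$2 = 0" "v$3 \<noteq> 0" for K x v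
  proof -
    have c: "B x v $ 1 = 0" "B x v $ 2 = 0" "B x v $ 3 = 0" "B x v $ 4 = - (x$1 * v$3)"
        "B x v $ 5 = - (x$2 * v$3)"
      using v(2,3) by (simp_all add: B_def form_simps)
    have "0 = \<omega> v (B x v)"
      using lagrangian_subalgebraD(2,3)[OF K] x v(1) by simp
    also have "\<dots> = w34 * (v$3 * B x v $ 4) + w35 * (v$3 * B x v $ 5)"
      using v(2,3) c(1-3) z0 z1 by (simp add: w form6_simps)
    also have "\<dots> = v$3 * v$3 * (x$1 * w26 - s * (x$2 * w16))"
      unfolding c w34 w35 by (simp add: algebra_simps)
    finally show ?thesis
      using v(4) by simp
  qed
  have False
    if F: "lagrangian_subalgebra B \<omega> F" and G: "lagrangian_subalgebra B \<omega> G"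
      and x: "x \<in> F" and y: "y \<in> G" and xy: "x$1 * y$2 - x$2 * y$1 \<noteq> 0"
      and v: "v \<in> F" "v$1 = 0" "v$2 = 0" "v$3 \<noteq> 0" for F G x y v
  proof -
    have x0: "x$1 \<noteq> 0 \<or> x$2 \<noteq> 0" and y0: "y$1 \<noteq> 0 \<or> y$2 \<noteq> 0"
      using xy by auto
    have q: "x$1 * x$1 + s * (x$2 * x$2) = 0"
      by (rule isotropic[OF F x x0 v])
    have s1: "s = - 1"
    proof (rule ccontr)
      assume "s \<noteq> - 1"
      then show False
        using q x0 s by (auto simp: sum_squares_eq_zero_iff)
    qed
    have c: "x$1 * w26 + x$2 * w16 = 0"
      using compat[OF F x v] s1 by simp
    \<comment> \<open>With the relation for \<open>x\<close>, this would be a regular linear system for \<open>w16\<close> and \<open>w26\<close>.\<close>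
    have indep: "w16 = 0 \<and> w26 = 0" if "y$1 * w26 + y$2 * w16 = 0"
    proof -
      have "(x$1 * y$2 - x$2 * y$1) * w16 = x$1 * (y$1 * w26 + y$2 * w16) - y$1 * (x$1 * w26 + x$2 * w16)"
        "(x$1 * y$2 - x$2 * y$1) * w26 = y$2 * (x$1 * w26 + x$2 * w16) - x$2 * (y$1 * w26 + y$2 * w16)"
        by (simp_all add: algebra_simps)
      from this[unfolded that c] show ?thesis
        using xy by simp
    qed
    \<comment> \<open>The first functional forces \<open>t$1 = t$2 = 0\<close>; the second one forces \<open>t$4 = t$5 = 0\<close> if \<open>[y, t] = 0\<close>.\<close>
    have "linear (\<lambda>c::real^6. y$1 * c$1 + y$2 * c$2)" "linear (\<lambda>c::real^6. y$1 * c$5 + y$2 * c$4)"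
      by (intro linear_coordinate_intros)+
    then obtain t where t: "t \<in> G" "t \<noteq> 0" "y$1 * t$1 + y$2 * t$2 = 0" "y$1 * t$5 + y$2 * t$4 = 0"
      by (rule lagrangian_common_zero[OF G])
    have p: "y$1 * y$1 + y$2 * y$2 \<noteq> 0"
      using y0 by (simp add: sum_squares_eq_zero_iff)
    have par: "y$1 * t$2 - y$2 * t$1 = 0"
      by (rule parallel[OF G y t(1)])
    have "(y$1 * y$1 + y$2 * y$2) * t$1 = y$1 * (y$1 * t$1 + y$2 * t$2) - y$2 * (y$1 * t$2 - y$2 * t$1)"
      "(y$1 * y$1 + y$2 * y$2) * t$2 = y$2 * (y$1 * t$1 + y$2 * t$2) + y$1 * (y$1 * t$2 - y$2 * t$1)"
      by (simp_all add: algebra_simps)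
    from this[unfolded t(3) par] have t12: "t$1 = 0" "t$2 = 0"
      using p by auto
    have t3: "t$3 = 0"
    proof (rule ccontr)
      assume "t$3 \<noteq> 0"
      then have "y$1 * w26 + y$2 * w16 = 0"
        using compat[OF G y t(1) t12] s1 by simp
      then show False
        using indep w1626 by blast
    qed
    have u6: "u6 \<in> G"
    proof (cases "y$1 * t$4 - y$2 * t$5 = 0")
      case True
      have "(y$1 * y$1 + y$2 * y$2) * t$4 = y$1 * (y$1 * t$4 - y$2 * t$5) + y$2 * (y$1 * t$5 + y$2 * t$4)"
        "(y$1 * y$1 + y$2 * y$2) * t$5 = y$1 * (y$1 * t$5 + y$2 * t$4) - y$2 * (y$1 * t$4 - y$2 * t$5)"
        by (simp_all add: algebra_simps)
      from this[unfolded t(4) True] have "t$4 = 0" "t$5 = 0"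
        using p by auto
      then have "t = vec6 0 0 0 0 0 (t$6)" "t$6 \<noteq> 0"
        using t(2) t12 t3 by (auto simp: vec6_eq_iff)
      then show ?thesis
        using vec6_last_mem[OF lagrangian_subalgebraD(1)[OF G] t(1)] by blast
    next
      case False
      have "B y t = vec6 0 0 0 0 0 (- (y$1 * t$4 - y$2 * t$5))"
        using t12 t3 s1 by (simp add: vec6_eq_iff B_def form_simps)
      then show ?thesis
        using vec6_last_mem[OF lagrangian_subalgebraD(1)[OF G] lagrangian_subalgebraD(2)[OF G y t(1)]]
            False by simp
    qed
    have d: "y$1 * w16 + y$2 * w26 = 0"
      using lagrangian_subalgebraD(3)[OF G y u6] z0 by (simp add: w form6_simps mult.commute)
    have "(x$1 - x$2) * (x$1 + x$2) = 0"
      using q s1 by (simp add: algebra_simps)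
    then consider "x$1 = x$2" | "x$1 = - x$2"
      by auto
    then have "w16 = 0 \<and> w26 = 0"
    proof cases
      case 1
      then have x2: "x$2 \<noteq> 0"
        using x0 by simp
      then have w: "w16 = - w26"
        using c 1 by (simp flip: distrib_left)
      have "(x$1 * y$2 - x$2 * y$1) * w26 = x$2 * (y$1 * w16 + y$2 * w26)"
        unfolding 1 w by (simp add: algebra_simps)
      from this[unfolded d] show ?thesis
        using xy w by simp
    next
      case 2
      then have x2: "x$2 \<noteq> 0"
        using x0 by simp
      have "x$2 * (w16 - w26) = 0"
        using c 2 by (simp add: algebra_simps)
      then have w: "w16 = w26"
        using x2 by simp
      have "(x$1 * y$2 - x$2 * y$1) * w26 = - x$2 * (y$1 * w16 + y$2 * w26)"
        unfolding 2 w by (simp add: algebra_simps)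
      from this[unfolded d] show ?thesis
        using xy w by simp
    qed
    then show False
      using w1626 by blast
  qed
  note no = this
  \<comment> \<open>The determinants of the projections add up to that of the first two basis vectors, which is \<open>1\<close>.\<close>
  obtain a a' where a: "a \<in> F" "a' \<in> G" "u1 = a + a'"
    using complement by blast
  obtain b b' where b: "b \<in> F" "b' \<in> G" "u2 = b + b'"
    using complement by blast
  have ab: "a'$1 = 1 - a$1" "a'$2 = - a$2" "b'$1 = - b$1" "b'$2 = 1 - b$2"
    using arg_cong[OF a(3), of "\<lambda>v. v$1"] arg_cong[OF a(3), of "\<lambda>v. v$2"]
      arg_cong[OF b(3), of "\<lambda>v. v$1"] arg_cong[OF b(3), of "\<lambda>v. v$2"] by simp_all
  have "(a$1 * b'$2 - a$2 * b'$1) - (b$1 * a'$2 - b$2 * a'$1)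
      = 1 - (a'$1 * b'$2 - a'$2 * b'$1) - (a$1 * b$2 - a$2 * b$1)"
    unfolding ab by (simp add: algebra_simps)
  also have "\<dots> = 1"
    using parallel[OF FG(1) a(1) b(1)] parallel[OF FG(2) a(2) b(2)] by simp
  finally have "a$1 * b'$2 - a$2 * b'$1 \<noteq> 0 \<or> b$1 * a'$2 - b$2 * a'$1 \<noteq> 0"
    by linarith
  then obtain x y where xy: "x \<in> F" "y \<in> G" and det: "x$1 * y$2 - x$2 * y$1 \<noteq> 0"
    using a(1,2) b(1,2) by blast
  obtain f g where fg: "f \<in> F" "g \<in> G" "u3 = f + g"
    using complement by blast
  have g: "g$1 = - f$1" "g$2 = - f$2" "f$3 + g$3 = 1"
    using arg_cong[OF fg(3), of "\<lambda>v. v$1"] arg_cong[OF fg(3), of "\<lambda>v. v$2"]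
      arg_cong[OF fg(3), of "\<lambda>v. v$3"] by simp_all
  have par: "x$1 * f$2 - x$2 * f$1 = 0" "y$1 * f$2 - y$2 * f$1 = 0"
    using parallel[OF FG(1) xy(1) fg(1)] parallel[OF FG(2) xy(2) fg(2)] g by simp_all
  have "(x$1 * y$2 - x$2 * y$1) * f$1 = y$1 * (x$1 * f$2 - x$2 * f$1) - x$1 * (y$1 * f$2 - y$2 * f$1)"
    "(x$1 * y$2 - x$2 * y$1) * f$2 = y$2 * (x$1 * f$2 - x$2 * f$1) - x$2 * (y$1 * f$2 - y$2 * f$1)"
    by (simp_all add: algebra_simps)
  from this[unfolded par] have f0: "f$1 = 0" "f$2 = 0"
    using det by simp_all
  have det': "y$1 * x$2 - y$2 * x$1 \<noteq> 0"
    using det by (simp add: mult.commute)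
  show False
  proof (cases "f$3 = 0")
    case False
    then show False
      by (rule no[OF FG(1,2) xy det fg(1) f0])
  next
    case True
    then have "g$3 \<noteq> 0"
      using g(3) by simp
    then show False
      using no[OF FG(2,1) xy(2,1) det' fg(2)] g f0 by simp
  qed
qed

lemma no_bi_lagrangian_L6_17_plus: "\<not> admits_bi_lagrangian L6_17_plus"
proof -
  have "L6_17_plus = lie6 (\<alpha> 1 2) (\<alpha> 1 3) (\<alpha> 2 3) (\<lambda>x y. \<alpha> 1 4 x y + 1 * \<alpha> 2 5 x y)"
    by (simp add: L6_17_plus_def plus_fun_def)
  then show ?thesis
    using no_bi_lagrangian_17[of 1] by simp
qed

lemma no_bi_lagrangian_L6_17_minus: "\<not> admits_bi_lagrangian L6_17_minus"
proof -
  have "L6_17_minus = lie6 (\<alpha> 1 2) (\<alpha> 1 3) (\<alpha> 2 3) (\<lambda>x y. \<alpha> 1 4 x y + (- 1) * \<alpha> 2 5 x y)"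
    by (simp add: L6_17_minus_def fun_diff_def)
  then show ?thesis
    using no_bi_lagrangian_17[of "- 1"] by simp
qed

section \<open>The algebras of dimension two and four\<close>

lemma nilpotent_4I:
  fixes B :: "4 bracket"
  assumes lie: "lie_algebra B"
    and "\<And>x y. B x y $ 1 = 0" "\<And>x y. B x y $ 2 = 0"
    and "\<And>x y. y$1 = 0 \<Longrightarrow> y$2 = 0 \<Longrightarrow> B x y $ 3 = 0"
    and "\<And>x y. y$1 = 0 \<Longrightarrow> y$2 = 0 \<Longrightarrow> y$3 = 0 \<Longrightarrow> B x y $ 4 = 0"
  shows "nilpotent_lie_algebra B"
proof -
  have "lower_central_series B 0 \<subseteq> coordinate_subspace UNIV"
    by (simp add: coordinate_subspace_def)
  then have "lower_central_series B (Suc 0) \<subseteq> coordinate_subspace {3, 4}"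
    by (rule lower_central_series_step) (use assms in \<open>simp add: coordinate_subspace_def forall_4\<close>)
  then have "lower_central_series B (Suc (Suc 0)) \<subseteq> coordinate_subspace {4}"
    by (rule lower_central_series_step) (use assms in \<open>simp add: coordinate_subspace_def forall_4\<close>)
  then have "lower_central_series B (Suc (Suc (Suc 0))) \<subseteq> coordinate_subspace {}"
    by (rule lower_central_series_step) (use assms in \<open>simp add: coordinate_subspace_def forall_4\<close>)
  then show ?thesis
    by (rule nilpotent_if_series_vanishes[OF lie])
qed

lemma component_4I:
  assumes "P 1" "P 2" "P 3" "P 4"
  shows "P (i::4)"
  using assms forall_4[of P] by blast

lemma nilpotent_4_nilpotent:
  "nilpotent_lie_algebra A4" "nilpotent_lie_algebra L3_S_A1" "nilpotent_lie_algebra L4"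
proof -
  have "lie_algebra A4" "lie_algebra L3_S_A1" "lie_algebra L4"
    unfolding A4_def L3_S_A1_def L4_def
    by (rule lie_algebra_componentI; rule component_4I; simp add: \<alpha>_def algebra_simps)+
  from this[THEN nilpotent_4I]
  show "nilpotent_lie_algebra A4" "nilpotent_lie_algebra L3_S_A1" "nilpotent_lie_algebra L4"
    by (simp_all add: A4_def L3_S_A1_def L4_def \<alpha>_def)
qed

lemma nilpotent_A2: "nilpotent_lie_algebra A2"
proof -
  have zero: "A2 x y = 0" for x y
    by (simp add: vec_eq_iff A2_def bracket_of_def)
  have "lie_algebra A2"
    by (rule lie_algebra_componentI) (simp_all add: zero)
  moreover have "lower_central_series A2 (Suc 0) \<subseteq> coordinate_subspace {}"
    unfolding lower_central_series.simps
    by (rule span_minimal[OF _ subspace_coordinate_subspace]) (auto simp: zero coordinate_subspace_def)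
  ultimately show ?thesis
    by (rule nilpotent_if_series_vanishes)
qed

text \<open>Being abelian and being two-step nilpotent distinguish the three algebras of dimension
  four.\<close>

lemma isomorphic_nilpotency_class:
  assumes "lie_isomorphic b b'"
  shows "(\<forall>x y. b x y = 0) \<longleftrightarrow> (\<forall>x y. b' x y = 0)"
    and "(\<forall>x y z. b (b x y) z = 0) \<longleftrightarrow> (\<forall>x y z. b' (b' x y) z = 0)"
proof -
  obtain \<phi> where "lie_isomorphism b b' \<phi>"
    using assms unfolding lie_isomorphic_def lie_isomorphism_def by blast
  then interpret lie_isomorphism b b' \<phi> .
  show "(\<forall>x y. b x y = 0) \<longleftrightarrow> (\<forall>x y. b' x y = 0)"
    by transfer_prover
  show "(\<forall>x y z. b (b x y) z = 0) \<longleftrightarrow> (\<forall>x y z. b' (b' x y) z = 0)"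
    by transfer_prover
qed

lemma isomorphic_nilpotent_4_eq:
  assumes "L \<in> nilpotent_4" "L' \<in> nilpotent_4" "lie_isomorphic L L'"
  shows "L = L'"
proof -
  have A: "A4 x y = 0" for x y
    by (simp add: A4_def vec4_eq_iff)
  have B: "L3_S_A1 (L3_S_A1 x y) z = 0" for x y z
    by (simp add: L3_S_A1_def \<alpha>_def vec4_eq_iff)
  have "L3_S_A1 v1 v2 $ 4 \<noteq> 0"
    by (simp add: L3_S_A1_def \<alpha>_def)
  then have B': "L3_S_A1 v1 v2 \<noteq> 0"
    by auto
  have "L4 (L4 v1 v2) v1 $ 4 \<noteq> 0"
    by (simp add: L4_def \<alpha>_def)
  then have C: "L4 (L4 v1 v2) v1 \<noteq> 0"
    by auto
  have C': "L4 v1 v2 \<noteq> 0"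
  proof
    assume "L4 v1 v2 = 0"
    then have "L4 (L4 v1 v2) v1 $ 4 = 0"
      by (simp add: L4_def \<alpha>_def)
    then show False
      using \<open>L4 (L4 v1 v2) v1 $ 4 \<noteq> 0\<close> by blast
  qed
  note inv = isomorphic_nilpotency_class[OF assms(3)]
  consider "L = A4" | "L = L3_S_A1" | "L = L4"
    using assms(1) unfolding nilpotent_4_def by blast
  then show ?thesis
  proof cases
    case 1
    have "L' v1 v2 = 0"
      using inv(1) A unfolding 1 by blast
    then show ?thesis
      using assms(2) B' C' unfolding 1 nilpotent_4_def by blast
  next
    case 2
    have "L' (L' v1 v2) v1 = 0" "\<exists>x y. L' x y \<noteq> 0"
      using inv B B' unfolding 2 by blast+
    then show ?thesis
      using assms(2) A C unfolding 2 nilpotent_4_def by blast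
  next
    case 3
    have "\<exists>x y z. L' (L' x y) z \<noteq> 0" "\<exists>x y. L' x y \<noteq> 0"
      using inv C C' unfolding 3 by blast+
    then show ?thesis
      using assms(2) A B unfolding 3 nilpotent_4_def by blast
  qed
qed

lemma card_nilpotent_4: "card nilpotent_4 = 3"
proof -
  have "A4 v1 v2 $ 3 \<noteq> L4 v1 v2 $ 3" "L3_S_A1 v1 v2 $ 3 \<noteq> L4 v1 v2 $ 3" "A4 v1 v2 $ 4 \<noteq> L3_S_A1 v1 v2 $ 4"
    by (simp_all add: A4_def L4_def L3_S_A1_def \<alpha>_def)
  then have "A4 \<noteq> L4" "L3_S_A1 \<noteq> L4" "A4 \<noteq> L3_S_A1"
    by metis+
  then show ?thesis
    by (simp add: nilpotent_4_def)
qed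

text \<open>Closedness makes the last basis vector orthogonal to all but the first. For \<open>x\<close> and \<open>y\<close> in
  a Lagrangian plane with \<open>x$1 \<noteq> 0 = y$1\<close>, the bracket \<open>[x, y]\<close> cannot be independent of both, so
  \<open>y\<close> is a multiple of the last basis vector, which is not orthogonal to \<open>x\<close>.\<close>

lemma no_bi_lagrangian_L4: "\<not> admits_bi_lagrangian L4"
proof
  assume "admits_bi_lagrangian L4"
  then obtain \<omega> F G where s: "bi_lagrangian_structure L4 \<omega> F G"
    unfolding admits_bi_lagrangian_def by blast
  have \<omega>: "bilinear \<omega>" "\<And>x. \<omega> x x = 0"
    and closed: "\<And>x y z. \<omega> (L4 x y) z + \<omega> (L4 y z) x + \<omega> (L4 z x) y = 0"
    and nondeg: "\<And>x. \<forall>y. \<omega> x y = 0 \<Longrightarrow> x = 0"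
    using s unfolding bi_lagrangian_structure_def symplectic_form_def by blast+
  have lag: "lagrangian_subalgebra L4 \<omega> F" "lagrangian_subalgebra L4 \<omega> G"
    and complement: "\<And>x. \<exists>y\<in>F. \<exists>z\<in>G. x = y + z"
    using s unfolding bi_lagrangian_structure_def lagrangian_subalgebra_def by blast+
  interpret b: bounded_bilinear \<omega>
    using \<omega>(1) by (simp add: bilinear_conv_bounded_bilinear)
  have br: "L4 v1 v2 = - v3" "L4 v1 v3 = - v4" "L4 v3 v1 = v4" "L4 v2 v4 = 0" "L4 v4 v1 = 0" "L4 v2 v3 = 0"
    by (simp_all add: vec4_eq_iff L4_def \<alpha>_def)
  have "\<omega> v3 v4 = 0"
    using closed[of v1 v2 v4] by (simp add: br b.minus_left b.zero_left)
  have skew: "\<omega> x y = - \<omega> y x" for x y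
  proof -
    have "\<omega> (x + y) (x + y) = \<omega> x y + \<omega> y x"
      unfolding b.add_left b.add_right by (simp add: \<omega>(2))
    then show ?thesis
      using \<omega>(2)[of "x + y"] by linarith
  qed
  have v43: "\<omega> v4 v3 = 0"
    using \<open>\<omega> v3 v4 = 0\<close> skew[of v4 v3] by simp
  have v42: "\<omega> v4 v2 = 0"
    using closed[of v1 v2 v3] by (simp add: br b.minus_left b.zero_left \<omega>(2))
  have \<omega>4: "\<omega> v4 x = x$1 * \<omega> v4 v1" for x
  proof -
    have "x = x$1 *\<^sub>R v1 + x$2 *\<^sub>R v2 + x$3 *\<^sub>R v3 + x$4 *\<^sub>R v4"
      by (simp add: vec4_eq_iff)
    then have "\<omega> v4 x = \<omega> v4 (x$1 *\<^sub>R v1 + x$2 *\<^sub>R v2 + x$3 *\<^sub>R v3 + x$4 *\<^sub>R v4)"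
      by simp
    then show ?thesis
      by (simp add: b.add_right b.scaleR_right v43 v42 \<omega>(2))
  qed
  have v41: "\<omega> v4 v1 \<noteq> 0"
  proof
    assume *: "\<omega> v4 v1 = 0"
    have "\<omega> v4 x = 0" for x
      unfolding \<omega>4[of x] by (simp add: *)
    then have "v4 = 0"
      using nondeg[of v4] by blast
    then show False
      by (simp add: vec4_eq_iff)
  qed
  have False if K: "lagrangian_subalgebra L4 \<omega> K" and x: "x \<in> K" "x$1 \<noteq> 0" for K x
  proof -
    have sub: "subspace K" and closedK: "\<And>x y. x \<in> K \<Longrightarrow> y \<in> K \<Longrightarrow> L4 x y \<in> K"
      and iso: "\<And>x y. x \<in> K \<Longrightarrow> y \<in> K \<Longrightarrow> \<omega> x y = 0" and dim: "dim K = 2"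
      using K by (auto simp: lagrangian_subalgebra_def lie_subalgebra_def lagrangian_def)
    have "\<exists>y\<in>K. y \<noteq> 0 \<and> (\<forall>i\<in>{1::4}. y $ i = 0)"
      using sub dim by (intro exists_common_zero linear_vec_component) auto
    then obtain y where y: "y \<in> K" "y \<noteq> 0" "y$1 = 0"
      by auto
    have three: "L4 x y = 0" if "h y \<noteq> 0" "h (L4 x y) = 0" "linear h" for h :: "real^4 \<Rightarrow> real"
    proof (rule ccontr)
      assume nz: "L4 x y \<noteq> 0"
      have 3: "independent {L4 x y}"
        using nz by (simp add: dependent_single)
      have 2: "independent {y, L4 x y}" "y \<notin> {L4 x y}"
        using independent_insert_functional[OF 3 that(3,1)] that(2) by auto
      have "L4 x y $ 1 = 0"
        by (simp add: L4_def)
      then have 1: "independent {x, y, L4 x y}" "x \<notin> {y, L4 x y}"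
        using independent_insert_functional[OF 2(1) linear_vec_component[of 1] x(2)] y(3) by auto
      have "card {x, y, L4 x y} = 3"
        using 1(2) 2(2) by simp
      moreover have "card {x, y, L4 x y} \<le> dim K"
        using independent_card_le_dim[OF _ 1(1), of K] x(1) y(1) closedK[OF x(1) y(1)] by simp
      ultimately show False
        using dim by simp
    qed
    have c: "L4 x y $ 1 = 0" "L4 x y $ 2 = 0" "L4 x y $ 3 = - (x$1 * y$2)" "L4 x y $ 4 = - (x$1 * y$3)"
      using y(3) by (simp_all add: L4_def \<alpha>_def)
    have y2: "y$2 = 0"
      using three[OF _ c(2) linear_vec_component] c(3) x(2) by force
    have y3: "y$3 = 0"
      using three[OF _ _ linear_vec_component[of 3]] c(3,4) y2 x(2) by force
    have "y = y$4 *\<^sub>R v4" "y$4 \<noteq> 0"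
      using y(2,3) y2 y3 by (auto simp: vec4_eq_iff)
    then have "y$4 * \<omega> v4 x = 0"
      using iso[OF y(1) x(1)] b.scaleR_left[of "y$4" v4 x] by simp
    then have "y$4 * (x$1 * \<omega> v4 v1) = 0"
      unfolding \<omega>4[of x] .
    then show False
      using v41 x(2) \<open>y$4 \<noteq> 0\<close> by simp
  qed
  moreover obtain x where "x \<in> F \<or> x \<in> G" "x$1 \<noteq> 0"
    by (rule complement_component[OF complement])
  ultimately show False
    using lag by blast
qed

section \<open>Bi-Lagrangian structures up to dimension six\<close>

lemma listed_bi_lagrangian:
  "L \<in> {A6, L3_S_A3, L5_2_S_A1, L3_S_L3, L6_1, L6_2, L5_3_S_A1, L6_4, L6_5, L6_6,
     L6_9, L6_10, L6_11, L6_12, L5_4_S_A1, L6_16} \<Longrightarrow> admits_bi_lagrangian L"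
  by (elim insertE emptyE; simp add: bi_lagrangian_A6 bi_lagrangian_L3_S_A3 bi_lagrangian_L5_2_S_A1
      bi_lagrangian_L3_S_L3
    bi_lagrangian_L6_1 bi_lagrangian_L6_2 bi_lagrangian_L5_3_S_A1 bi_lagrangian_L6_4
    bi_lagrangian_L6_5 bi_lagrangian_L6_6 bi_lagrangian_L6_9 bi_lagrangian_L6_10
    bi_lagrangian_L6_11 bi_lagrangian_L6_12 bi_lagrangian_L5_4_S_A1 bi_lagrangian_L6_16)

lemma listed_no_bi_lagrangian:
  "L \<in> {L4_S_A2, L6_13, L5_6_S_A1, L6_14, L6_15, L6_17_plus, L6_17_minus, L6_18, L6_19, L6_21} \<Longrightarrow>
    \<not> admits_bi_lagrangian L"
  by (elim insertE emptyE; simp add: no_bi_lagrangian_L4_S_A2 no_bi_lagrangian_L6_13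
      no_bi_lagrangian_L5_6_S_A1
    no_bi_lagrangian_L6_14 no_bi_lagrangian_L6_15 no_bi_lagrangian_L6_17_plus
    no_bi_lagrangian_L6_17_minus no_bi_lagrangian_L6_18 no_bi_lagrangian_L6_19 no_bi_lagrangian_L6_21)

theorem theorem1p4:
  shows
  "(nilpotent_lie_algebra A2 \<and>
    (\<forall>br :: 'a::real_vector \<Rightarrow> 'a \<Rightarrow> 'a.
       nilpotent_lie_algebra br \<and> dim (UNIV :: 'a set) = 2 \<longrightarrow> lie_isomorphic br A2) \<and>
    admits_bi_lagrangian A2) \<and>

   (card nilpotent_4 = 3 \<and>
    (\<forall>L\<in>nilpotent_4. nilpotent_lie_algebra L \<and> admits_symplectic L) \<and>
    (\<forall>L\<in>nilpotent_4. \<forall>L'\<in>nilpotent_4. lie_isomorphic L L' \<longrightarrow> L = L') \<and>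
    (\<forall>br :: 'b::real_vector \<Rightarrow> 'b \<Rightarrow> 'b.
       nilpotent_lie_algebra br \<and> dim (UNIV :: 'b set) = 4 \<longrightarrow>
       (\<exists>L\<in>nilpotent_4. lie_isomorphic br L)) \<and>
    {L \<in> nilpotent_4. admits_bi_lagrangian L} = {A4, L3_S_A1} \<and>
    {L \<in> nilpotent_4. \<not> admits_bi_lagrangian L} = {L4}) \<and>

   (card symplectic_nilpotent_6 = 26 \<and>
    (\<forall>L\<in>symplectic_nilpotent_6. nilpotent_lie_algebra L \<and> admits_symplectic L) \<and>
    (\<forall>L\<in>symplectic_nilpotent_6. \<forall>L'\<in>symplectic_nilpotent_6.
       lie_isomorphic L L' \<longrightarrow> L = L') \<and>
    (\<forall>br :: 'c::real_vector \<Rightarrow> 'c \<Rightarrow> 'c.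
       nilpotent_lie_algebra br \<and> dim (UNIV :: 'c set) = 6 \<and> admits_symplectic br \<longrightarrow>
       (\<exists>L\<in>symplectic_nilpotent_6. lie_isomorphic br L)) \<and>
    {L \<in> symplectic_nilpotent_6. admits_bi_lagrangian L} =
      {A6, L3_S_A3, L5_2_S_A1, L3_S_L3, L6_1, L6_2, L5_3_S_A1, L6_4, L6_5, L6_6,
       L6_9, L6_10, L6_11, L6_12, L5_4_S_A1, L6_16} \<and>
    card {L \<in> symplectic_nilpotent_6. admits_bi_lagrangian L} = 16 \<and>
    {L \<in> symplectic_nilpotent_6. \<not> admits_bi_lagrangian L} =
      {L4_S_A2, L6_13, L5_6_S_A1, L6_14, L6_15, L6_17_plus, L6_17_minus, L6_18, L6_19, L6_21} \<and>
    card {L \<in> symplectic_nilpotent_6. \<not> admits_bi_lagrangian L} = 10)"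
proof (intro conjI ballI allI impI)
  let ?Y = "{A6, L3_S_A3, L5_2_S_A1, L3_S_L3, L6_1, L6_2, L5_3_S_A1, L6_4, L6_5, L6_6,
    L6_9, L6_10, L6_11, L6_12, L5_4_S_A1, L6_16}"
  let ?N = "{L4_S_A2, L6_13, L5_6_S_A1, L6_14, L6_15, L6_17_plus, L6_17_minus, L6_18, L6_19, L6_21}"
  have union: "symplectic_nilpotent_6 = ?Y \<union> ?N"
    unfolding symplectic_nilpotent_6_def by blast
  show Y: "{L \<in> symplectic_nilpotent_6. admits_bi_lagrangian L} = ?Y"
    and N: "{L \<in> symplectic_nilpotent_6. \<not> admits_bi_lagrangian L} = ?N"
    unfolding union using listed_bi_lagrangian listed_no_bi_lagrangian by blast+
  have "card (set [A6, L3_S_A3, L5_2_S_A1, L3_S_L3, L6_1, L6_2, L5_3_S_A1, L6_4, L6_5, L6_6,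
      L6_9, L6_10, L6_11, L6_12, L5_4_S_A1, L6_16]) \<le> 16"
    by (rule order_trans[OF card_length]) simp
  then have Y16: "card ?Y \<le> 16"
    by (simp only: list.set)
  have "card (set [L4_S_A2, L6_13, L5_6_S_A1, L6_14, L6_15, L6_17_plus, L6_17_minus, L6_18,
      L6_19, L6_21]) \<le> 10"
    by (rule order_trans[OF card_length]) simp
  then have N10: "card ?N \<le> 10"
    by (simp only: list.set)
  \<comment> \<open>The two sets have at most \<open>16\<close> and \<open>10\<close> elements, and \<open>26\<close> together.\<close>
  have "26 \<le> card ?Y + card ?N"
    using card_Un_le[of ?Y ?N] card_symplectic_nilpotent_6 unfolding union by (simp only:)
  then show "card {L \<in> symplectic_nilpotent_6. admits_bi_lagrangian L} = 16"
    and "card {L \<in> symplectic_nilpotent_6. \<not> admits_bi_lagrangian L} = 10"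
    unfolding Y N using Y16 N10 by linarith+
  have 4: "\<And>L. L \<in> nilpotent_4 \<longleftrightarrow> L = A4 \<or> L = L3_S_A1 \<or> L = L4"
    by (auto simp: nilpotent_4_def)
  show "{L \<in> nilpotent_4. admits_bi_lagrangian L} = {A4, L3_S_A1}"
    and "{L \<in> nilpotent_4. \<not> admits_bi_lagrangian L} = {L4}"
    unfolding 4 using admits_bi_lagrangian_A4 admits_bi_lagrangian_L3_S_A1 no_bi_lagrangian_L4 by blast+
  show "nilpotent_lie_algebra L" "admits_symplectic L" if "L \<in> nilpotent_4" for L
    using that symplectic_A4 symplectic_L3_S_A1 symplectic_L4 nilpotent_4_nilpotent
    unfolding 4 admits_symplectic_def by blast+
  show "nilpotent_lie_algebra L" "admits_symplectic L" if "L \<in> symplectic_nilpotent_6" for L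
    using that listed_nilpotent listed_admits_symplectic
    unfolding symplectic_nilpotent_6_def by (elim insertE emptyE, simp_all)
qed (simp_all add: nilpotent_A2 classification_dim_2 admits_bi_lagrangian_A2 card_nilpotent_4
    isomorphic_nilpotent_4_eq classification_dim_4 card_symplectic_nilpotent_6 isomorphic_listed_eq
    classification_dim_6)

end
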